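(* Let $M$ be a piecewise flat Finsler surface and $T_xM$ the tangent cone at a vertex $x\in M$. Then a maximally extended geodesic in $T_xM$ must be one of the following: (1) A geodesic defined on $(-\infty,\infty)$, not passing through $x$, of the form $$R_{x_1,v_1^-}\cup\Big(\bigcup_{i=1}^{m-1}L_{x_i,x_{i+1}}\Big)\cup R_{x_m,v_m^+},$$ where $R_{x_1,v_1^-},L_{x_1,x_2},\ldots,L_{x_{m-1},x_m},R_{x_m,v_m^+}$ are contained in Minkowski cones $C_{x,0},C_{x,1},\ldots,C_{x,m}$ of $T_xM$ respectively, each $x_i\neq x$ is contained in the edge $E_i=C_{x,i-1}\cap C_{x,i}$, and none of these line segments and rays is contained in an edge. (2) A ray $R_{x,v^\pm}$, where $v^\pm$ is a nonzero incoming or outgoing tangent vector at $x$. (3) The union of two rays $R_{x,v^-}\cup R_{x,v^+}$, where $v^-$ and $v^+$ are nonzero incoming and outgoing tangent vectors at $x$ respectively.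
   Context: A Minkowski norm on a finite-dimensional real vector space $V$ is a continuous $F:V\to[0,\infty)$, smooth and positive on $V\setminus\{0\}$, with $F(\lambda y)=\lambda F(y)$ for $\lambda\ge0$, such that for every $y\ne0$ the bilinear form $\langle u,v\rangle^F_y=\frac12\frac{\partial^2}{\partial s\partial t}F^2(y+su+tv)|_{s=t=0}$ is positive definite ($F(-y)=F(y)$ is not required). A Minkowski plane is $\mathbb R^2$ with the translation-invariant Finsler metric given by a Minkowski norm. A piecewise flat Finsler surface is a surface $M$ (without boundary) with a locally finite triangulation $M=\bigcup T_i$ by closed triangles, different triangles being disjoint or meeting in exactly one common edge or one common vertex, where each $T_i$ carries a flat metric $F_i$ such that $(T_i,F_i)$ is isometric to a straight-edged triangle in a Minkowski plane, and $F_i,F_j$ coincide on a common edge of $T_i,T_j$. Tangent cone: let $(T_1,F_1),\dots,(T_n,F_n)$ be the closed triangles containing $x$. Each is enlarged to a Minkowski cone $C_{x,i}$ with vertex $x$ (the planar sector at $x$ spanned by $T_i$) with $F_i$ extended to it; $T_xM=\bigcup_i C_{x,i}$, glued along common boundary rays. For $i\ne j$, $C_{x,i}\cap C_{x,j}$ is $\{x\}$ or a ray at $x$, called an edge. When $x$ is a vertex of $M$ there are at least three cones. In (1) the cones are indexed consecutively in the order they are met around $x$, with repetitions allowed. A piecewise smooth curve is locally a finite union of smooth curves on closed intervals, each in a single cone; its length is $\int F(\dot c)\,dt$ (using the norm of the cone), and $d(p,q)$ is the infimum of lengths of piecewise smooth paths from $p$ to $q$. A geodesic is a piecewise smooth curve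 with constant nonzero speed that is locally minimizing: every $t_0$ has an $\varepsilon>0$ such that for $t_1<t_2$ in the domain within $\varepsilon$ of $t_0$ the length of $c|_{[t_1,t_2]}$ equals $d(c(t_1),c(t_2))$. An outgoing (incoming) tangent vector at $p$ is an arrow in a cone starting (ending) at $p$. $L_{p,q}$ is the straight segment from $p$ to $q$ in a cone; $R_{p,v^+}$ is the ray starting at $p$ in direction of the outgoing vector $v^+$; $R_{p,v^-}$ is the ray ending at $p$ with direction the incoming vector $v^-$. *)

theory Defs
  imports "HOL-Analysis.Analysis"
begin

text \<open>Derivatives are taken within \<open>S\<close>, so that for a compact interval \<open>S\<close> they are one-sided at the
  end points. The notion is meant for open sets \<open>S\<close> and for nondegenerate closed intervals, where
  derivatives within \<open>S\<close> are unique.\<close>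

primrec Ck_on :: "nat \<Rightarrow> 'a::real_normed_vector set \<Rightarrow> ('a \<Rightarrow> 'b::real_normed_vector) \<Rightarrow> bool" where
  "Ck_on 0 S f \<longleftrightarrow> continuous_on S f"
| "Ck_on (Suc k) S f \<longleftrightarrow>
     (\<exists>f'. (\<forall>x\<in>S. (f has_derivative f' x) (at x within S)) \<and> (\<forall>v. Ck_on k S (\<lambda>x. f' x v)))"

definition smooth_on :: "'a::real_normed_vector set \<Rightarrow> ('a \<Rightarrow> 'b::real_normed_vector) \<Rightarrow> bool" where
  "smooth_on S f \<longleftrightarrow> (\<forall>k. Ck_on k S f)"

definition fundamental_form ::
    "('v::real_normed_vector \<Rightarrow> real) \<Rightarrow> 'v \<Rightarrow> 'v \<Rightarrow> 'v \<Rightarrow> real" where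
  "fundamental_form F y u v =
     1/2 * deriv (\<lambda>s. deriv (\<lambda>t. (F (y + s *\<^sub>R u + t *\<^sub>R v))\<^sup>2) 0) 0"

definition minkowski_norm :: "('v::euclidean_space \<Rightarrow> real) \<Rightarrow> bool" where
  "minkowski_norm F \<longleftrightarrow>
     continuous_on UNIV F \<and> (\<forall>y. 0 \<le> F y) \<and>
     smooth_on (- {0}) F \<and> (\<forall>y. y \<noteq> 0 \<longrightarrow> 0 < F y) \<and>
     (\<forall>y r. 0 \<le> r \<longrightarrow> F (r *\<^sub>R y) = r * F y) \<and>
     (\<forall>y u. y \<noteq> 0 \<longrightarrow> u \<noteq> 0 \<longrightarrow> 0 < fundamental_form F y u u)"

text \<open>A triangle is a subset of the surface. The flat metric on a triangle \<open>T\<close> is given by an isometry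
  \<open>chart M T\<close> onto a straight-edged triangle of the Minkowski plane \<open>(\<real>\<^sup>2, fnorm M T)\<close>.\<close>

record 'a pf_surface =
  surf :: "'a topology"
  triangles :: "'a set set"
  chart :: "'a set \<Rightarrow> 'a \<Rightarrow> real^2"
  fnorm :: "'a set \<Rightarrow> real^2 \<Rightarrow> real"

definition topological_surface :: "'a topology \<Rightarrow> bool" where
  "topological_surface X \<longleftrightarrow>
     Hausdorff_space X \<and> second_countable X \<and>
     (\<forall>p\<in>topspace X. \<exists>U. openin X U \<and> p \<in> U \<and>
        (\<exists>V :: (real^2) set. open V \<and> subtopology X U homeomorphic_space top_of_set V))"

definition tri_vertices :: "'a pf_surface \<Rightarrow> 'a set \<Rightarrow> 'a set" where
  "tri_vertices M T = {p \<in> T. chart M T p extreme_point_of (chart M T ` T)}"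

definition tri_edges :: "'a pf_surface \<Rightarrow> 'a set \<Rightarrow> 'a set set" where
  "tri_edges M T = {e. e \<subseteq> T \<and> (chart M T ` e) edge_of (chart M T ` T)}"

text \<open>In the last clause, \<open>fnorm M T (chart M T q - chart M T p)\<close> is the length, for the metric of
  \<open>T\<close>, of the part of the common edge running from \<open>p\<close> to \<open>q\<close> (in that direction, as the norms
  need not be reversible).\<close>

definition pf_finsler_surface :: "'a pf_surface \<Rightarrow> bool" where
  "pf_finsler_surface M \<longleftrightarrow>
     topological_surface (surf M) \<and>
     \<Union> (triangles M) = topspace (surf M) \<and>
     (\<forall>p\<in>topspace (surf M). \<exists>U. openin (surf M) U \<and> p \<in> U \<and>
        finite {T \<in> triangles M. T \<inter> U \<noteq> {}}) \<and>
     (\<forall>T\<in>triangles M.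
        minkowski_norm (fnorm M T) \<and>
        (\<exists>A B C. \<not> collinear {A, B, C} \<and>
           homeomorphic_map (subtopology (surf M) T) (top_of_set (convex hull {A, B, C}))
             (chart M T))) \<and>
     (\<forall>T\<in>triangles M. \<forall>T'\<in>triangles M. T \<noteq> T' \<longrightarrow>
        T \<inter> T' = {} \<or>
        T \<inter> T' \<in> tri_edges M T \<inter> tri_edges M T' \<or>
        (\<exists>p \<in> tri_vertices M T \<inter> tri_vertices M T'. T \<inter> T' = {p})) \<and>
     (\<forall>T\<in>triangles M. \<forall>T'\<in>triangles M. T \<noteq> T' \<longrightarrow>
        T \<inter> T' \<in> tri_edges M T \<inter> tri_edges M T' \<longrightarrow>
        (\<forall>p \<in> T \<inter> T'. \<forall>q \<in> T \<inter> T'.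
           fnorm M T (chart M T q - chart M T p) = fnorm M T' (chart M T' q - chart M T' p)))"

definition pf_vertices :: "'a pf_surface \<Rightarrow> 'a set" where
  "pf_vertices M = (\<Union>T \<in> triangles M. tri_vertices M T)"

definition star :: "'a pf_surface \<Rightarrow> 'a \<Rightarrow> 'a set set" where
  "star M x = {T \<in> triangles M. x \<in> T}"

text \<open>The sector spanned by \<open>T\<close> at \<open>x\<close>, in the coordinates of \<open>T\<close> translated such that \<open>x\<close> becomes
  the origin.\<close>

definition sector :: "'a pf_surface \<Rightarrow> 'a \<Rightarrow> 'a set \<Rightarrow> (real^2) set" where
  "sector M x T = {t *\<^sub>R (chart M T q - chart M T x) | t q. 0 \<le> t \<and> q \<in> T}"

text \<open>For \<open>T = T'\<close> this is the identity on the sector. For \<open>T \<noteq> T'\<close> it identifies the boundary rays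
  of the two sectors along a common edge of \<open>T\<close> and \<open>T'\<close>, or just the two origins if
  \<open>T \<inter> T' = {x}\<close>.\<close>

definition glue :: "'a pf_surface \<Rightarrow> 'a \<Rightarrow> (('a set \<times> (real^2)) \<times> ('a set \<times> (real^2))) set" where
  "glue M x = {((T, a), (T', b)) | T a T' b. T \<in> star M x \<and> T' \<in> star M x \<and>
     (\<exists>q \<in> T \<inter> T'. \<exists>t\<ge>0. a = t *\<^sub>R (chart M T q - chart M T x) \<and>
                           b = t *\<^sub>R (chart M T' q - chart M T' x))}"

text \<open>A point \<open>p\<close> of the tangent cone is a class of the gluing; \<open>(T, a) \<in> p\<close> means that \<open>p\<close> lies in
  the cone of \<open>T\<close> and has the coordinate vector \<open>a\<close> there.\<close>

type_synonym 'a tpoint = "('a set \<times> (real^2)) set"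

definition tangent_cone :: "'a pf_surface \<Rightarrow> 'a \<Rightarrow> 'a tpoint set" where
  "tangent_cone M x = (SIGMA T:star M x. sector M x T) // glue M x"

definition apex :: "'a pf_surface \<Rightarrow> 'a \<Rightarrow> 'a tpoint" where
  "apex M x = star M x \<times> {0}"

definition mcone :: "'a pf_surface \<Rightarrow> 'a \<Rightarrow> 'a set \<Rightarrow> 'a tpoint set" where
  "mcone M x T = {p \<in> tangent_cone M x. \<exists>a. (T, a) \<in> p}"

definition cone_edges :: "'a pf_surface \<Rightarrow> 'a \<Rightarrow> 'a tpoint set set" where
  "cone_edges M x =
     {mcone M x T \<inter> mcone M x T' | T T'. T \<in> star M x \<and> T' \<in> star M x \<and> T \<noteq> T'} - {{apex M x}}"

definition smooth_piece ::
    "'a pf_surface \<Rightarrow> 'a \<Rightarrow> (real \<Rightarrow> 'a tpoint) \<Rightarrow> 'a set \<Rightarrow> real \<Rightarrow> real \<Rightarrow> (real \<Rightarrow> real^2) \<Rightarrow> bool"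
  where
  "smooth_piece M x c T a b g \<longleftrightarrow>
     a < b \<and> smooth_on {a..b} g \<and> (\<forall>t\<in>{a..b}. c t \<in> tangent_cone M x \<and> (T, g t) \<in> c t)"

definition piece_speed ::
    "'a pf_surface \<Rightarrow> 'a set \<Rightarrow> real \<Rightarrow> real \<Rightarrow> (real \<Rightarrow> real^2) \<Rightarrow> real \<Rightarrow> real" where
  "piece_speed M T a b g t = fnorm M T (vector_derivative g (at t within {a..b}))"

text \<open>\<open>has_length M x c a b L\<close>: on \<open>[a,b]\<close> the curve \<open>c\<close> is a finite concatenation of smooth pieces,
  each in a single cone, and its length is \<open>L\<close>.\<close>

inductive has_length ::
    "'a pf_surface \<Rightarrow> 'a \<Rightarrow> (real \<Rightarrow> 'a tpoint) \<Rightarrow> real \<Rightarrow> real \<Rightarrow> real \<Rightarrow> bool"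
  for M x c where
  piece: "smooth_piece M x c T a b g \<Longrightarrow>
     has_length M x c a b (integral {a..b} (piece_speed M T a b g))"
| join: "has_length M x c a b L \<Longrightarrow> has_length M x c b d L' \<Longrightarrow> has_length M x c a d (L + L')"

definition tdist :: "'a pf_surface \<Rightarrow> 'a \<Rightarrow> 'a tpoint \<Rightarrow> 'a tpoint \<Rightarrow> real" where
  "tdist M x p q = Inf {L. \<exists>c a b. has_length M x c a b L \<and> c a = p \<and> c b = q}"

definition piecewise_smooth :: "'a pf_surface \<Rightarrow> 'a \<Rightarrow> real set \<Rightarrow> (real \<Rightarrow> 'a tpoint) \<Rightarrow> bool" where
  "piecewise_smooth M x D c \<longleftrightarrow> (\<forall>a\<in>D. \<forall>b\<in>D. a < b \<longrightarrow> (\<exists>L. has_length M x c a b L))"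

text \<open>The domain \<open>D\<close> is any nondegenerate interval; the values of \<open>c\<close> outside \<open>D\<close> are irrelevant.\<close>

definition geodesic :: "'a pf_surface \<Rightarrow> 'a \<Rightarrow> real set \<Rightarrow> (real \<Rightarrow> 'a tpoint) \<Rightarrow> bool" where
  "geodesic M x D c \<longleftrightarrow>
     is_interval D \<and> (\<exists>a\<in>D. \<exists>b\<in>D. a < b) \<and>
     piecewise_smooth M x D c \<and>
     (\<exists>\<sigma>>0. \<forall>T a b g. {a..b} \<subseteq> D \<longrightarrow> smooth_piece M x c T a b g \<longrightarrow>
        (\<forall>t\<in>{a..b}. piece_speed M T a b g t = \<sigma>)) \<and>
     (\<forall>t0\<in>D. \<exists>\<epsilon>>0. \<forall>t1\<in>D. \<forall>t2\<in>D. \<bar>t1 - t0\<bar> < \<epsilon> \<longrightarrow> \<bar>t2 - t0\<bar> < \<epsilon> \<longrightarrow> t1 < t2 \<longrightarrow>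
        has_length M x c t1 t2 (tdist M x (c t1) (c t2)))"

definition maximal_geodesic :: "'a pf_surface \<Rightarrow> 'a \<Rightarrow> real set \<Rightarrow> (real \<Rightarrow> 'a tpoint) \<Rightarrow> bool" where
  "maximal_geodesic M x D c \<longleftrightarrow>
     geodesic M x D c \<and>
     \<not> (\<exists>D' c'. D \<subset> D' \<and> geodesic M x D' c' \<and> (\<forall>t\<in>D. c' t = c t))"

text \<open>On \<open>J\<close> the curve \<open>c\<close> moves in the cone of \<open>T\<close> with constant velocity \<open>v \<noteq> 0\<close>. So \<open>c\<close> traverses
  \<^item> for \<open>J = {..t}\<close> the ray ending at \<open>c t\<close> with incoming vector \<open>v\<close>,
  \<^item> for \<open>J = {t..}\<close> the ray starting at \<open>c t\<close> with outgoing vector \<open>v\<close>,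
  \<^item> for \<open>J = {s..t}\<close> the straight segment from \<open>c s\<close> to \<open>c t\<close>.

  If \<open>c t\<close> is the apex, then in the first case \<open>- v\<close> lies in the sector of \<open>T\<close> (an arrow ending at the
  apex), in the second case \<open>v\<close> does.\<close>

definition straight_on ::
    "'a pf_surface \<Rightarrow> 'a \<Rightarrow> (real \<Rightarrow> 'a tpoint) \<Rightarrow> real set \<Rightarrow> 'a set \<Rightarrow> real^2 \<Rightarrow> bool" where
  "straight_on M x c J T v \<longleftrightarrow>
     T \<in> star M x \<and> v \<noteq> 0 \<and>
     (\<exists>a. \<forall>t\<in>J. c t \<in> tangent_cone M x \<and> (T, a + t *\<^sub>R v) \<in> c t)"

definition in_edge :: "'a pf_surface \<Rightarrow> 'a \<Rightarrow> 'a tpoint set \<Rightarrow> bool" where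
  "in_edge M x P \<longleftrightarrow> (\<exists>E \<in> cone_edges M x. P \<subseteq> E)"

text \<open>The cones \<open>C 0, \<dots>, C m\<close> are consecutive around \<open>x\<close>: neighbours are different and share an edge,
  and each cone is entered and left through different edges.\<close>

definition consecutive_cones :: "'a pf_surface \<Rightarrow> 'a \<Rightarrow> nat \<Rightarrow> (nat \<Rightarrow> 'a set) \<Rightarrow> bool" where
  "consecutive_cones M x m C \<longleftrightarrow>
     (\<forall>i\<le>m. C i \<in> star M x) \<and>
     (\<forall>i\<in>{1..m}. C (i - 1) \<noteq> C i \<and> mcone M x (C (i - 1)) \<inter> mcone M x (C i) \<in> cone_edges M x) \<and>
     (\<forall>i\<in>{1..<m}. mcone M x (C (i - 1)) \<inter> mcone M x (C i) \<noteq>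
                   mcone M x (C i) \<inter> mcone M x (C (i + 1)))"

end

theory Submission
  imports Defs
begin

text \<open>Within a cone a geodesic is straight, since the triangle inequality of a Minkowski norm is
  strict. Where it crosses an edge, the first variation gives Snell's law: the functionals \<open>d F\<^sub>v\<close>
  of both velocities agree on the edge. Conversely, a broken line obeying Snell's law minimizes
  locally, because these functionals, clamped by a bump function, form a calibration of the
  tangent cone. Hence a geodesic that ends at a point other than the apex can be continued: the
  refracted velocity exists by minimization, and every edge lies in a second cone by invariance of
  domain. A geodesic that is radial somewhere stays radial as long as it avoids the apex. For all
  others, Snell's law makes \<open>q = d F\<^sub>v(c)\<close> continuous along the geodesic \<open>c\<close>, and it grows with
  the arc length, whereas \<open>F(c)\<close> falls behind the arc length by a definite fraction of \<open>F(c)\<close> at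
  each crossing of a cone. This allows only finitely many crossings.\<close>

subsection \<open>Strictly convex norms\<close>

text \<open>Finsler metrics provide no angle, so crossings cannot be counted by an angle sum; the
  monotone quantities \<open>q\<close> and \<open>r - q\<close> take its place. The norms are also
  not symmetric, so forward and backward statements differ. The backward ones are the forward ones
  for \<open>reverse M\<close>, whose norms are the reflected ones; for this the argument runs on
  \<open>strict_norm\<close> and \<open>cone_structure\<close>, both of which are preserved by
  reversal. Second derivatives enter through the strict triangle inequality of
  \<open>strict_norm\<close>.

  Since \<open>tdist\<close> is an infimum over all curves, upper bounds come from broken lines with
  two segments and lower bounds from calibrations. A supporting functional calibrates its own cone,
  but it is not compatible with the gluing at the other edges; this is the reason for clamping it. A
  refracted velocity exists because the functionals supporting at directions that point from an edge
  into a cone take on the edge vector \<open>e\<close> every value strictly between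
  \<open>- F (- e)\<close> and \<open>F e\<close>, and these bounds are the same in all cones at the
  edge. A geodesic that is not radial crosses the edge transversally, so its value lies strictly
  between them.\<close>

definition strict_norm :: "('v::real_normed_vector \<Rightarrow> real) \<Rightarrow> bool" where
  "strict_norm F \<longleftrightarrow>
     continuous_on UNIV F \<and> (\<forall>y. 0 \<le> F y) \<and> (\<forall>y. y \<noteq> 0 \<longrightarrow> 0 < F y) \<and>
     (\<forall>y r. 0 \<le> r \<longrightarrow> F (r *\<^sub>R y) = r * F y) \<and>
     (\<forall>y. y \<noteq> 0 \<longrightarrow> F differentiable at y) \<and>
     (\<forall>y z. F (y + z) \<le> F y + F z) \<and>
     (\<forall>y z. y \<noteq> 0 \<longrightarrow> z \<noteq> 0 \<longrightarrow> F (y + z) = F y + F z \<longrightarrow> (\<exists>k>0. z = k *\<^sub>R y))"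

text \<open>Half the second derivative of \<open>F\<^sup>2\<close> along the line is
  \<open>fundamental_form F\<close> in direction \<open>u\<close>, so \<open>F\<^sup>2\<close> is
  strictly convex there and, being 1 at both ends, less than 1 between them. The line avoids 0,
  where \<open>F\<close> need not be differentiable.\<close>

lemma minkowski_norm_line_convex:
  fixes F :: "'v::euclidean_space \<Rightarrow> real"
  assumes mn: "minkowski_norm F" and line: "\<And>\<tau>. y + \<tau> *\<^sub>R u \<noteq> 0" and u: "u \<noteq> 0"
    and ends: "F y = 1" "F (y + u) = 1" and s: "0 < s" "s < 1"
  shows "F (y + s *\<^sub>R u) < 1"
proof -
  have "Ck_on (Suc (Suc 0)) (- {0}) F"
    using mn unfolding minkowski_norm_def smooth_on_def by blast
  then obtain F' where F': "\<And>z. z \<noteq> 0 \<Longrightarrow> (F has_derivative F' z) (at z within - {0})"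
    and C1: "\<And>v. Ck_on (Suc 0) (- {0}) (\<lambda>z. F' z v)"
    unfolding Ck_on.simps(2)[of "Suc 0"] by auto
  from C1[of u] obtain G where G: "\<And>z. z \<noteq> 0 \<Longrightarrow> ((\<lambda>z. F' z u) has_derivative G z) (at z within -
      {0})"
    by auto
  have op: "open (- {0::'v})" by auto
  have F'_at: "(F has_derivative F' z) (at z)" if "z \<noteq> 0" for z
    using F'[OF that] at_within_open[OF _ op, of z] that by simp
  have G_at: "((\<lambda>z. F' z u) has_derivative G z) (at z)" if "z \<noteq> 0" for z
    using G[OF that] at_within_open[OF _ op, of z] that by simp
  define p where "p \<tau> = y + \<tau> *\<^sub>R u" for \<tau>
  have p: "(p has_derivative (\<lambda>h. h *\<^sub>R u)) (at \<tau>)" for \<tau>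
    unfolding p_def by (auto intro!: derivative_eq_intros)
  have p0: "p \<tau> \<noteq> 0" for \<tau> unfolding p_def by (rule line)
  define a where "a \<tau> = F (p \<tau>)" for \<tau>
  define b where "b \<tau> = F' (p \<tau>) u" for \<tau>
  have a: "(a has_real_derivative b \<tau>) (at \<tau>)" for \<tau>
  proof -
    have "((\<lambda>\<tau>. F (p \<tau>)) has_derivative (\<lambda>h. F' (p \<tau>) (h *\<^sub>R u))) (at \<tau>)"
      by (rule has_derivative_compose[OF p F'_at[OF p0]])
    moreover have "F' (p \<tau>) (h *\<^sub>R u) = F' (p \<tau>) u * h" for h
      using has_derivative_linear[OF F'_at[OF p0]] by (simp add: linear_scale)
    ultimately show ?thesis
      by (simp add: has_field_derivative_def a_def[abs_def] b_def)
  qed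
  have b: "(b has_real_derivative G (p \<tau>) u) (at \<tau>)" for \<tau>
  proof -
    have "((\<lambda>\<tau>. F' (p \<tau>) u) has_derivative (\<lambda>h. G (p \<tau>) (h *\<^sub>R u))) (at \<tau>)"
      by (rule has_derivative_compose[OF p G_at[OF p0]])
    moreover have "G (p \<tau>) (h *\<^sub>R u) = G (p \<tau>) u * h" for h
      using has_derivative_linear[OF G_at[OF p0]] by (simp add: linear_scale)
    ultimately show ?thesis
      by (simp add: has_field_derivative_def b_def[abs_def])
  qed
  define \<psi> where "\<psi> \<tau> = 2 * a \<tau> * b \<tau>" for \<tau>
  define \<theta> where "\<theta> \<tau> = 2 * (b \<tau> * b \<tau> + a \<tau> * G (p \<tau>) u)" for \<tau>
  have phi: "((\<lambda>\<tau>. (a \<tau>)\<^sup>2) has_real_derivative \<psi> \<tau>) (at \<tau>)" for \<tau>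
    unfolding \<psi>_def by (rule derivative_eq_intros a refl)+ simp
  have psi: "(\<psi> has_real_derivative \<theta> \<tau>) (at \<tau>)" for \<tau>
    unfolding \<psi>_def[abs_def] \<theta>_def by (rule derivative_eq_intros a b refl)+ (simp add:
        algebra_simps)
  \<comment> \<open>Both nested \<open>deriv\<close> in \<open>fundamental_form\<close> are genuine
    derivatives here: up to a shift of the parameter, those of \<open>(a \<tau>)\<^sup>2\<close> and
    of \<open>\<psi>\<close>.\<close>
  have ff: "fundamental_form F (p \<tau>) u u = 1/2 * \<theta> \<tau>" for \<tau>
  proof -
    have 1: "deriv (\<lambda>t. (F (p \<tau> + s *\<^sub>R u + t *\<^sub>R u))\<^sup>2) 0 = \<psi> (\<tau> + s)" for s
    proof (rule DERIV_imp_deriv)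
      have "((\<lambda>t. (a (t + (\<tau> + s)))\<^sup>2) has_real_derivative \<psi> (0 + (\<tau> + s))) (at 0)"
        using phi[of "0 + (\<tau> + s)"] by (subst (asm) DERIV_shift)
      then show "((\<lambda>t. (F (p \<tau> + s *\<^sub>R u + t *\<^sub>R u))\<^sup>2) has_real_derivative \<psi> (\<tau> + s)) (at 0)"
        by (simp add: a_def p_def algebra_simps)
    qed
    have "deriv (\<lambda>s. \<psi> (\<tau> + s)) 0 = \<theta> \<tau>"
    proof (rule DERIV_imp_deriv)
      have "((\<lambda>s. \<psi> (s + \<tau>)) has_real_derivative \<theta> (0 + \<tau>)) (at 0)"
        using psi[of "0 + \<tau>"] by (subst (asm) DERIV_shift)
      then show "((\<lambda>s. \<psi> (\<tau> + s)) has_real_derivative \<theta> \<tau>) (at 0)"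
        by (simp add: add.commute[of \<tau>])
    qed
    then show ?thesis unfolding fundamental_form_def 1 by simp
  qed
  have "0 < \<theta> \<tau>" for \<tau>
    using mn u p0[of \<tau>] ff[of \<tau>] unfolding minkowski_norm_def by fastforce
  then have mono: "\<psi> \<tau> < \<psi> \<tau>'" if "\<tau> < \<tau>'" for \<tau> \<tau>'
    using DERIV_pos_imp_increasing[OF that, of \<psi>] psi by blast
  obtain z1 where z1: "0 < z1" "z1 < s" "(a s)\<^sup>2 - (a 0)\<^sup>2 = (s - 0) * \<psi> z1"
    using MVT2[OF s(1), of "\<lambda>\<tau>. (a \<tau>)\<^sup>2" \<psi>] phi by blast
  obtain z2 where z2: "s < z2" "z2 < 1" "(a 1)\<^sup>2 - (a s)\<^sup>2 = (1 - s) * \<psi> z2"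
    using MVT2[OF s(2), of "\<lambda>\<tau>. (a \<tau>)\<^sup>2" \<psi>] phi by blast
  have e: "a 0 = 1" "a 1 = 1" using ends by (auto simp: a_def p_def)
  \<comment> \<open>Otherwise the mean slope on \<open>[0, s]\<close> is nonnegative and that on
    \<open>[s, 1]\<close> nonpositive, against the strict growth of \<open>\<psi>\<close>.\<close>
  have "(a s)\<^sup>2 < 1"
  proof (rule ccontr)
    assume "\<not> ?thesis"
    then have "0 \<le> s * \<psi> z1" "(1 - s) * \<psi> z2 \<le> 0" using z1 z2 e by auto
    then have "0 \<le> \<psi> z1" "\<psi> z2 \<le> 0" using s by (auto simp: zero_le_mult_iff mult_le_0_iff)
    then show False using mono[of z1 z2] z1 z2 by auto
  qed
  then show ?thesis unfolding a_def p_def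
    by (metis abs_square_less_1 abs_less_iff)
qed

text \<open>For independent vectors strictness comes from the chord between the normalised vectors,
  which avoids 0; for proportional vectors homogeneity decides.\<close>

lemma minkowski_norm_imp_strict_norm:
  fixes F :: "'v::euclidean_space \<Rightarrow> real"
  assumes mn: "minkowski_norm F"
  shows "strict_norm F"
proof -
  have pos: "0 < F y" if "y \<noteq> 0" for y using mn that unfolding minkowski_norm_def by blast
  have hom: "F (r *\<^sub>R y) = r * F y" if "0 \<le> r" for r y
    using mn that unfolding minkowski_norm_def by blast
  have F0: "F 0 = 0" using hom[of 0 0] by simp
  have strict: "F (y + z) < F y + F z" if yz: "y \<noteq> 0" "z \<noteq> 0" "\<nexists>k. 0 < k \<and> z = k *\<^sub>R y" for y z
  proof (cases "\<exists>k. z = k *\<^sub>R y")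
    case True
    then obtain k where k: "z = k *\<^sub>R y" by auto
    then have k0: "k < 0" using yz by (metis linorder_neqE_linordered_idom scaleR_zero_left)
    show ?thesis
    \<comment> \<open>The sum is a nonnegative multiple of \<open>y\<close> or of \<open>z\<close>,
      depending on which of the two opposite vectors is longer, and homogeneity needs a nonnegative
      factor.\<close>
    proof (cases "k \<ge> -1")
      case True
      have "y + z = (1 + k) *\<^sub>R y" by (simp add: k algebra_simps)
      then have "F (y + z) = (1 + k) * F y" using hom[of "1 + k" y] True by simp
      also have "\<dots> < F y + F z" using k0 pos[OF yz(1)] pos[OF yz(2)]
        by (simp add: algebra_simps) (smt (verit) mult_neg_pos)
      finally show ?thesis .
    next
      case False
      have "y + z = (1 + 1/k) *\<^sub>R z" using k0 by (simp add: k algebra_simps)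
      then have "F (y + z) = (1 + 1/k) * F z" using hom[of "1 + 1/k" z] False k0
        by (simp add: field_simps)
      also have "\<dots> < F y + F z" using k0 pos[OF yz(1)] pos[OF yz(2)]
        by (simp add: algebra_simps) (smt (verit) divide_pos_neg)
      finally show ?thesis .
    qed
  next
    case False
    define y' where "y' = (1 / F y) *\<^sub>R y"
    define z' where "z' = (1 / F z) *\<^sub>R z"
    have Fy: "0 < F y" "0 < F z" using pos yz by auto
    have u1: "F y' = 1" "F z' = 1" using Fy by (auto simp: y'_def z'_def hom)
    \<comment> \<open>With this weight the point on the chord from \<open>y'\<close> to
      \<open>z'\<close> is \<open>y + z\<close> divided by \<open>F y + F z\<close>.\<close>
    define s where "s = F z / (F y + F z)"
    have s: "0 < s" "s < 1" using Fy by (auto simp: s_def)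
    have line: "y' + \<tau> *\<^sub>R (z' - y') \<noteq> 0" for \<tau>
    proof
      assume *: "y' + \<tau> *\<^sub>R (z' - y') = 0"
      show False
      proof (cases "\<tau> = 0")
        case True then show False using * Fy yz by (auto simp: y'_def)
      next
        case t: False
        have "(\<tau> / F z) *\<^sub>R z = ((\<tau> - 1) / F y) *\<^sub>R y"
          using * by (simp add: y'_def z'_def algebra_simps divide_inverse)
        then have "(F z / \<tau>) *\<^sub>R ((\<tau> / F z) *\<^sub>R z) = (F z / \<tau>) *\<^sub>R (((\<tau> - 1) / F y) *\<^sub>R y)" by simp
        then have "z = (F z / \<tau> * ((\<tau> - 1) / F y)) *\<^sub>R y" using t Fy by simp
        then show False using False by blast
      qed
    qed
    have "z' - y' \<noteq> 0"
    proof
      assume "z' - y' = 0"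
      then have "F z *\<^sub>R ((1 / F z) *\<^sub>R z) = F z *\<^sub>R ((1 / F y) *\<^sub>R y)" by (simp add: y'_def z'_def)
      then have "z = (F z / F y) *\<^sub>R y" using Fy by simp
      then show False using False by blast
    qed
    then have lt: "F (y' + s *\<^sub>R (z' - y')) < 1"
      using minkowski_norm_line_convex[OF mn line _ u1(1) _ s] u1(2) by simp
    have "y' + s *\<^sub>R (z' - y') = (1 - s) *\<^sub>R y' + s *\<^sub>R z'" by (simp add: algebra_simps)
    also have "\<dots> = (1 / (F y + F z)) *\<^sub>R (y + z)"
    proof -
      have "(1 - s) *\<^sub>R y' = (1 / (F y + F z)) *\<^sub>R y" "s *\<^sub>R z' = (1 / (F y + F z)) *\<^sub>R z"
        using Fy by (auto simp: y'_def z'_def s_def field_simps)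
      then show ?thesis by (simp add: algebra_simps)
    qed
    finally have "F ((1 / (F y + F z)) *\<^sub>R (y + z)) < 1" using lt by simp
    then show ?thesis using Fy hom[of "1 / (F y + F z)" "y + z"] by (simp add: pos_divide_less_eq)
  qed
  have tri: "F (y + z) \<le> F y + F z" for y z
  proof (cases "y = 0 \<or> z = 0 \<or> (\<nexists>k. 0 < k \<and> z = k *\<^sub>R y)")
    case True
    then show ?thesis using strict[of y z, THEN less_imp_le] F0 by (metis add.left_neutral
        add.right_neutral order_refl)
  next
    case False
    then obtain k where "0 < k" "z = k *\<^sub>R y" by blast
    then have "y + z = (1 + k) *\<^sub>R y" "F z = k * F y" by (auto simp: algebra_simps hom)
    then show ?thesis using hom[of "1 + k" y] \<open>0 < k\<close> by (simp add: algebra_simps)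
  qed
  have diff: "F differentiable at y" if "y \<noteq> 0" for y
  proof -
    have "Ck_on (Suc 0) (- {0}) F"
      using mn unfolding minkowski_norm_def smooth_on_def by blast
    then obtain F' where "\<And>z. z \<in> - {0} \<Longrightarrow> (F has_derivative F' z) (at z within - {0})"
      by auto
    then have "(F has_derivative F' y) (at y within - {0})" using that by simp
    moreover have "at y within - {0} = at y" using that by (intro at_within_open) auto
    ultimately show ?thesis unfolding differentiable_def by auto
  qed
  show ?thesis unfolding strict_norm_def
    using mn tri diff strict unfolding minkowski_norm_def by (metis order_less_irrefl)
qed

section \<open>Supporting functionals of a strictly convex norm\<close>

locale strict_normed =
  fixes F :: "'v::real_normed_vector \<Rightarrow> real"
  assumes strict_norm: "strict_norm F"
begin

lemma cont: "continuous_on S F"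
  and nonneg: "0 \<le> F y"
  and pos: "y \<noteq> 0 \<Longrightarrow> 0 < F y"
  and hom: "0 \<le> r \<Longrightarrow> F (r *\<^sub>R y) = r * F y"
  and diff: "y \<noteq> 0 \<Longrightarrow> F differentiable at y"
  and tri: "F (y + z) \<le> F y + F z"
  and tri_eq: "y \<noteq> 0 \<Longrightarrow> z \<noteq> 0 \<Longrightarrow> F (y + z) = F y + F z \<Longrightarrow> \<exists>k>0. z = k *\<^sub>R y"
  using strict_norm continuous_on_subset[of UNIV F S] unfolding strict_norm_def by auto

lemma zero [simp]: "F 0 = 0" using hom[of 0 0] by simp

lemma zero_iff: "F y = 0 \<longleftrightarrow> y = 0" using pos[of y] zero by force

text \<open>The differential of \<open>F\<close> at \<open>y\<close> is the linear functional that
  supports the unit ball in direction \<open>y\<close>: at most \<open>F\<close> everywhere, and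
  equal to \<open>F\<close> only on the ray of \<open>y\<close>. It is both the momentum in Snell's
  law and the local calibration.\<close>

definition supp :: "'v \<Rightarrow> 'v \<Rightarrow> real" where
  "supp y = frechet_derivative F (at y)"

lemma supp_derivative: "y \<noteq> 0 \<Longrightarrow> (F has_derivative supp y) (at y)"
  unfolding supp_def by (metis diff frechet_derivative_works)

lemma supp_linear: "y \<noteq> 0 \<Longrightarrow> linear (supp y)"
  using supp_derivative has_derivative_linear by blast

lemma supp_along:
  assumes "y \<noteq> 0"
  shows "((\<lambda>h. F (y + h *\<^sub>R u)) has_real_derivative supp y u) (at 0)"
proof -
  have "((\<lambda>h. y + h *\<^sub>R u) has_derivative (\<lambda>h. h *\<^sub>R u)) (at 0)"
    by (auto intro!: derivative_eq_intros)
  from has_derivative_compose[OF this, of F "supp y"] supp_derivative[OF assms]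
  have "((\<lambda>h. F (y + h *\<^sub>R u)) has_derivative (\<lambda>h. supp y (h *\<^sub>R u))) (at 0)" by simp
  moreover have "supp y (h *\<^sub>R u) = supp y u * h" for h
    using supp_linear[OF assms] by (simp add: linear_scale)
  ultimately show ?thesis by (simp add: has_field_derivative_def)
qed

text \<open>By the triangle inequality, every difference quotient of \<open>F\<close> at
  \<open>y\<close> in direction \<open>u\<close> with positive increment is at most
  \<open>F u\<close>.\<close>

lemma supp_le:
  assumes "y \<noteq> 0"
  shows "supp y u \<le> F u"
proof (rule tendsto_upperbound)
  show "((\<lambda>h. (F (y + h *\<^sub>R u) - F y) / h) \<longlongrightarrow> supp y u) (at_right 0)"
    using supp_along[OF assms, of u] unfolding has_field_derivative_iff
    by (auto intro: tendsto_mono[OF at_le])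
  show "\<forall>\<^sub>F h in at_right 0. (F (y + h *\<^sub>R u) - F y) / h \<le> F u"
  proof (rule eventually_at_right_less[THEN eventually_mono])
    fix h :: real assume "0 < h"
    then show "(F (y + h *\<^sub>R u) - F y) / h \<le> F u"
      using tri[of y "h *\<^sub>R u"] hom[of h u] by (simp add: field_simps)
  qed
qed auto

lemma supp_self:
  assumes "y \<noteq> 0"
  shows "supp y y = F y"
proof -
  have "((\<lambda>h. (1 + h) * F y) has_real_derivative F y) (at 0)"
    by (auto intro!: derivative_eq_intros)
  moreover have "\<forall>\<^sub>F h in nhds 0. F (y + h *\<^sub>R y) = (1 + h) * F y"
  proof -
    have "\<forall>\<^sub>F h in nhds (0::real). -1 < h" by (rule eventually_nhds_in_open[of "{-1<..}",
        simplified]) auto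
    then show ?thesis
      by eventually_elim (metis add.commute hom less_eq_real_def minus_less_iff
          real_0_less_add_iff scaleR_left_distrib scaleR_one)
  qed
  ultimately have "((\<lambda>h. F (y + h *\<^sub>R y)) has_real_derivative F y) (at 0)"
    by (subst DERIV_cong_ev[OF refl _ refl]) auto
  then show ?thesis using supp_along[OF assms] DERIV_unique by blast
qed

text \<open>Evaluating the functional at \<open>y + u\<close> turns the assumption into equality in
  the triangle inequality.\<close>

lemma supp_eq:
  assumes "y \<noteq> 0" "u \<noteq> 0" "supp y u = F u"
  shows "\<exists>k>0. u = k *\<^sub>R y"
proof -
  have "F y + F u = supp y (y + u)"
    using assms supp_self[OF assms(1)] linear_add[OF supp_linear[OF assms(1)]] by simp
  also have "\<dots> \<le> F (y + u)" by (rule supp_le[OF assms(1)])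
  finally show ?thesis using tri[of y u] tri_eq[OF assms(1,2)] by auto
qed

lemma supp_ge: "y \<noteq> 0 \<Longrightarrow> - F (- u) \<le> supp y u"
  using supp_le[of y "- u"] linear_neg[OF supp_linear, of y u] by simp

text \<open>A detour costs a fixed fraction of its first leg. The second leg is bounded below by the
  functional supporting at \<open>e2\<close>, which is linear, so \<open>\<kappa>\<close> does not
  depend on \<open>s\<close> and \<open>t\<close>; it is positive because \<open>e1\<close> does not
  point in the direction of \<open>e2\<close>.\<close>

lemma triangle_defect:
  assumes "e1 \<noteq> 0" "e2 \<noteq> 0" "\<nexists>k. 0 < k \<and> e1 = k *\<^sub>R e2"
  shows "\<exists>\<kappa>>0. \<forall>s\<ge>0. \<forall>t\<ge>0. F (t *\<^sub>R e2) \<le> F (s *\<^sub>R e1) + F (t *\<^sub>R e2 - s *\<^sub>R e1) - \<kappa> * F (s *\<^sub>R e1)"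
proof (intro exI conjI allI impI)
  define \<kappa> where "\<kappa> = 1 - supp e2 e1 / F e1"
  have "supp e2 e1 < F e1"
    using supp_le[OF assms(2), of e1] supp_eq[OF assms(2,1)] assms(3) by force
  then show "0 < \<kappa>" using pos[OF assms(1)] by (simp add: \<kappa>_def)
  fix s t :: real assume st: "0 \<le> s" "0 \<le> t"
  have "supp e2 (t *\<^sub>R e2 - s *\<^sub>R e1) = t * F e2 - s * supp e2 e1"
    using supp_linear[OF assms(2)] by (simp add: linear_diff linear_scale supp_self assms)
  then have "t * F e2 - s * supp e2 e1 \<le> F (t *\<^sub>R e2 - s *\<^sub>R e1)"
    using supp_le[OF assms(2), of "t *\<^sub>R e2 - s *\<^sub>R e1"] by simp
  moreover have "\<kappa> * F (s *\<^sub>R e1) = s * F e1 - s * supp e2 e1"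
    using pos[OF assms(1)] st by (simp add: \<kappa>_def hom field_simps)
  ultimately show "F (t *\<^sub>R e2) \<le> F (s *\<^sub>R e1) + F (t *\<^sub>R e2 - s *\<^sub>R e1) - \<kappa> * F (s *\<^sub>R e1)"
    using st by (simp add: hom)
qed

text \<open>The bounds on \<open>\<alpha>\<close> make
  \<open>F (w + s *\<^sub>R e) - \<alpha> * s\<close> tend to infinity on both sides, so it has a
  minimum, and there its derivative vanishes.\<close>

lemma supp_exists_direction:
  assumes "\<And>s. w + s *\<^sub>R e \<noteq> 0" "- F (- e) < \<alpha>" "\<alpha> < F e"
  shows "\<exists>s. supp (w + s *\<^sub>R e) e = \<alpha>"
proof -
  define f where "f s = F (w + s *\<^sub>R e) - \<alpha> * s" for s
  have contf: "continuous_on A f" for A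
    unfolding f_def by (intro continuous_intros continuous_on_compose2[OF cont[of UNIV]]) auto
  \<comment> \<open>Outside \<open>[-R, R]\<close> the triangle inequality gives \<open>f s\<close>
    at least \<open>f 0 = F w\<close>, so the minimum over this interval is global.\<close>
  define R where "R = max ((F w + F (- w)) / (F e - \<alpha>)) ((F w + F (- w)) / (F (- e) + \<alpha>))"
  have R1: "(F w + F (- w)) \<le> R * (F e - \<alpha>)" "(F w + F (- w)) \<le> R * (F (- e) + \<alpha>)"
    using assms(2,3) by (auto simp: R_def pos_divide_le_eq[symmetric])
  have R0: "0 \<le> R" unfolding R_def using nonneg assms(2,3) by (simp add: le_max_iff_disj
      add_nonneg_nonneg)
  obtain s0 where s0: "s0 \<in> {-R..R}" "\<And>s. s \<in> {-R..R} \<Longrightarrow> f s0 \<le> f s"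
    using continuous_attains_inf[of "{-R..R}" f] contf R0 by force
  have min: "f s0 \<le> f s" for s
  proof (cases "s \<in> {-R..R}")
    case False
    have "f s0 \<le> f 0" using s0(2)[of 0] R0 by auto
    also have "f 0 \<le> f s"
    proof (cases "s \<ge> 0")
      case True
      then have "s \<ge> R" using False R0 by auto
      have "F (s *\<^sub>R e) \<le> F (- w) + F (w + s *\<^sub>R e)" using tri[of "- w" "w + s *\<^sub>R e"] by simp
      moreover have "R * (F e - \<alpha>) \<le> s * (F e - \<alpha>)" using \<open>s \<ge> R\<close> assms(3) by (simp add:
          mult_right_mono)
      ultimately show ?thesis using R1(1) True by (simp add: f_def hom algebra_simps)
    next
      case sn: False
      then have "- s \<ge> R" using False R0 by auto
      have "F ((- s) *\<^sub>R (- e)) \<le> F (- w) + F (w + s *\<^sub>R e)" using tri[of "- w" "w + s *\<^sub>R e"] by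
          simp
      moreover have "R * (F (- e) + \<alpha>) \<le> (- s) * (F (- e) + \<alpha>)" using \<open>- s \<ge> R\<close> assms(2)
        by (intro mult_right_mono) auto
      ultimately show ?thesis using R1(2) sn hom[of "- s" "- e"] by (simp add: f_def algebra_simps)
    qed
    finally show ?thesis .
  qed (use s0 in auto)
  have "((\<lambda>h. F ((w + s0 *\<^sub>R e) + h *\<^sub>R e) - \<alpha> * (s0 + h)) has_real_derivative (supp (w + s0 *\<^sub>R
      e) e - \<alpha>)) (at 0)"
    by (auto intro!: derivative_eq_intros supp_along assms(1))
  moreover have "F ((w + s0 *\<^sub>R e) + h *\<^sub>R e) - \<alpha> * (s0 + h) = f (s0 + h)" for h
    by (simp add: f_def algebra_simps)
  ultimately have "((\<lambda>h. f (s0 + h)) has_real_derivative (supp (w + s0 *\<^sub>R e) e - \<alpha>)) (at 0)" by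
      simp
  from DERIV_local_min[OF this, of 1] min have "supp (w + s0 *\<^sub>R e) e - \<alpha> = 0" by simp
  then show ?thesis by (intro exI[of _ s0]) simp
qed

end

lemma strict_norm_reverse:
  assumes "strict_norm F"
  shows "strict_norm (\<lambda>v. F (- v))"
proof -
  interpret strict_normed F using assms by unfold_locales
  have "(\<lambda>v. F (- v)) differentiable at y" if "y \<noteq> 0" for y
    using differentiable_chain_at[of uminus y F] diff[of "- y"] that by (simp add: o_def)
  moreover have "\<exists>k>0. z = k *\<^sub>R y" if "y \<noteq> 0" "z \<noteq> 0" "F (- (y + z)) = F (- y) + F (- z)" for y z
    using tri_eq[of "- y" "- z"] that by auto
  moreover have "continuous_on UNIV (\<lambda>v. F (- v))"
    by (intro continuous_on_compose2[OF cont[of UNIV]] continuous_intros) auto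
  ultimately show ?thesis unfolding strict_norm_def
    using nonneg pos hom[of _ "- _"] tri[of "- _" "- _"] by auto
qed

subsection \<open>Reversal of curves\<close>

lemma Ck_on_subset: "Ck_on k S f \<Longrightarrow> S' \<subseteq> S \<Longrightarrow> Ck_on k S' f"
proof (induction k arbitrary: f)
  case 0 then show ?case using continuous_on_subset by auto
next
  case (Suc k)
  from Suc.prems(1) obtain f' where "\<forall>x\<in>S. (f has_derivative f' x) (at x within S)" "\<forall>v. Ck_on k S
      (\<lambda>x. f' x v)"
    by auto
  then show ?case using Suc.IH Suc.prems(2) unfolding Ck_on.simps
    by (intro exI[of _ f']) (meson has_derivative_subset subsetD)
qed

lemma smooth_on_subset: "smooth_on S f \<Longrightarrow> S' \<subseteq> S \<Longrightarrow> smooth_on S' f"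
  unfolding smooth_on_def using Ck_on_subset by blast

lemma Ck_on_const: "Ck_on k S (\<lambda>x. c)"
  by (induction k arbitrary: c) (auto intro!: exI[of _ "\<lambda>_ _. 0"])

lemma smooth_on_affine: "smooth_on S (\<lambda>t::real. a + t *\<^sub>R v)"
proof -
  have "Ck_on k S (\<lambda>t::real. a + t *\<^sub>R v)" for k
  proof (cases k)
    case (Suc j)
    have "((\<lambda>t. a + t *\<^sub>R v) has_derivative (\<lambda>h. h *\<^sub>R v)) (at t within S)" for t
      by (auto intro!: derivative_eq_intros)
    then show ?thesis unfolding Suc Ck_on.simps using Ck_on_const
      by (intro exI[of _ "\<lambda>_ h. h *\<^sub>R v"]) blast
  qed (auto intro!: continuous_intros)
  then show ?thesis by (simp add: smooth_on_def)
qed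

lemma Ck_on_reverse: "Ck_on k S f \<Longrightarrow> Ck_on k (uminus ` S) (\<lambda>t. f (- t))"
proof (induction k arbitrary: f)
  case 0 then show ?case
    by (auto intro!: continuous_on_compose2[of S f "uminus ` S" uminus] continuous_intros)
next
  case (Suc k)
  from Suc.prems(1) obtain f' where f': "\<And>x. x \<in> S \<Longrightarrow> (f has_derivative f' x) (at x within S)"
    and C: "\<And>v. Ck_on k S (\<lambda>x. f' x v)"
    by auto
  have "((\<lambda>t. f (- t)) has_derivative (\<lambda>h. f' (- y) (- h))) (at y within uminus ` S)"
    if "y \<in> uminus ` S" for y
  proof -
    have "(uminus has_derivative uminus) (at y within uminus ` S)"
      by (rule has_derivative_minus[OF has_derivative_ident])
    moreover have "(f has_derivative f' (- y)) (at (- y) within uminus ` (uminus ` S))"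
      using that f' by (auto simp: image_image)
    ultimately show ?thesis by (rule has_derivative_in_compose)
  qed
  moreover have "Ck_on k (uminus ` S) (\<lambda>y. f' (- y) (- v))" for v
    using Suc.IH[OF C] .
  ultimately show ?case unfolding Ck_on.simps by (intro exI[of _ "\<lambda>y h. f' (- y) (- h)"]) simp
qed

lemma smooth_on_reverse:
  assumes "smooth_on {a..b::real} g"
  shows "smooth_on {- b..- a} (\<lambda>t. g (- t))"
proof -
  have "uminus ` {a..b} = {- b..- a}" by simp
  then show ?thesis using assms Ck_on_reverse unfolding smooth_on_def by metis
qed

lemma smooth_on_vector_derivative:
  fixes g :: "real \<Rightarrow> 'b::real_normed_vector"
  assumes "smooth_on {a..b} g"
  obtains g' where "continuous_on {a..b} g'"
    "\<And>t. t \<in> {a..b} \<Longrightarrow> (g has_vector_derivative g' t) (at t within {a..b})"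
proof -
  from assms have "Ck_on (Suc 0) {a..b} g" unfolding smooth_on_def by blast
  then obtain f' where f': "\<And>x. x \<in> {a..b} \<Longrightarrow> (g has_derivative f' x) (at x within {a..b})"
    and C: "continuous_on {a..b} (\<lambda>x. f' x 1)" unfolding Ck_on.simps by blast
  have "(g has_vector_derivative f' x 1) (at x within {a..b})" if "x \<in> {a..b}" for x
  proof -
    have "f' x = (\<lambda>h. h *\<^sub>R f' x 1)"
    proof
      fix h :: real
      show "f' x h = h *\<^sub>R f' x 1"
        using linear_scale[OF has_derivative_linear[OF f'[OF that]], of h 1] by simp
    qed
    then show ?thesis using f'[OF that] by (simp add: has_vector_derivative_def)
  qed
  then show ?thesis using that C by blast
qed

lemma vector_derivative_within_interval:
  fixes f :: "real \<Rightarrow> 'b::real_normed_vector"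
  assumes "(f has_vector_derivative f') (at t within {a..b})" "a < b" "t \<in> {a..b}"
  shows "vector_derivative f (at t within {a..b}) = f'"
  using vector_derivative_within_cbox[of a b t f f'] assms by (simp add: cbox_interval)

lemma smooth_piece_less: "smooth_piece M x c T a b g \<Longrightarrow> a < b"
  by (simp add: smooth_piece_def)

lemma has_length_less: "has_length M x c a b L \<Longrightarrow> a < b"
  by (induction rule: has_length.induct) (auto simp: smooth_piece_def)

lemma smooth_piece_cong:
  "(\<And>t. t \<in> {a..b} \<Longrightarrow> c t = c' t) \<Longrightarrow> smooth_piece M x c T a b g = smooth_piece M x c' T a b g"
  unfolding smooth_piece_def by auto

lemma has_length_cong:
  assumes "has_length M x c a b L" "\<And>t. t \<in> {a..b} \<Longrightarrow> c t = c' t"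
  shows "has_length M x c' a b L"
  using assms
proof (induction rule: has_length.induct)
  case (piece T a b g)
  then have "smooth_piece M x c' T a b g" using smooth_piece_cong[of a b c c'] by blast
  then show ?case by (rule has_length.piece)
next
  case (join a b L d L')
  have "a < b" "b < d" using has_length_less[OF join.hyps(1)] has_length_less[OF join.hyps(2)] by
      auto
  then show ?case using join by (intro has_length.join[of _ _ _ a b L d L']) auto
qed

text \<open>The speed is an argument so that a geodesic and its extension can be required to have
  the same one.\<close>

definition const_speed :: "'a pf_surface \<Rightarrow> 'a \<Rightarrow> real set \<Rightarrow> (real \<Rightarrow> 'a tpoint) \<Rightarrow> real \<Rightarrow> bool" where
  "const_speed M x D c \<sigma> \<longleftrightarrow> (\<forall>T a b g. {a..b} \<subseteq> D \<longrightarrow> smooth_piece M x c T a b g \<longrightarrow>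
     (\<forall>t\<in>{a..b}. piece_speed M T a b g t = \<sigma>))"

text \<open>Stated for a single time, so that an extension inherits it before the seam and it has to
  be proved only from there on.\<close>

definition minimizing_at :: "'a pf_surface \<Rightarrow> 'a \<Rightarrow> real set \<Rightarrow> (real \<Rightarrow> 'a tpoint) \<Rightarrow> real \<Rightarrow> bool" where
  "minimizing_at M x D c t0 \<longleftrightarrow>
     (\<exists>\<epsilon>>0. \<forall>t1\<in>D. \<forall>t2\<in>D. \<bar>t1 - t0\<bar> < \<epsilon> \<longrightarrow> \<bar>t2 - t0\<bar> < \<epsilon> \<longrightarrow> t1 < t2 \<longrightarrow>
        has_length M x c t1 t2 (tdist M x (c t1) (c t2)))"

lemma geodesic_iff:
  "geodesic M x D c \<longleftrightarrow> is_interval D \<and> (\<exists>a\<in>D. \<exists>b\<in>D. a < b) \<and> piecewise_smooth M x D c \<and>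
     (\<exists>\<sigma>>0. const_speed M x D c \<sigma>) \<and> (\<forall>t0\<in>D. minimizing_at M x D c t0)"
  unfolding geodesic_def const_speed_def minimizing_at_def ..

lemma const_speedD:
  "const_speed M x D c \<sigma> \<Longrightarrow> {a..b} \<subseteq> D \<Longrightarrow> smooth_piece M x c T a b g \<Longrightarrow> t \<in> {a..b} \<Longrightarrow>
     piece_speed M T a b g t = \<sigma>"
  unfolding const_speed_def by blast

lemma is_interval_subset: "is_interval D \<Longrightarrow> a \<in> D \<Longrightarrow> b \<in> D \<Longrightarrow> {a..b::real} \<subseteq> D"
  by (meson mem_is_interval_1_I atLeastAtMost_iff subsetI)

text \<open>A curve run backwards has the negated velocity, so its length is kept when every norm is
  reflected. Charts and triangles stay, hence the tangent cone is literally the same set.\<close>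

definition reverse :: "'a pf_surface \<Rightarrow> 'a pf_surface" where
  "reverse M = M\<lparr>fnorm := \<lambda>T v. fnorm M T (- v)\<rparr>"

lemma reverse_reverse [simp]: "reverse (reverse M) = M"
  by (simp add: reverse_def)

lemma reverse_simps [simp]:
  "triangles (reverse M) = triangles M" "chart (reverse M) = chart M"
  "fnorm (reverse M) T = (\<lambda>v. fnorm M T (- v))"
  by (auto simp: reverse_def)

lemma reverse_cone [simp]:
  "star (reverse M) x = star M x" "sector (reverse M) x = sector M x" "glue (reverse M) x = glue M
      x"
  "tangent_cone (reverse M) x = tangent_cone M x" "apex (reverse M) x = apex M x"
  by (auto simp: star_def sector_def glue_def tangent_cone_def apex_def fun_eq_iff)

lemma smooth_piece_reverse:
  assumes "smooth_piece M x c T a b g"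
  shows "smooth_piece (reverse M) x (\<lambda>t. c (- t)) T (- b) (- a) (\<lambda>t. g (- t))"
  using assms smooth_on_reverse[of a b g] unfolding smooth_piece_def by auto

lemma piece_speed_reverse:
  assumes "smooth_piece M x c T a b g" "t \<in> {a..b}"
  shows "piece_speed (reverse M) T (- b) (- a) (\<lambda>t. g (- t)) (- t) = piece_speed M T a b g t"
proof -
  have ab: "a < b" "smooth_on {a..b} g" using assms by (auto simp: smooth_piece_def)
  obtain g' where g': "\<And>t. t \<in> {a..b} \<Longrightarrow> (g has_vector_derivative g' t) (at t within {a..b})"
    using smooth_on_vector_derivative[OF ab(2)] by metis
  have im: "uminus ` {- b..- a} = {a..b}" by simp
  have "((g \<circ> uminus) has_vector_derivative (-1) *\<^sub>R g' (- (- t))) (at (- t) within {- b..- a})"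
    by (rule vector_diff_chain_within) (use im g'[OF assms(2)] in \<open>auto intro!:
        derivative_eq_intros\<close>)
  then have "vector_derivative (\<lambda>t. g (- t)) (at (- t) within {- b..- a}) = - g' t"
    using vector_derivative_within_interval[of "g \<circ> uminus" "- g' t" "- t" "- b" "- a"] ab assms(2)
    by (simp add: o_def)
  moreover have "vector_derivative g (at t within {a..b}) = g' t"
    using vector_derivative_within_interval g' assms(2) ab by blast
  ultimately show ?thesis by (simp add: piece_speed_def)
qed

lemma has_length_reverse:
  "has_length M x c a b L \<Longrightarrow> has_length (reverse M) x (\<lambda>t. c (- t)) (- b) (- a) L"
proof (induction rule: has_length.induct)
  case (piece T a b g)
  have "integral {- b..- a} (piece_speed (reverse M) T (- b) (- a) (\<lambda>t. g (- t)))
      = integral {- b..- a} (\<lambda>t. piece_speed M T a b g (- t))"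
  proof (rule integral_cong)
    fix t assume "t \<in> {- b..- a}"
    then show "piece_speed (reverse M) T (- b) (- a) (\<lambda>t. g (- t)) t = piece_speed M T a b g (- t)"
      using piece_speed_reverse[OF piece, of "- t"] by simp
  qed
  also have "\<dots> = integral {a..b} (piece_speed M T a b g)"
    by (rule Henstock_Kurzweil_Integration.integral_reflect_real)
  finally show ?case using has_length.piece[OF smooth_piece_reverse[OF piece]] by simp
next
  case (join a b L d L')
  then show ?case using has_length.join[OF join.IH(2,1)] by (simp add: add.commute)
qed

text \<open>Reversal is an involution that exchanges the ends of a curve and keeps its length, so
  both infima run over the same set.\<close>

lemma tdist_reverse: "tdist (reverse M) x p q = tdist M x q p"
proof -
  have "\<exists>c a b. has_length (reverse M') x c a b L \<and> c a = q \<and> c b = p"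
    if "has_length M' x c a b L" "c a = p" "c b = q" for M' :: "'a pf_surface" and c a b L p q
    using has_length_reverse[OF that(1)] that(2,3)
    by (intro exI[of _ "\<lambda>t. c (- t)"] exI[of _ "- b"] exI[of _ "- a"]) simp
  from this[of M _ _ _ _ q p] this[of "reverse M" _ _ _ _ p q, unfolded reverse_reverse]
  have "{L. \<exists>c a b. has_length (reverse M) x c a b L \<and> c a = p \<and> c b = q}
      = {L. \<exists>c a b. has_length M x c a b L \<and> c a = q \<and> c b = p}"
    by (intro equalityI subsetI CollectI; elim CollectE exE conjE) assumption+
  then show ?thesis unfolding tdist_def by simp
qed

lemma mem_uminus_image: "t \<in> uminus ` D \<longleftrightarrow> - t \<in> (D::real set)"
  by (force simp: image_iff)

lemma minimizing_at_reverse: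
  assumes "minimizing_at M x D c t0"
  shows "minimizing_at (reverse M) x (uminus ` D) (\<lambda>t. c (- t)) (- t0)"
proof -
  from assms obtain \<epsilon> where e: "\<epsilon> > 0" and m: "\<And>t1 t2. t1\<in>D \<Longrightarrow> t2\<in>D \<Longrightarrow> \<bar>t1 - t0\<bar> < \<epsilon> \<Longrightarrow> \<bar>t2 - t0\<bar> < \<epsilon>
      \<Longrightarrow> t1 < t2 \<Longrightarrow>
        has_length M x c t1 t2 (tdist M x (c t1) (c t2))" unfolding minimizing_at_def by blast
  show ?thesis unfolding minimizing_at_def
  proof (intro exI[of _ \<epsilon>] conjI ballI impI e)
    fix t1 t2 assume *: "t1\<in>uminus ` D" "t2\<in>uminus ` D" "\<bar>t1 - - t0\<bar> < \<epsilon>" "\<bar>t2 - - t0\<bar> < \<epsilon>" "t1 <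
        t2"
    have "has_length M x c (- t2) (- t1) (tdist M x (c (- t2)) (c (- t1)))"
      by (rule m) (use * in \<open>simp_all add: mem_uminus_image\<close>)
    from has_length_reverse[OF this]
    show "has_length (reverse M) x (\<lambda>t. c (- t)) t1 t2 (tdist (reverse M) x (c (- t1)) (c (- t2)))"
      by (simp add: tdist_reverse)
  qed
qed

lemma const_speed_reverse:
  assumes "const_speed M x D c \<sigma>"
  shows "const_speed (reverse M) x (uminus ` D) (\<lambda>t. c (- t)) \<sigma>"
  unfolding const_speed_def
proof (intro allI impI ballI)
  fix T a b g t
  assume *: "{a..b} \<subseteq> uminus ` D" "smooth_piece (reverse M) x (\<lambda>t. c (- t)) T a b g" "t \<in> {a..b}"
  have "smooth_piece M x c T (- b) (- a) (\<lambda>t. g (- t))"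
    using smooth_piece_reverse[OF *(2)] by simp
  moreover have "{- b..- a} \<subseteq> D" 
  proof
    fix r assume "r \<in> {- b..- a}"
    then have "- r \<in> uminus ` D" using *(1) by auto
    then show "r \<in> D" by (simp add: mem_uminus_image)
  qed
  moreover have "- t \<in> {- b..- a}" using *(3) by simp
  ultimately have "piece_speed M T (- b) (- a) (\<lambda>t. g (- t)) (- t) = \<sigma>" using const_speedD[OF
      assms] by blast
  then show "piece_speed (reverse M) T a b g t = \<sigma>"
    using piece_speed_reverse[OF *(2,3)] by simp
qed

lemma geodesic_reverse:
  assumes "geodesic M x D c"
  shows "geodesic (reverse M) x (uminus ` D) (\<lambda>t. c (- t))"
  unfolding geodesic_iff
proof (intro conjI)
  have *: "is_interval D" "\<exists>a\<in>D. \<exists>b\<in>D. a < b" "piecewise_smooth M x D c"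
     "\<exists>\<sigma>>0. const_speed M x D c \<sigma>" "\<forall>t0\<in>D. minimizing_at M x D c t0"
    using assms unfolding geodesic_iff by auto
  show "is_interval (uminus ` D)" using *(1) by simp
  from *(2) obtain a b where "a \<in> D" "b \<in> D" "a < b" by blast
  then have "- b \<in> uminus ` D" "- a \<in> uminus ` D" "- b < - a" by auto
  then show "\<exists>a\<in>uminus ` D. \<exists>b\<in>uminus ` D. a < b" by blast
  show "piecewise_smooth (reverse M) x (uminus ` D) (\<lambda>t. c (- t))"
    unfolding piecewise_smooth_def
  proof (intro ballI impI)
    fix a b assume "a \<in> uminus ` D" "b \<in> uminus ` D" "a < b"
    then have "- b \<in> D" "- a \<in> D" "- b < - a" by (simp_all add: mem_uminus_image)
    then obtain L where "has_length M x c (- b) (- a) L" using *(3) unfolding piecewise_smooth_def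
        by blast
    from has_length_reverse[OF this] show "\<exists>L. has_length (reverse M) x (\<lambda>t. c (- t)) a b L" by auto
  qed
  show "\<exists>\<sigma>>0. const_speed (reverse M) x (uminus ` D) (\<lambda>t. c (- t)) \<sigma>"
    using *(4) by (elim exE conjE) (intro exI conjI const_speed_reverse)
  show "\<forall>t0\<in>uminus ` D. minimizing_at (reverse M) x (uminus ` D) (\<lambda>t. c (- t)) t0"
  proof
    fix t0 assume "t0 \<in> uminus ` D"
    then have "minimizing_at M x D c (- t0)" using *(5) by (simp add: mem_uminus_image)
    from minimizing_at_reverse[OF this]
    show "minimizing_at (reverse M) x (uminus ` D) (\<lambda>t. c (- t)) t0" by simp
  qed
qed

lemma maximal_geodesic_reverse:
  assumes "maximal_geodesic M x D c"
  shows "maximal_geodesic (reverse M) x (uminus ` D) (\<lambda>t. c (- t))"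
  unfolding maximal_geodesic_def
proof (intro conjI notI)
  show "geodesic (reverse M) x (uminus ` D) (\<lambda>t. c (- t))"
    using assms unfolding maximal_geodesic_def by (intro geodesic_reverse) (elim conjE)
  assume "\<exists>D' c'. uminus ` D \<subset> D' \<and> geodesic (reverse M) x D' c' \<and> (\<forall>t\<in>uminus ` D. c' t = c (- t))"
  then obtain D' c' where *: "uminus ` D \<subset> D'" "geodesic (reverse M) x D' c'" "\<forall>t\<in>uminus ` D. c' t
      = c (- t)"
    by blast
  have "geodesic M x (uminus ` D') (\<lambda>t. c' (- t))" using geodesic_reverse[OF *(2)] by simp
  moreover have "D \<subset> uminus ` D'"
  proof -
    obtain y where y: "y \<in> D'" "y \<notin> uminus ` D" using *(1) by blast
    then have "- y \<in> uminus ` D'" "- y \<notin> D" by (simp_all add: mem_uminus_image)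
    moreover have "D \<subseteq> uminus ` D'" using *(1) by (auto simp: mem_uminus_image)
    ultimately show ?thesis by blast
  qed
  moreover have "\<forall>t\<in>D. c' (- t) = c t" using *(3) by auto
  ultimately show False using assms unfolding maximal_geodesic_def
    by (elim conjE notE) (intro exI[of _ "uminus ` D'"] exI[of _ "\<lambda>t. c' (- t)"] conjI ballI,
        simp_all)
qed

subsection \<open>Coordinates of the tangent cone\<close>

text \<open>\<open>Ed T\<close> is the set of the two edges of the cone of \<open>T\<close>. The vectors \<open>u T e\<close>, for the
  different \<open>T\<close> with edge \<open>e\<close>, represent one point of \<open>e\<close>, and \<open>co T e\<close> is the coordinate along \<open>u
  T e\<close> in the basis \<open>u T\<close>.\<close>

locale cone_structure =
  fixes M :: "'a pf_surface" and x :: 'a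
    and Ed :: "'a set \<Rightarrow> 'e set"
    and u :: "'a set \<Rightarrow> 'e \<Rightarrow> real^2"
    and co :: "'a set \<Rightarrow> 'e \<Rightarrow> real^2 \<Rightarrow> real"
  assumes finite_star: "finite (star M x)"
    and norms: "T \<in> star M x \<Longrightarrow> strict_norm (fnorm M T)"
    and card_Ed: "T \<in> star M x \<Longrightarrow> card (Ed T) = 2"
    and co_linear: "T \<in> star M x \<Longrightarrow> e \<in> Ed T \<Longrightarrow> linear (co T e)"
    and co_u: "T \<in> star M x \<Longrightarrow> e \<in> Ed T \<Longrightarrow> f \<in> Ed T \<Longrightarrow> co T e (u T f) = (if e = f then 1 else 0)"
    and co_sum: "T \<in> star M x \<Longrightarrow> (\<Sum>e\<in>Ed T. co T e a *\<^sub>R u T e) = a"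
    and sector: "T \<in> star M x \<Longrightarrow> sector M x T = {a. \<forall>e\<in>Ed T. 0 \<le> co T e a}"
    and glue: "((T, a), (T', b)) \<in> glue M x \<longleftrightarrow> T \<in> star M x \<and> T' \<in> star M x \<and>
       (T = T' \<and> a = b \<and> a \<in> sector M x T \<or> a = 0 \<and> b = 0 \<or>
        (\<exists>e\<in>Ed T \<inter> Ed T'. \<exists>s>0. a = s *\<^sub>R u T e \<and> b = s *\<^sub>R u T' e))"
    and edge_norm: "T \<in> star M x \<Longrightarrow> T' \<in> star M x \<Longrightarrow> e \<in> Ed T \<Longrightarrow> e \<in> Ed T' \<Longrightarrow>
       fnorm M T (s *\<^sub>R u T e) = fnorm M T' (s *\<^sub>R u T' e)"
    and edge_shared: "T \<in> star M x \<Longrightarrow> e \<in> Ed T \<Longrightarrow> \<exists>T'\<in>star M x. T' \<noteq> T \<and> e \<in> Ed T'"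
    and edge_unique: "T \<in> star M x \<Longrightarrow> T' \<in> star M x \<Longrightarrow> T \<noteq> T' \<Longrightarrow> e \<in> Ed T \<Longrightarrow> e \<in> Ed T' \<Longrightarrow>
       f \<in> Ed T \<Longrightarrow> f \<in> Ed T' \<Longrightarrow> e = f"
begin

lemma other_edge:
  assumes "T \<in> star M x" "e \<in> Ed T"
  obtains f where "f \<in> Ed T" "f \<noteq> e" "Ed T = {e, f}"
proof -
  obtain a b where "Ed T = {a, b}" "a \<noteq> b" using card_Ed[OF assms(1)] by (auto simp: card_2_iff)
  then show ?thesis using assms(2) that by (cases "e = a") auto
qed

lemma two_edges:
  assumes "T \<in> star M x"
  obtains e f where "e \<in> Ed T" "f \<in> Ed T" "f \<noteq> e" "Ed T = {e, f}"
proof -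
  obtain a b where "Ed T = {a, b}" "a \<noteq> b" using card_Ed[OF assms(1)] by (auto simp: card_2_iff)
  then show ?thesis using that by auto
qed

lemma co_expand:
  assumes "T \<in> star M x" "Ed T = {e, f}" "f \<noteq> e"
  shows "a = co T e a *\<^sub>R u T e + co T f a *\<^sub>R u T f"
  using co_sum[OF assms(1), of a] assms(2,3) by simp

lemma co_simps:
  assumes "T \<in> star M x" "e \<in> Ed T"
  shows "co T e 0 = 0" "co T e (a + b) = co T e a + co T e b" "co T e (a - b) = co T e a - co T e b"
    "co T e (r *\<^sub>R a) = r * co T e a" "co T e (- a) = - co T e a"
  using co_linear[OF assms] by (simp_all add: linear_0 linear_add linear_diff linear_scale
      linear_neg)

lemma u_nonzero: "T \<in> star M x \<Longrightarrow> e \<in> Ed T \<Longrightarrow> u T e \<noteq> 0"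
  using co_u[of T e e] co_simps(1)[of T e] by auto

lemma co_eqI:
  assumes "T \<in> star M x" "\<And>e. e \<in> Ed T \<Longrightarrow> co T e a = co T e b"
  shows "a = b"
  using co_sum[OF assms(1), of a] co_sum[OF assms(1), of b] assms(2) by (metis (no_types, lifting)
      sum.cong)

lemma on_edge_iff:
  assumes "T \<in> star M x" "Ed T = {e, f}" "f \<noteq> e"
  shows "a = s *\<^sub>R u T e \<longleftrightarrow> co T e a = s \<and> co T f a = 0"
proof
  show "co T e a = s \<and> co T f a = 0 \<Longrightarrow> a = s *\<^sub>R u T e"
    using co_expand[OF assms, of a] by simp
qed (use assms in \<open>auto simp: co_simps co_u\<close>)

lemma u_scale_eq: "T \<in> star M x \<Longrightarrow> e \<in> Ed T \<Longrightarrow> s *\<^sub>R u T e = r *\<^sub>R u T e \<longleftrightarrow> s = r"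
  using u_nonzero by auto

lemma u_scale_edge:
  assumes "T \<in> star M x" "e \<in> Ed T" "f \<in> Ed T" "s *\<^sub>R u T e = r *\<^sub>R u T f" "s \<noteq> 0"
  shows "e = f"
proof -
  have "s = co T e (s *\<^sub>R u T e)" using co_simps(4) co_u assms(1,2) by simp
  also have "\<dots> = r * (if e = f then 1 else 0)"
    unfolding assms(4) using co_simps(4) co_u assms(1-3) by simp
  finally show ?thesis using assms(5) by (auto split: if_splits)
qed

lemma in_sector: "T \<in> star M x \<Longrightarrow> a \<in> sector M x T \<longleftrightarrow> (\<forall>e\<in>Ed T. 0 \<le> co T e a)"
  using sector by auto

lemma edge_in_sector: "T \<in> star M x \<Longrightarrow> e \<in> Ed T \<Longrightarrow> 0 \<le> s \<Longrightarrow> s *\<^sub>R u T e \<in> sector M x T"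
  by (auto simp: in_sector co_simps co_u)

lemma zero_in_sector: "T \<in> star M x \<Longrightarrow> 0 \<in> sector M x T"
  by (auto simp: in_sector co_simps)

lemma sector_convex:
  assumes "T \<in> star M x" "a \<in> sector M x T" "b \<in> sector M x T" "0 \<le> r" "0 \<le> s"
  shows "r *\<^sub>R a + s *\<^sub>R b \<in> sector M x T"
  using assms by (auto simp: in_sector co_simps)

section \<open>The gluing relation and the coordinates of points\<close>

lemma glue_sym: "((T, a), (T', b)) \<in> glue M x \<Longrightarrow> ((T', b), (T, a)) \<in> glue M x"
  unfolding glue by blast

text \<open>A nonzero vector on an edge ray of \<open>T'\<close> determines the edge and the
  coefficient, so two consecutive identifications run along the same edge with the same coefficient.
  The zero vector is glued only to zero vectors.\<close>

lemma glue_trans: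
  assumes "((T, a), (T', b)) \<in> glue M x" "((T', b), (T'', d)) \<in> glue M x"
  shows "((T, a), (T'', d)) \<in> glue M x"
proof -
  have S: "T \<in> star M x" "T' \<in> star M x" "T'' \<in> star M x" using assms by (auto simp: glue)
  consider "T = T' \<and> a = b" | "T' = T'' \<and> b = d" | "a = 0 \<and> b = 0" | "b = 0 \<and> d = 0"
    | e s e' s' where "e \<in> Ed T" "e \<in> Ed T'" "s > 0" "a = s *\<^sub>R u T e" "b = s *\<^sub>R u T' e"
       "e' \<in> Ed T'" "e' \<in> Ed T''" "s' > 0" "b = s' *\<^sub>R u T' e'" "d = s' *\<^sub>R u T'' e'"
    using assms unfolding glue by blast
  then show ?thesis
  proof cases
    case 3
    then have "d = 0" using assms(2) S u_nonzero by (auto simp: glue)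
    then show ?thesis using 3 S by (simp add: glue)
  next
    case 4
    then have "a = 0" using assms(1) S u_nonzero by (auto simp: glue)
    then show ?thesis using 4 S by (simp add: glue)
  next
    case 5
    then have "e = e'" using u_scale_edge[OF S(2)] by (metis less_irrefl)
    then have "s = s'" using 5 u_scale_eq[OF S(2)] by metis
    then show ?thesis using 5 \<open>e = e'\<close> S by (auto simp: glue)
  qed (use assms in auto)
qed

lemma glue_equiv: "equiv (SIGMA T:star M x. sector M x T) (glue M x)"
proof (rule equivI)
  show "glue M x \<subseteq> (SIGMA T:star M x. sector M x T) \<times> (SIGMA T:star M x. sector M x T)"
    by (auto simp: glue zero_in_sector edge_in_sector)
  show "refl_on (SIGMA T:star M x. sector M x T) (glue M x)"
    unfolding refl_on_def by (auto simp: glue zero_in_sector edge_in_sector)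
  show "sym (glue M x)" unfolding sym_def using glue_sym by auto
  show "trans (glue M x)" unfolding trans_def by (metis glue_trans surj_pair)
qed

text \<open>A relation rather than a function, because a point on an edge has coordinates in every
  cone that contains the edge, and the apex has them in all cones.\<close>

definition coord :: "'a tpoint \<Rightarrow> 'a set \<Rightarrow> real^2 \<Rightarrow> bool" where
  "coord p T a \<longleftrightarrow> p \<in> tangent_cone M x \<and> (T, a) \<in> p"

definition pt :: "'a set \<Rightarrow> real^2 \<Rightarrow> 'a tpoint" where
  "pt T a = glue M x `` {(T, a)}"

lemma coordD:
  assumes "coord p T a"
  shows "T \<in> star M x" "a \<in> sector M x T"
  using in_quotient_imp_subset[OF glue_equiv, of p] assms
  unfolding coord_def tangent_cone_def by auto

lemma coord_pt: "T \<in> star M x \<Longrightarrow> a \<in> sector M x T \<Longrightarrow> coord (pt T a) T a"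
  unfolding coord_def tangent_cone_def pt_def
  by (auto intro: quotientI simp: glue)

lemma coord_glue:
  assumes "coord p T a"
  shows "coord p T' b \<longleftrightarrow> ((T, a), (T', b)) \<in> glue M x"
  using assms quotient_eq_iff[OF glue_equiv] in_quotient_imp_closed[OF glue_equiv]
    in_quotient_imp_in_rel[OF glue_equiv]
  unfolding coord_def tangent_cone_def by (meson empty_subsetI insert_subset)

lemma coord_unique_point:
  assumes "coord p T a" "coord q T a"
  shows "p = q"
  using assms quotient_eq_iff[OF glue_equiv, of p q "(T,a)" "(T,a)"] coord_glue[OF assms(1)]
      assms(1)
  unfolding coord_def tangent_cone_def by auto

lemma pt_eq: "coord p T a \<Longrightarrow> p = pt T a"
  using coord_unique_point coord_pt coordD by blast

lemma coord_unique:
  assumes "coord p T a" "coord p T b"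
  shows "a = b"
proof -
  have "((T, a), (T, b)) \<in> glue M x" using assms coord_glue by blast
  then show ?thesis by (auto simp: glue)
qed

lemma coord_cases:
  assumes "coord p T a" "coord p T' b" "T \<noteq> T'"
  shows "a = 0 \<and> b = 0 \<or> (\<exists>e s. e \<in> Ed T \<and> e \<in> Ed T' \<and> s > 0 \<and> a = s *\<^sub>R u T e \<and> b = s *\<^sub>R u T' e)"
proof -
  have "((T, a), (T', b)) \<in> glue M x" using assms coord_glue by blast
  then show ?thesis using assms(3) by (auto simp: glue)
qed

lemma coord_apex: "T \<in> star M x \<Longrightarrow> coord (apex M x) T 0"
proof -
  assume T: "T \<in> star M x"
  have "apex M x = pt T 0"
    unfolding apex_def pt_def using T u_nonzero by (auto simp: glue)
  then show ?thesis using coord_pt[OF T zero_in_sector[OF T]] by simp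
qed

lemma coord_0_iff:
  assumes "coord p T a"
  shows "a = 0 \<longleftrightarrow> p = apex M x"
  using coord_apex[OF coordD(1)[OF assms]] coord_unique coord_unique_point assms by metis

lemma coord_edge:
  assumes "coord p T (s *\<^sub>R u T e)" "e \<in> Ed T" "e \<in> Ed T'" "T' \<in> star M x" "0 \<le> s"
  shows "coord p T' (s *\<^sub>R u T' e)"
proof -
  have "((T, s *\<^sub>R u T e), (T', s *\<^sub>R u T' e)) \<in> glue M x"
  proof (cases "s = 0")
    case False
    then have "\<exists>e'\<in>Ed T \<inter> Ed T'. \<exists>r>0. s *\<^sub>R u T e = r *\<^sub>R u T e' \<and> s *\<^sub>R u T' e = r *\<^sub>R u T' e'"
      using assms by (intro bexI[of _ e] exI[of _ s]) auto
    then show ?thesis using assms(4) coordD(1)[OF assms(1)] unfolding glue by blast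
  qed (use assms(4) coordD(1)[OF assms(1)] in \<open>simp add: glue\<close>)
  then show ?thesis using coord_glue[OF assms(1)] by blast
qed

text \<open>The interiors of the cones. An inner point has only one cone and coordinate vector
  (\<open>inner_unique\<close>); any other point lies on an edge or is the apex
  (\<open>not_inner_cases\<close>). The crossing times of a geodesic will be those at which this
  fails.\<close>

definition inner :: "'a tpoint \<Rightarrow> bool" where
  "inner p \<longleftrightarrow> (\<exists>T a. coord p T a \<and> (\<forall>e\<in>Ed T. 0 < co T e a))"

lemma inner_unique:
  assumes "coord p T a" "\<forall>e\<in>Ed T. 0 < co T e a" "coord p T' b"
  shows "T' = T" "b = a"
proof -
  have T: "T \<in> star M x" using coordD assms by blast
  show *: "T' = T"
  proof (rule ccontr)
    assume "T' \<noteq> T"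
    then consider "a = 0" | e s where "e \<in> Ed T" "a = s *\<^sub>R u T e"
      using coord_cases[OF assms(1,3)] by blast
    then show False
    proof cases
      case 1
      obtain e where "e \<in> Ed T" using two_edges[OF T] by blast
      then show False using 1 assms(2) co_simps(1)[OF T] by force
    next
      case 2
      obtain f where "f \<in> Ed T" "f \<noteq> e" using other_edge[OF T 2(1)] by blast
      then have "co T f a = 0" using 2 T by (auto simp: co_simps co_u)
      then show False using assms(2) \<open>f \<in> Ed T\<close> by force
    qed
  qed
  show "b = a" using coord_unique assms * by blast
qed

lemma inner_pos:
  assumes "inner p" "coord p T a" "e \<in> Ed T"
  shows "0 < co T e a"
  using assms inner_unique unfolding inner_def by metis

lemma not_inner_cases:
  assumes "coord p T a" "\<not> inner p" "p \<noteq> apex M x"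
  obtains e s where "e \<in> Ed T" "0 < s" "a = s *\<^sub>R u T e"
proof -
  have T: "T \<in> star M x" and a: "a \<in> sector M x T" using coordD assms by auto
  obtain f where f: "f \<in> Ed T" "co T f a \<le> 0" using assms(1,2) unfolding inner_def by (meson
      not_less)
  then have f0: "co T f a = 0" using a T by (force simp: in_sector)
  obtain e where e: "e \<in> Ed T" "e \<noteq> f" "Ed T = {f, e}" using other_edge[OF T f(1)] by blast
  have "a = co T e a *\<^sub>R u T e" using on_edge_iff[OF T, of e f a "co T e a"] e f0 by auto
  moreover have "co T e a \<noteq> 0" using calculation assms(1,3) coord_0_iff[OF assms(1)] by auto
  then have "0 < co T e a" using a T e by (force simp: in_sector)
  ultimately show ?thesis using that e by blast
qed

section \<open>Lower bounds for lengths\<close>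

definition lip :: "'a set \<Rightarrow> (real^2 \<Rightarrow> real) \<Rightarrow> bool" where
  "lip T f \<longleftrightarrow> (\<forall>a b. f b - f a \<le> fnorm M T (b - a))"

text \<open>Along a curve such a function grows by at most the length, whichever cones are visited;
  this is how an infimum over all curves is bounded from below. The second clause makes it a
  function on the glued cone.\<close>

definition calibration :: "('a set \<Rightarrow> real^2 \<Rightarrow> real) \<Rightarrow> bool" where
  "calibration \<Psi> \<longleftrightarrow> (\<forall>T\<in>star M x. lip T (\<Psi> T)) \<and>
     (\<forall>p T a T' b. coord p T a \<longrightarrow> coord p T' b \<longrightarrow> \<Psi> T a = \<Psi> T' b)"

abbreviation supp :: "'a set \<Rightarrow> real^2 \<Rightarrow> real^2 \<Rightarrow> real" where
  "supp T \<equiv> strict_normed.supp (fnorm M T)"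

lemma normed: "T \<in> star M x \<Longrightarrow> strict_normed (fnorm M T)"
  using norms by unfold_locales

lemma smooth_piece_star: "smooth_piece M x c T a b g \<Longrightarrow> T \<in> star M x"
  unfolding smooth_piece_def using coordD(1)[of "c a" T "g a"] by (auto simp: coord_def)

lemma smooth_piece_coord: "smooth_piece M x c T a b g \<Longrightarrow> t \<in> {a..b} \<Longrightarrow> coord (c t) T (g t)"
  unfolding smooth_piece_def coord_def by auto

text \<open>The functional supporting at the chord \<open>g b - g a\<close> is at most the norm on
  the velocity, and its integral is its value on the chord, that is, the norm of the chord.\<close>

lemma piece_length:
  assumes "smooth_piece M x c T a b g"
  shows "fnorm M T (g b - g a) \<le> integral {a..b} (piece_speed M T a b g)"
proof -
  have T: "T \<in> star M x" by (rule smooth_piece_star[OF assms])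
  interpret F: strict_normed "fnorm M T" by (rule normed[OF T])
  have ab: "a < b" "smooth_on {a..b} g" using assms by (auto simp: smooth_piece_def)
  obtain g' where g': "continuous_on {a..b} g'"
    "\<And>t. t \<in> {a..b} \<Longrightarrow> (g has_vector_derivative g' t) (at t within {a..b})"
    using smooth_on_vector_derivative[OF ab(2)] by metis
  have sp: "piece_speed M T a b g t = fnorm M T (g' t)" if "t \<in> {a..b}" for t
    using vector_derivative_within_interval[OF g'(2)[OF that] ab(1) that] by (simp add:
        piece_speed_def)
  have eq: "integral {a..b} (piece_speed M T a b g) = integral {a..b} (\<lambda>t. fnorm M T (g' t))"
    by (rule integral_cong) (rule sp)
  have contF: "continuous_on {a..b} (\<lambda>t. fnorm M T (g' t))"
    by (intro continuous_on_compose2[OF F.cont[of UNIV] g'(1)]) auto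
  show ?thesis
  proof (cases "g b - g a = 0")
    case True
    then show ?thesis unfolding eq using F.nonneg by (simp add: integral_nonneg
        integrable_continuous_interval contF)
  next
    case False
    define w where "w = g b - g a"
    have lin: "bounded_linear (F.supp w)"
      using F.supp_linear[of w] False by (simp add: w_def linear_conv_bounded_linear)
    have "((\<lambda>t. F.supp w (g' t)) has_integral (F.supp w (g b) - F.supp w (g a))) {a..b}"
      by (rule fundamental_theorem_of_calculus)
         (use ab in \<open>auto intro!: bounded_linear.has_vector_derivative[OF lin] g'(2)\<close>)
    moreover have "((\<lambda>t. fnorm M T (g' t)) has_integral integral {a..b} (\<lambda>t. fnorm M T (g' t)))
        {a..b}"
      by (intro integrable_integral integrable_continuous_interval contF)
    ultimately have "F.supp w (g b) - F.supp w (g a) \<le> integral {a..b} (\<lambda>t. fnorm M T (g' t))"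
      by (rule has_integral_le) (use False in \<open>auto intro!: F.supp_le simp: w_def\<close>)
    moreover have "F.supp w (g b) - F.supp w (g a) = fnorm M T w"
      using linear_diff[of "F.supp w" "g b" "g a"] F.supp_self[of w] F.supp_linear[of w] False
      by (simp add: w_def)
    ultimately show ?thesis unfolding eq w_def by simp
  qed
qed

text \<open>At a junction of two pieces the coordinates may belong to different cones; the values of
  \<open>\<Psi>\<close> agree there, so the bounds add up.\<close>

lemma calibration_length:
  assumes "has_length M x c a b L" "calibration \<Psi>"
  shows "coord (c a) T \<alpha> \<Longrightarrow> coord (c b) T' \<beta> \<Longrightarrow> \<Psi> T' \<beta> - \<Psi> T \<alpha> \<le> L"
  using assms(1)
proof (induction arbitrary: T \<alpha> T' \<beta> rule: has_length.induct)
  case (piece T0 a b g)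
  have ab: "a < b" by (rule smooth_piece_less[OF piece(1)])
  have *: "coord (c a) T0 (g a)" "coord (c b) T0 (g b)" using smooth_piece_coord[OF piece(1)] ab
      by auto
  have "\<Psi> T' \<beta> - \<Psi> T \<alpha> = \<Psi> T0 (g b) - \<Psi> T0 (g a)"
    using assms(2) * piece unfolding calibration_def by metis
  also have "\<dots> \<le> fnorm M T0 (g b - g a)"
    using assms(2) smooth_piece_star[OF piece(1)] unfolding calibration_def lip_def by blast
  finally show ?case using piece_length[OF piece(1)] by linarith
next
  case (join a b L d L')
  obtain T0 \<gamma> where "coord (c b) T0 \<gamma>"
    using join.hyps(2)
  proof (induction rule: has_length.induct)
    case (piece T a b g)
    then show ?case using smooth_piece_coord[OF piece(1), of a] smooth_piece_less by fastforce
  qed auto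
  then show ?case using join.IH(1)[OF join.prems(1)] join.IH(2)[OF _ join.prems(2)] by fastforce
qed

lemma has_length_nonneg:
  assumes "has_length M x c a b L"
  shows "0 \<le> L"
  using assms
proof (induction rule: has_length.induct)
  case (piece T a b g)
  then show ?case using piece_length[OF piece] strict_normed.nonneg[OF normed[OF
      smooth_piece_star[OF piece]]]
    by (meson order_trans)
qed auto

lemma tdist_le: "has_length M x c a b L \<Longrightarrow> tdist M x (c a) (c b) \<le> L"
  unfolding tdist_def
  by (intro cInf_lower bdd_belowI[of _ 0]) (auto dest: has_length_nonneg)

lemma calibrated_tdist:
  assumes "has_length M x c a b L" "calibration \<Psi>" "coord (c a) T \<alpha>" "coord (c b) T' \<beta>"
    "\<Psi> T' \<beta> - \<Psi> T \<alpha> = L"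
  shows "tdist M x (c a) (c b) = L"
proof (rule antisym[OF tdist_le[OF assms(1)]])
  show "L \<le> tdist M x (c a) (c b)" unfolding tdist_def
  proof (rule cInf_greatest)
    fix L' assume "L' \<in> {L. \<exists>c' a' b'. has_length M x c' a' b' L \<and> c' a' = c a \<and> c' b' = c b}"
    then obtain c' a' b' where "has_length M x c' a' b' L'" "c' a' = c a" "c' b' = c b" by blast
    then show "L \<le> L'" using calibration_length[OF _ assms(2), of c' a' b' L' T \<alpha> T' \<beta>] assms by
        simp
  qed (use assms(1) in blast)
qed

text \<open>The parameter is absolute time, so adjacent pieces with the same \<open>\<alpha>\<close>
  and \<open>v\<close> form one line without reparametrisation. A line is radial, with the apex at
  time \<open>s0\<close>, if \<open>\<alpha> = - s0 *\<^sub>R v\<close>; this is the form in which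
  radial lines occur below.\<close>

definition line :: "(real \<Rightarrow> 'a tpoint) \<Rightarrow> real set \<Rightarrow> 'a set \<Rightarrow> real^2 \<Rightarrow> real^2 \<Rightarrow> bool" where
  "line c J T \<alpha> v \<longleftrightarrow> (\<forall>t\<in>J. coord (c t) T (\<alpha> + t *\<^sub>R v))"

lemma straight_on_iff:
  "straight_on M x c J T v \<longleftrightarrow> T \<in> star M x \<and> v \<noteq> 0 \<and> (\<exists>\<alpha>. line c J T \<alpha> v)"
  unfolding straight_on_def line_def coord_def ..

lemma line_subset: "line c J T \<alpha> v \<Longrightarrow> J' \<subseteq> J \<Longrightarrow> line c J' T \<alpha> v"
  unfolding line_def by blast

lemma lineD: "line c J T \<alpha> v \<Longrightarrow> t \<in> J \<Longrightarrow> coord (c t) T (\<alpha> + t *\<^sub>R v)"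
  unfolding line_def by blast

lemma line_smooth_piece:
  "line c {a..b} T \<alpha> v \<Longrightarrow> a < b \<Longrightarrow> smooth_piece M x c T a b (\<lambda>t. \<alpha> + t *\<^sub>R v)"
  unfolding smooth_piece_def line_def coord_def by (auto intro: smooth_on_affine)

lemma affine_vector_derivative:
  "((\<lambda>t::real. \<alpha> + t *\<^sub>R v) has_vector_derivative v) (at t within A)"
  by (auto intro!: derivative_eq_intros)

lemma line_speed:
  assumes "a < b" "t \<in> {a..b}"
  shows "piece_speed M T a b (\<lambda>t. \<alpha> + t *\<^sub>R v) t = fnorm M T v"
  unfolding piece_speed_def
  using vector_derivative_within_interval[OF affine_vector_derivative assms, of \<alpha> v] by simp

lemma line_has_length:
  assumes "line c {a..b} T \<alpha> v" "a < b"
  shows "has_length M x c a b ((b - a) * fnorm M T v)"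
proof -
  have "integral {a..b} (piece_speed M T a b (\<lambda>t. \<alpha> + t *\<^sub>R v)) = integral {a..b} (\<lambda>t. fnorm M T v)"
    by (rule integral_cong) (rule line_speed[OF assms(2)])
  then show ?thesis
    using has_length.piece[OF line_smooth_piece[OF assms]] assms(2) by simp
qed

lemma const_speed_line:
  assumes "const_speed M x D c \<sigma>" "line c {a..b} T \<alpha> v" "a < b" "{a..b} \<subseteq> D"
  shows "fnorm M T v = \<sigma>"
  using const_speedD[OF assms(1,4) line_smooth_piece[OF assms(2,3)], of a]
    line_speed[OF assms(3), of a] assms(3) by simp

text \<open>The competitors used against a geodesic are broken lines of this kind. For Snell's law
  \<open>m\<close> is a point of an edge, read in two adjacent cones.\<close>

lemma tdist_two_segments:
  assumes "coord p T a" "coord m T b" "coord m T' b'" "coord q T' d" 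
  shows "tdist M x p q \<le> fnorm M T (b - a) + fnorm M T' (d - b')"
proof -
  have T: "T \<in> star M x" "T' \<in> star M x" using assms coordD by auto
  \<comment> \<open>The offset \<open>b' - (d - b')\<close> makes the second segment start in
    \<open>b'\<close> at time 1 and end in \<open>d\<close> at time 2.\<close>
  define c where "c t = (if t \<le> 1 then pt T (a + t *\<^sub>R (b - a)) else pt T' ((b' - (d - b')) + t
      *\<^sub>R (d - b')))" for t :: real
  have l1: "line c {0..1} T a (b - a)" unfolding line_def
  proof
    fix t :: real assume t: "t \<in> {0..1}"
    have "a + t *\<^sub>R (b - a) = (1 - t) *\<^sub>R a + t *\<^sub>R b" by (simp add: algebra_simps)
    then have "a + t *\<^sub>R (b - a) \<in> sector M x T"
      using sector_convex[OF T(1), of a b "1 - t" t] assms coordD t by auto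
    then show "coord (c t) T (a + t *\<^sub>R (b - a))" using coord_pt[OF T(1)] t by (simp add: c_def)
  qed
  have l2: "line c {1..2} T' (b' - (d - b')) (d - b')" unfolding line_def
  proof
    fix t :: real assume t: "t \<in> {1..2}"
    have "(b' - (d - b')) + t *\<^sub>R (d - b') = (2 - t) *\<^sub>R b' + (t - 1) *\<^sub>R d" by (simp add:
        algebra_simps scaleR_2)
    then have "(b' - (d - b')) + t *\<^sub>R (d - b') \<in> sector M x T'"
      using sector_convex[OF T(2), of b' d "2 - t" "t - 1"] assms coordD t by auto
    then have *: "coord (pt T' ((b' - (d - b')) + t *\<^sub>R (d - b'))) T' ((b' - (d - b')) + t *\<^sub>R (d
        - b'))"
      using coord_pt[OF T(2)] by simp
    show "coord (c t) T' ((b' - (d - b')) + t *\<^sub>R (d - b'))"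
    proof (cases "t = 1")
      case True
      then show ?thesis using assms(2,3) pt_eq[OF assms(2)] by (simp add: c_def)
    qed (use t * in \<open>simp add: c_def\<close>)
  qed
  have "has_length M x c 0 2 ((1 - 0) * fnorm M T (b - a) + (2 - 1) * fnorm M T' (d - b'))"
    by (rule has_length.join[OF line_has_length[OF l1] line_has_length[OF l2]]) auto
  moreover have "c 0 = p" "c 2 = q"
    using pt_eq[OF assms(1)] pt_eq[OF assms(4)] by (auto simp: c_def algebra_simps scaleR_2)
  ultimately show ?thesis using tdist_le by fastforce
qed

lemma tdist_segment:
  assumes "coord p T a" "coord q T b"
  shows "tdist M x p q \<le> fnorm M T (b - a)"
  using tdist_two_segments[OF assms(1,2,2,2)] strict_normed.zero[OF normed[OF coordD(1)[OF
      assms(1)]]] by simp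

text \<open>Two different cones share at most one edge, and the line is nonzero at two times at
  least, so it runs along that edge; the gluing carries its coefficient unchanged to the other
  cone.\<close>

lemma line_transfer:
  assumes l: "line c {a..b} T \<alpha> v" and ab: "a < b" and v: "v \<noteq> 0" and TT: "T \<noteq> T'"
    and g: "\<And>s. s \<in> {a..b} \<Longrightarrow> coord (c s) T' (g s)"
  obtains e k m where "e \<in> Ed T" "e \<in> Ed T'" "v = k *\<^sub>R u T e" "\<alpha> = m *\<^sub>R u T e" "k \<noteq> 0"
    "\<And>s. s \<in> {a..b} \<Longrightarrow> 0 \<le> m + s * k" "\<And>s. s \<in> {a..b} \<Longrightarrow> g s = (m + s * k) *\<^sub>R u T' e"
proof -
  have S: "T \<in> star M x" "T' \<in> star M x"
    using coordD(1)[OF lineD[OF l, of a]] coordD(1)[OF g[of a]] ab by auto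
  have c: "\<alpha> + s *\<^sub>R v = 0 \<and> g s = 0 \<or> (\<exists>e r. e \<in> Ed T \<and> e \<in> Ed T' \<and> r > 0 \<and> \<alpha> + s *\<^sub>R v = r *\<^sub>R u
      T e \<and> g s = r *\<^sub>R u T' e)"
    if "s \<in> {a..b}" for s
    using coord_cases[OF lineD[OF l that] g[OF that] TT] .
  have one: "s = s'" if "\<alpha> + s *\<^sub>R v = 0" "\<alpha> + s' *\<^sub>R v = 0" for s s'
    using that v by (metis add_left_cancel scaleR_cancel_right)
  \<comment> \<open>At most one time has the value 0, so two of \<open>a\<close>, the midpoint and
    \<open>b\<close> will do.\<close>
  obtain s1 s2 where s12: "s1 \<in> {a..b}" "s2 \<in> {a..b}" "s1 \<noteq> s2" "\<alpha> + s1 *\<^sub>R v \<noteq> 0" "\<alpha> + s2 *\<^sub>R v \<noteq>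
      0"
  proof -
    define h where "h = (a + b) / 2"
    have mid: "h \<in> {a..b}" "a \<noteq> h" "b \<noteq> h" "a \<noteq> b" "a \<in> {a..b}" "b \<in> {a..b}" using ab by (auto
        simp: h_def)
    consider "\<alpha> + a *\<^sub>R v = 0" | "\<alpha> + a *\<^sub>R v \<noteq> 0" "\<alpha> + b *\<^sub>R v = 0" | "\<alpha> + a *\<^sub>R v \<noteq> 0" "\<alpha> + b
        *\<^sub>R v \<noteq> 0" by blast
    then show ?thesis
    proof cases
      case 1
      then have "\<alpha> + b *\<^sub>R v \<noteq> 0" "\<alpha> + h *\<^sub>R v \<noteq> 0" using one[OF 1] mid by metis+
      then show ?thesis using that mid by metis
    next
      case 2
      then have "\<alpha> + h *\<^sub>R v \<noteq> 0" using one[OF 2(2)] mid by metis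
      then show ?thesis using that mid 2 by metis
    next
      case 3 then show ?thesis using that mid by metis
    qed
  qed
  obtain e r1 where e: "e \<in> Ed T" "e \<in> Ed T'" and r1: "\<alpha> + s1 *\<^sub>R v = r1 *\<^sub>R u T e"
    using c[OF s12(1)] s12(4) by blast
  obtain e2 r2 where e2: "e2 \<in> Ed T" "e2 \<in> Ed T'" and r2: "\<alpha> + s2 *\<^sub>R v = r2 *\<^sub>R u T e2"
    using c[OF s12(2)] s12(5) by blast
  have "e2 = e" using edge_unique[OF S TT e e2] by simp
  define k where "k = (r1 - r2) / (s1 - s2)"
  define m where "m = r1 - s1 * k"
  have "(s1 - s2) *\<^sub>R v = (r1 - r2) *\<^sub>R u T e"
    using r1 r2 \<open>e2 = e\<close> by (metis add_diff_cancel_left scaleR_left_diff_distrib)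
  then have "(1 / (s1 - s2)) *\<^sub>R ((s1 - s2) *\<^sub>R v) = (1 / (s1 - s2)) *\<^sub>R ((r1 - r2) *\<^sub>R u T e)" by
      simp
  then have vk: "v = k *\<^sub>R u T e" using s12(3) by (simp add: k_def)
  have am: "\<alpha> = m *\<^sub>R u T e"
    using r1 unfolding m_def vk by (simp add: algebra_simps)
  have k0: "k \<noteq> 0" using v vk by auto
  have at: "\<alpha> + s *\<^sub>R v = (m + s * k) *\<^sub>R u T e" for s by (simp add: vk am algebra_simps)
  have "0 \<le> m + s * k \<and> g s = (m + s * k) *\<^sub>R u T' e" if s: "s \<in> {a..b}" for s
    using c[OF s]
  proof
    assume "\<alpha> + s *\<^sub>R v = 0 \<and> g s = 0"
    then show ?thesis using at u_nonzero[OF S(1) e(1)] by simp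
  next
    assume "\<exists>e r. e \<in> Ed T \<and> e \<in> Ed T' \<and> r > 0 \<and> \<alpha> + s *\<^sub>R v = r *\<^sub>R u T e \<and> g s = r *\<^sub>R u T' e"
    then obtain e3 r where 3: "e3 \<in> Ed T" "e3 \<in> Ed T'" "r > 0" "\<alpha> + s *\<^sub>R v = r *\<^sub>R u T e3" "g s =
        r *\<^sub>R u T' e3"
      by blast
    then have "e3 = e" using edge_unique[OF S TT] e by blast
    then have "r = m + s * k" using 3(4) at[of s] u_scale_eq[OF S(1) e(1)] by metis
    then show ?thesis using 3 \<open>e3 = e\<close> by auto
  qed
  then show ?thesis using that[OF e vk am k0] by blast
qed

lemma line_change_cone:
  assumes l: "line c {a..b} T \<alpha> v" and ab: "a < b" and v: "v \<noteq> 0"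
    and g: "\<And>s. s \<in> {a..b} \<Longrightarrow> coord (c s) T' (g s)"
  obtains \<beta> w where "\<And>s. s \<in> {a..b} \<Longrightarrow> g s = \<beta> + s *\<^sub>R w" "fnorm M T' w = fnorm M T v" "w \<noteq> 0"
proof (cases "T = T'")
  case True
  then have "g s = \<alpha> + s *\<^sub>R v" if "s \<in> {a..b}" for s
    using coord_unique[OF lineD[OF l that]] g[OF that] by metis
  then show ?thesis using that True v by blast
next
  case False
  have S: "T \<in> star M x" "T' \<in> star M x"
    using coordD(1)[OF lineD[OF l, of a]] coordD(1)[OF g[of a]] ab by auto
  obtain e k m where e: "e \<in> Ed T" "e \<in> Ed T'" "v = k *\<^sub>R u T e" "k \<noteq> 0"
    "\<And>s. s \<in> {a..b} \<Longrightarrow> g s = (m + s * k) *\<^sub>R u T' e"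
    using line_transfer[OF l ab v False g] by metis
  show ?thesis
  proof (rule that)
    show "g s = m *\<^sub>R u T' e + s *\<^sub>R (k *\<^sub>R u T' e)" if "s \<in> {a..b}" for s
      using e(5)[OF that] by (simp add: algebra_simps)
    show "fnorm M T' (k *\<^sub>R u T' e) = fnorm M T v" using edge_norm[OF S e(1,2)] e(3) by simp
    show "k *\<^sub>R u T' e \<noteq> 0" using e u_nonzero[OF S(2)] by simp
  qed
qed

text \<open>\<open>const_speed\<close> speaks of every smooth piece in every cone, so the speed of
  an extended curve has to be checked for arbitrary \<open>g\<close>. A nondegenerate part on which
  the curve is straight already determines the derivative of \<open>g\<close> within the larger
  interval.\<close>

lemma line_piece_speed:
  assumes l: "line c {p..q} T \<alpha> v" and pq: "p < q" "t \<in> {p..q}" "{p..q} \<subseteq> {a..b}" and v: "v \<noteq> 0"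
    and sp: "smooth_piece M x c T' a b g"
  shows "piece_speed M T' a b g t = fnorm M T v"
proof -
  have ab: "a < b" "smooth_on {a..b} g" using sp by (auto simp: smooth_piece_def)
  have t: "t \<in> {a..b}" using pq by auto
  have co: "coord (c s) T' (g s)" if "s \<in> {p..q}" for s
    using smooth_piece_coord[OF sp] pq(3) that by blast
  obtain \<beta> w where w: "\<And>s. s \<in> {p..q} \<Longrightarrow> g s = \<beta> + s *\<^sub>R w" "fnorm M T' w = fnorm M T v"
    using line_change_cone[OF l pq(1) v co] by metis
  obtain g' where g': "\<And>t. t \<in> {a..b} \<Longrightarrow> (g has_vector_derivative g' t) (at t within {a..b})"
    using smooth_on_vector_derivative[OF ab(2)] by metis
  have "(g has_vector_derivative g' t) (at t within {p..q})"
    by (rule has_vector_derivative_within_subset[OF g'[OF t] pq(3)])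
  moreover have "(g has_vector_derivative w) (at t within {p..q})"
    by (rule has_vector_derivative_transform[OF pq(2) _ affine_vector_derivative]) (rule w(1))
  ultimately have "g' t = w"
    using vector_derivative_within_interval[OF _ pq(1,2)] by metis
  then show ?thesis
    using vector_derivative_within_interval[OF g'[OF t] ab(1) t] w(2) by (simp add: piece_speed_def)
qed

end

subsection \<open>Calibrations\<close>

lemma strict_norm_bounded_below:
  fixes F :: "'v::euclidean_space \<Rightarrow> real"
  assumes "strict_norm F"
  obtains k where "k > 0" "\<And>a. k * norm a \<le> F a"
proof -
  interpret strict_normed F using assms by unfold_locales
  have "compact (sphere (0::'v) 1)" "sphere (0::'v) 1 \<noteq> {}" by auto
  then obtain b where b: "b \<in> sphere 0 1" "\<And>y. y \<in> sphere 0 1 \<Longrightarrow> F b \<le> F y"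
    using continuous_attains_inf[OF _ _ cont] by metis
  show ?thesis
  proof
    show "0 < F b" using b(1) pos[of b] by (metis dist_0_norm mem_sphere norm_zero zero_neq_one)
    show "F b * norm a \<le> F a" for a
    proof (cases "a = 0")
      case False
      then have "F b \<le> F ((1 / norm a) *\<^sub>R a)" by (intro b(2)) simp
      also have "\<dots> = F a / norm a" by (simp add: hom)
      finally show ?thesis using False by (simp add: field_simps)
    qed auto
  qed
qed

lemma strict_norm_bounded_above:
  fixes F :: "'v::euclidean_space \<Rightarrow> real"
  assumes "strict_norm F"
  obtains K where "K > 0" "\<And>a. F a \<le> K * norm a"
proof -
  interpret strict_normed F using assms by unfold_locales
  have "compact (sphere (0::'v) 1)" "sphere (0::'v) 1 \<noteq> {}" by auto
  then obtain b where b: "b \<in> sphere 0 1" "\<And>y. y \<in> sphere 0 1 \<Longrightarrow> F y \<le> F b"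
    using continuous_attains_sup[OF _ _ cont] by metis
  show ?thesis
  proof
    show "0 < F b" using b(1) pos[of b] by (metis dist_0_norm mem_sphere norm_zero zero_neq_one)
    show "F a \<le> F b * norm a" for a
    proof (cases "a = 0")
      case False
      have "F a / norm a = F ((1 / norm a) *\<^sub>R a)" by (simp add: hom)
      also have "\<dots> \<le> F b" using False by (intro b(2)) simp
      finally show ?thesis using False by (simp add: field_simps)
    qed auto
  qed
qed

lemma finite_uniform_pos:
  assumes "finite I" "\<And>i. i \<in> I \<Longrightarrow> \<exists>k>0::real. P i k"
    and "\<And>i k k'. P i k \<Longrightarrow> 0 < k' \<Longrightarrow> k' \<le> k \<Longrightarrow> P i k'"
  obtains k where "k > 0" "\<And>i. i \<in> I \<Longrightarrow> P i k"
proof -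
  obtain K where K: "\<And>i. i \<in> I \<Longrightarrow> K i > 0 \<and> P i (K i)" using assms(2) by metis
  define k where "k = Min (insert 1 (K ` I))"
  have fin: "finite (insert 1 (K ` I))" using assms(1) by simp
  have "k > 0" unfolding k_def using fin K by (subst Min_gr_iff) auto
  moreover have "P i k" if "i \<in> I" for i
    using assms(3)[of i "K i" k] K[OF that] \<open>k > 0\<close> Min_le[OF fin, of "K i"] that unfolding k_def
        by simp
  ultimately show ?thesis using that by blast
qed

context cone_structure
begin

lemma finite_Ed: "T \<in> star M x \<Longrightarrow> finite (Ed T)"
  using card_Ed by (metis card.infinite zero_neq_numeral)

text \<open>This \<open>k\<close> will be the slope of the bump functions: \<open>k\<close> times a
  coordinate is 1-Lipschitz in both directions.\<close>

lemma co_bound: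
  obtains k where "k > 0" "\<And>T e a. T \<in> star M x \<Longrightarrow> e \<in> Ed T \<Longrightarrow> k * \<bar>co T e a\<bar> \<le> fnorm M T a"
proof -
  have ex: "\<exists>k>0. \<forall>a. k * \<bar>co T e a\<bar> \<le> fnorm M T a" if Te: "T \<in> star M x" "e \<in> Ed T" for T e
  proof -
    obtain m where m: "m > 0" "\<And>a. m * norm a \<le> fnorm M T a"
      using strict_norm_bounded_below[OF norms[OF Te(1)]] by blast
    have "bounded_linear (co T e)" using co_linear[OF Te] by (simp add: linear_conv_bounded_linear)
    then obtain B where B: "B > 0" "\<And>a. norm (co T e a) \<le> norm a * B"
      using bounded_linear.pos_bounded by blast
    have "m / B * \<bar>co T e a\<bar> \<le> fnorm M T a" for a
    proof -
      have "m / B * \<bar>co T e a\<bar> \<le> m / B * (norm a * B)"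
        using B m(1) by (intro mult_left_mono) (auto simp flip: real_norm_def)
      also have "\<dots> = m * norm a" using B(1) by simp
      finally show ?thesis using m(2)[of a] by linarith
    qed
    then show ?thesis using m(1) B(1) by (intro exI[of _ "m / B"]) simp
  qed
  have "\<exists>k>0. \<forall>i\<in>Sigma (star M x) Ed. (\<forall>a. k * \<bar>co (fst i) (snd i) a\<bar> \<le> fnorm M (fst i) a)"
  proof (rule finite_uniform_pos[of "Sigma (star M x) Ed" "\<lambda>i k. \<forall>a. k * \<bar>co (fst i) (snd i) a\<bar> \<le>
      fnorm M (fst i) a"])
    show "finite (Sigma (star M x) Ed)" using finite_star finite_Ed by (intro finite_SigmaI)
    show "\<exists>k>0. \<forall>a. k * \<bar>co (fst i) (snd i) a\<bar> \<le> fnorm M (fst i) a" if "i \<in> Sigma (star M x) Ed"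
        for i
      using ex[of "fst i" "snd i"] that by auto
    show "\<forall>a. k' * \<bar>co (fst i) (snd i) a\<bar> \<le> fnorm M (fst i) a"
      if "\<forall>a. k * \<bar>co (fst i) (snd i) a\<bar> \<le> fnorm M (fst i) a" "k' \<le> k" for i k k'
      using that by (meson abs_ge_zero mult_right_mono order_trans)
  qed auto
  then show ?thesis using that by fastforce
qed

lemma lip_min: "lip T f \<Longrightarrow> lip T g \<Longrightarrow> lip T (\<lambda>a. min (f a) (g a))"
  unfolding lip_def min_def by (smt (verit))

lemma lip_max: "lip T f \<Longrightarrow> lip T g \<Longrightarrow> lip T (\<lambda>a. max (f a) (g a))"
  unfolding lip_def max_def by (smt (verit))

lemma lip_linear:
  assumes "linear f" "\<And>a. f a \<le> fnorm M T a"
  shows "lip T (\<lambda>a. f a - k)"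
  unfolding lip_def using assms(2) linear_diff[OF assms(1)] by (metis diff_diff_eq2 diff_add_cancel)

text \<open>Clamping a functional \<open>\<phi>\<close>, which need only be compatible with the gluing near a point, by a
  bump function \<open>\<rho>\<close> makes it a calibration of the whole cone.\<close>

lemma clamp_calibration:
  assumes l: "\<And>T. T \<in> star M x \<Longrightarrow> lip T (\<phi> T)"
    and r: "\<And>T. T \<in> star M x \<Longrightarrow> lip T (\<rho> T)" "\<And>T. T \<in> star M x \<Longrightarrow> lip T (\<lambda>a. - \<rho> T a)"
    and r0: "\<And>p T a. coord p T a \<Longrightarrow> 0 \<le> \<rho> T a"
    and rc: "\<And>p T a T' b. coord p T a \<Longrightarrow> coord p T' b \<Longrightarrow> T \<noteq> T' \<Longrightarrow> \<rho> T a = \<rho> T' b"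
    and lc: "\<And>p T a T' b. coord p T a \<Longrightarrow> coord p T' b \<Longrightarrow> T \<noteq> T' \<Longrightarrow> 0 < \<rho> T a \<Longrightarrow> \<phi> T a = \<phi> T' b"
  shows "calibration (\<lambda>T a. min (max (\<phi> T a) (- \<rho> T a)) (\<rho> T a))"
  unfolding calibration_def
proof (intro conjI ballI allI impI)
  fix T assume "T \<in> star M x"
  then show "lip T (\<lambda>a. min (max (\<phi> T a) (- \<rho> T a)) (\<rho> T a))" using l r by (intro lip_min lip_max)
next
  fix p T a T' b assume c: "coord p T a" "coord p T' b"
  show "min (max (\<phi> T a) (- \<rho> T a)) (\<rho> T a) = min (max (\<phi> T' b) (- \<rho> T' b)) (\<rho> T' b)"
  proof (cases "T = T'")
    case True then show ?thesis using coord_unique c by metis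
  next
    case False
    show ?thesis
    proof (cases "\<rho> T a > 0")
      case True then show ?thesis using rc[OF c False] lc[OF c False] by simp
    next
      \<comment> \<open>Where the bump vanishes, the clamped value is 0 in both cones, whatever
        \<open>\<phi>\<close> is.\<close>
      case f: False then have "\<rho> T a = 0" using r0[OF c(1)] by simp
      then show ?thesis using rc[OF c False] by (auto simp: min_def max_def)
    qed
  qed
qed

text \<open>Positive on \<open>e\<close> away from the apex and in the interiors of the cones at
  \<open>e\<close>. It vanishes on the other edges of these cones and therefore fits together with
  the value 0 elsewhere.\<close>

definition edge_bump :: "real \<Rightarrow> 'e \<Rightarrow> 'a set \<Rightarrow> real^2 \<Rightarrow> real" where
  "edge_bump \<kappa> e T a = (if e \<in> Ed T then \<kappa> * co T e a else 0)"

lemma edge_bump: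
  assumes k: "\<kappa> > 0" "\<forall>T\<in>star M x. \<forall>e\<in>Ed T. \<forall>a. \<kappa> * \<bar>co T e a\<bar> \<le> fnorm M T a"
  shows "T \<in> star M x \<Longrightarrow> lip T (edge_bump \<kappa> e T)"
    and "T \<in> star M x \<Longrightarrow> lip T (\<lambda>a. - edge_bump \<kappa> e T a)"
    and "coord p T a \<Longrightarrow> 0 \<le> edge_bump \<kappa> e T a"
    and "coord p T a \<Longrightarrow> coord p T' b \<Longrightarrow> T \<noteq> T' \<Longrightarrow> edge_bump \<kappa> e T a = edge_bump \<kappa> e T' b"
    and "coord p T a \<Longrightarrow> coord p T' b \<Longrightarrow> T \<noteq> T' \<Longrightarrow> 0 < edge_bump \<kappa> e T a \<Longrightarrow>
      e \<in> Ed T \<and> e \<in> Ed T' \<and> (\<exists>s>0. a = s *\<^sub>R u T e \<and> b = s *\<^sub>R u T' e)"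
proof -
  have *: "\<bar>edge_bump \<kappa> e T b - edge_bump \<kappa> e T a\<bar> \<le> fnorm M T (b - a)" if T: "T \<in> star M x" for T
      a b
  proof (cases "e \<in> Ed T")
    case True
    have "\<bar>edge_bump \<kappa> e T b - edge_bump \<kappa> e T a\<bar> = \<kappa> * \<bar>co T e (b - a)\<bar>"
      using True T k(1) by (simp add: edge_bump_def co_simps abs_mult flip: right_diff_distrib)
    then show ?thesis using k(2) T True by simp
  next
    case False
    then show ?thesis using strict_normed.nonneg[OF normed[OF T]] by (simp add: edge_bump_def)
  qed
  show "T \<in> star M x \<Longrightarrow> lip T (edge_bump \<kappa> e T)" "T \<in> star M x \<Longrightarrow> lip T (\<lambda>a. - edge_bump \<kappa> e T a)"
    unfolding lip_def using * by (smt (verit))+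
  show "0 \<le> edge_bump \<kappa> e T a" if "coord p T a"
    using coordD[OF that] k(1) by (auto simp: edge_bump_def in_sector)
  have val: "edge_bump \<kappa> e T (s *\<^sub>R u T e') = (if e = e' then \<kappa> * s else 0)" if "T \<in> star M x" "e'
      \<in> Ed T" for T s e'
    using that by (auto simp: edge_bump_def co_simps co_u)
  have val0: "edge_bump \<kappa> e T 0 = 0" if "T \<in> star M x" for T
    using that by (auto simp: edge_bump_def co_simps)
  show "edge_bump \<kappa> e T a = edge_bump \<kappa> e T' b" if c: "coord p T a" "coord p T' b" "T \<noteq> T'"
    using coord_cases[OF c] coordD(1)[OF c(1)] coordD(1)[OF c(2)] val val0 by auto
  show "e \<in> Ed T \<and> e \<in> Ed T' \<and> (\<exists>s>0. a = s *\<^sub>R u T e \<and> b = s *\<^sub>R u T' e)"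
    if c: "coord p T a" "coord p T' b" "T \<noteq> T'" and p: "0 < edge_bump \<kappa> e T a"
    using coord_cases[OF c]
  proof
    assume "a = 0 \<and> b = 0"
    then show ?thesis using p val0[OF coordD(1)[OF c(1)]] by simp
  next
    assume "\<exists>e s. e \<in> Ed T \<and> e \<in> Ed T' \<and> s > 0 \<and> a = s *\<^sub>R u T e \<and> b = s *\<^sub>R u T' e"
    then obtain e' s where e': "e' \<in> Ed T" "e' \<in> Ed T'" "s > 0" "a = s *\<^sub>R u T e'" "b = s *\<^sub>R u T'
        e'" by blast
    then have "e' = e" using p val[OF coordD(1)[OF c(1)] e'(1), of s] by (auto split: if_splits)
    then show ?thesis using e' by auto
  qed
qed

text \<open>The functionals agree on \<open>e\<close>, the only edge on which the bump is positive,
  so clamping makes them compatible with the whole gluing. The constant \<open>k\<close> will be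
  their value at the crossing point, near which the clamp is then inactive.\<close>

lemma edge_calibration:
  assumes lin: "\<And>T. T \<in> star M x \<Longrightarrow> linear (\<xi> T)" and le: "\<And>T a. T \<in> star M x \<Longrightarrow> \<xi> T a \<le> fnorm M T a"
    and e: "\<And>T. T \<in> star M x \<Longrightarrow> e \<in> Ed T \<Longrightarrow> \<xi> T (u T e) = \<alpha>"
  obtains \<kappa> \<Psi> where "\<kappa> > 0" "calibration \<Psi>"
    "\<And>T a. T \<in> star M x \<Longrightarrow> e \<in> Ed T \<Longrightarrow> \<bar>\<xi> T a - k\<bar> \<le> \<kappa> * co T e a \<Longrightarrow> \<Psi> T a = \<xi> T a - k"
proof -
  obtain \<kappa> where k: "\<kappa> > 0" "\<forall>T\<in>star M x. \<forall>e\<in>Ed T. \<forall>a. \<kappa> * \<bar>co T e a\<bar> \<le> fnorm M T a"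
    using co_bound by metis
  note eb = edge_bump[OF k]
  have "calibration (\<lambda>T a. min (max (\<xi> T a - k) (- edge_bump \<kappa> e T a)) (edge_bump \<kappa> e T a))"
  proof (rule clamp_calibration)
    show "lip T (\<lambda>a. \<xi> T a - k)" if "T \<in> star M x" for T using lip_linear[OF lin le] that by blast
    show "\<xi> T a - k = \<xi> T' b - k" if c: "coord p T a" "coord p T' b" "T \<noteq> T'" "0 < edge_bump \<kappa> e T
        a" for p T a T' b
    proof -
      have S: "T \<in> star M x" "T' \<in> star M x" using c coordD by auto
      obtain s where s: "e \<in> Ed T" "e \<in> Ed T'" "a = s *\<^sub>R u T e" "b = s *\<^sub>R u T' e" using eb(5)[OF
          c] by blast
      then show ?thesis using e[OF S(1) s(1)] e[OF S(2) s(2)] linear_scale[OF lin[OF S(1)]]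
          linear_scale[OF lin[OF S(2)]]
        by simp
    qed
  qed (fact eb(1) eb(2) eb(3) eb(4))+
  moreover have "min (max (\<xi> T a - k) (- edge_bump \<kappa> e T a)) (edge_bump \<kappa> e T a) = \<xi> T a - k"
    if "e \<in> Ed T" "\<bar>\<xi> T a - k\<bar> \<le> \<kappa> * co T e a" for T a
    using that by (auto simp: edge_bump_def)
  ultimately show ?thesis using that[OF k(1)] by blast
qed

text \<open>The minimum of the two edge bumps of \<open>T0\<close> vanishes on all edges, as
  different cones share at most one edge; so a functional that lives on \<open>T0\<close> alone can
  be continued by 0.\<close>

lemma inner_calibration:
  assumes T0: "T0 \<in> star M x" and lin: "linear \<xi>" and le: "\<And>a. \<xi> a \<le> fnorm M T0 a"
  obtains \<kappa> \<Psi> where "\<kappa> > 0" "calibration \<Psi>"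
    "\<And>a. \<forall>e\<in>Ed T0. \<bar>\<xi> a - k\<bar> \<le> \<kappa> * co T0 e a \<Longrightarrow> \<Psi> T0 a = \<xi> a - k"
proof -
  obtain \<kappa> where k: "\<kappa> > 0" "\<forall>T\<in>star M x. \<forall>e\<in>Ed T. \<forall>a. \<kappa> * \<bar>co T e a\<bar> \<le> fnorm M T a"
    using co_bound by metis
  note eb = edge_bump[OF k]
  obtain e f where ef: "e \<in> Ed T0" "f \<in> Ed T0" "f \<noteq> e" "Ed T0 = {e, f}" using two_edges[OF T0] by
      blast
  define \<rho> where "\<rho> T a = min (edge_bump \<kappa> e T a) (edge_bump \<kappa> f T a)" for T a
  define \<phi> where "\<phi> T a = (if T = T0 then \<xi> a - k else 0)" for T a
  have "calibration (\<lambda>T a. min (max (\<phi> T a) (- \<rho> T a)) (\<rho> T a))"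
  proof (rule clamp_calibration)
    show "lip T (\<phi> T)" if T: "T \<in> star M x" for T
      unfolding \<phi>_def[abs_def] using lip_linear[OF lin le] strict_normed.nonneg[OF normed[OF T]]
      by (auto simp: lip_def)
    show "lip T (\<rho> T)" if T: "T \<in> star M x" for T
      unfolding \<rho>_def[abs_def] by (intro lip_min eb(1) T)
    show "lip T (\<lambda>a. - \<rho> T a)" if T: "T \<in> star M x" for T
    proof -
      have *: "- \<rho> T a = max (- edge_bump \<kappa> e T a) (- edge_bump \<kappa> f T a)" for a by (auto simp:
          \<rho>_def)
      show ?thesis unfolding * by (intro lip_max eb(2) T)
    qed
    show "0 \<le> \<rho> T a" if "coord p T a" for p T a using that eb(3) by (auto simp: \<rho>_def)
    show "\<rho> T a = \<rho> T' b" if "coord p T a" "coord p T' b" "T \<noteq> T'" for p T a T' b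
      using eb(4)[OF that] by (simp add: \<rho>_def)
    show "\<phi> T a = \<phi> T' b" if c: "coord p T a" "coord p T' b" "T \<noteq> T'" "0 < \<rho> T a" for p T a T' b
    proof -
      have "e \<in> Ed T" "e \<in> Ed T'" "f \<in> Ed T" "f \<in> Ed T'"
        using eb(5)[OF c(1-3)] c(4) by (auto simp: \<rho>_def)
      then have "e = f" using edge_unique[OF _ _ c(3)] coordD(1)[OF c(1)] coordD(1)[OF c(2)] by
          blast
      then show ?thesis using ef by simp
    qed
  qed
  moreover have "min (max (\<phi> T0 a) (- \<rho> T0 a)) (\<rho> T0 a) = \<xi> a - k" if "\<forall>e\<in>Ed T0. \<bar>\<xi> a - k\<bar> \<le> \<kappa> *
      co T0 e a" for a
    using that ef by (auto simp: \<phi>_def \<rho>_def edge_bump_def)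
  ultimately show ?thesis using that[OF k(1)] by blast
qed

text \<open>A point shared by two cones is the apex or lies on a common edge, where the norms agree
  on multiples of both signs. So the distances of a point from and to the apex can be computed in
  any of its cones.\<close>

lemma coord_norm:
  assumes "coord p T a" "coord p T' b"
  shows "fnorm M T (s *\<^sub>R a) = fnorm M T' (s *\<^sub>R b)"
proof (cases "T = T'")
  case True then show ?thesis using coord_unique assms by metis
next
  case False
  have S: "T \<in> star M x" "T' \<in> star M x" using assms coordD by auto
  show ?thesis using coord_cases[OF assms False]
  proof
    assume "a = 0 \<and> b = 0"
    then show ?thesis using strict_normed.zero[OF normed] S by simp
  next
    assume "\<exists>e r. e \<in> Ed T \<and> e \<in> Ed T' \<and> r > 0 \<and> a = r *\<^sub>R u T e \<and> b = r *\<^sub>R u T' e"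
    then show ?thesis using edge_norm[OF S] by auto
  qed
qed

text \<open>The distance from the apex and the negative of the distance to the apex. The triangle
  inequality gives the Lipschitz bound in each cone, so no clamping is involved and the apex is
  included.\<close>

lemma radial_calibration: "calibration (\<lambda>T a. fnorm M T a)" "calibration (\<lambda>T a. - fnorm M T (- a))"
proof -
  have "lip T (fnorm M T)" "lip T (\<lambda>a. - fnorm M T (- a))" if "T \<in> star M x" for T
  proof -
    interpret F: strict_normed "fnorm M T" by (rule normed[OF that])
    show "lip T (fnorm M T)" unfolding lip_def
    proof (intro allI)
      show "fnorm M T b - fnorm M T a \<le> fnorm M T (b - a)" for a b using F.tri[of a "b - a"] by simp
    qed
    show "lip T (\<lambda>a. - fnorm M T (- a))" unfolding lip_def
    proof (intro allI)
      show "- fnorm M T (- b) - - fnorm M T (- a) \<le> fnorm M T (b - a)" for a b using F.tri[of "-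
          b" "b - a"] by simp
    qed
  qed
  note lip = this
  have eq: "fnorm M T a = fnorm M T' b" "fnorm M T (- a) = fnorm M T' (- b)"
    if "coord p T a" "coord p T' b" for p T a T' b
    using coord_norm[OF that, of 1] coord_norm[OF that, of "-1"] by simp_all
  show "calibration (\<lambda>T a. fnorm M T a)" unfolding calibration_def
    by (intro conjI ballI allI impI lip(1) eq(1))
  show "calibration (\<lambda>T a. - fnorm M T (- a))" unfolding calibration_def
    by (intro conjI ballI allI impI lip(2) arg_cong[of _ _ uminus] eq(2))
qed

section \<open>Local minimality of lines and broken lines\<close>

lemma broken_line_tdist:
  assumes l: "line c {a..t0} T \<alpha> v" and l': "line c {t0..b} T' \<alpha>' v'" 
    and F: "fnorm M T v = \<sigma>" "fnorm M T' v' = \<sigma>"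
    and cal: "calibration \<Psi>"
    and psi: "\<And>t. t \<in> {a..t0} \<Longrightarrow> \<Psi> T (\<alpha> + t *\<^sub>R v) = (t - t0) * \<sigma>" 
      "\<And>t. t \<in> {t0..b} \<Longrightarrow> \<Psi> T' (\<alpha>' + t *\<^sub>R v') = (t - t0) * \<sigma>"
    and t: "a \<le> t1" "t1 < t2" "t2 \<le> b"
  shows "has_length M x c t1 t2 (tdist M x (c t1) (c t2))"
proof -
  consider "t2 \<le> t0" | "t0 \<le> t1" | "t1 < t0" "t0 < t2" by linarith
  then show ?thesis
  proof cases
    case 1
    have "line c {t1..t2} T \<alpha> v" by (rule line_subset[OF l]) (use 1 t in auto)
    from line_has_length[OF this t(2)] have h: "has_length M x c t1 t2 ((t2 - t1) * \<sigma>)" by (simp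
        add: F)
    from calibrated_tdist[OF h cal lineD[OF l] lineD[OF l]] psi[of t1] psi[of t2] 1 t
    have "tdist M x (c t1) (c t2) = (t2 - t1) * \<sigma>" by (simp add: algebra_simps)
    then show ?thesis using h by simp
  next
    case 2
    have "line c {t1..t2} T' \<alpha>' v'" by (rule line_subset[OF l']) (use 2 t in auto)
    from line_has_length[OF this t(2)] have h: "has_length M x c t1 t2 ((t2 - t1) * \<sigma>)" by (simp
        add: F)
    from calibrated_tdist[OF h cal lineD[OF l'] lineD[OF l']] psi(2)[of t1] psi(2)[of t2] 2 t
    have "tdist M x (c t1) (c t2) = (t2 - t1) * \<sigma>" by (simp add: algebra_simps)
    then show ?thesis using h by simp
  next
    case 3
    have "line c {t1..t0} T \<alpha> v" by (rule line_subset[OF l]) (use 3 t in auto)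
    from line_has_length[OF this 3(1)] have h1: "has_length M x c t1 t0 ((t0 - t1) * \<sigma>)" by (simp
        add: F)
    have "line c {t0..t2} T' \<alpha>' v'" by (rule line_subset[OF l']) (use 3 t in auto)
    from line_has_length[OF this 3(2)] have h2: "has_length M x c t0 t2 ((t2 - t0) * \<sigma>)" by (simp
        add: F)
    from has_length.join[OF h1 h2] have h: "has_length M x c t1 t2 ((t2 - t1) * \<sigma>)" by (simp add:
        algebra_simps)
    from calibrated_tdist[OF h cal lineD[OF l] lineD[OF l']] psi(1)[of t1] psi(2)[of t2] 3 t
    have "tdist M x (c t1) (c t2) = (t2 - t1) * \<sigma>" by (simp add: algebra_simps)
    then show ?thesis using h by simp
  qed
qed

text \<open>At \<open>t0\<close> the right side is positive and the left side is 0, and both change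
  at a bounded rate. This keeps the clamp inactive along a curve near \<open>t0\<close>; with
  \<open>\<kappa>\<close> and \<open>\<sigma>\<close> equal to 1 it keeps a coordinate
  positive.\<close>

lemma affine_small:
  fixes f :: "real^2 \<Rightarrow> real"
  assumes "linear f" "f (\<alpha> + t0 *\<^sub>R v) > 0" "\<kappa> > 0"
  obtains \<delta> where "\<delta> > 0" "\<And>t. \<bar>t - t0\<bar> \<le> \<delta> \<Longrightarrow> \<bar>(t - t0) * \<sigma>\<bar> \<le> \<kappa> * f (\<alpha> + t *\<^sub>R v)"
proof -
  define A where "A = f (\<alpha> + t0 *\<^sub>R v)"
  have f: "f (\<alpha> + t *\<^sub>R v) = A + (t - t0) * f v" for t
  proof -
    have "\<alpha> + t *\<^sub>R v = (\<alpha> + t0 *\<^sub>R v) + (t - t0) *\<^sub>R v" by (simp add: algebra_simps)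
    then show ?thesis using assms(1) by (simp add: A_def linear_add linear_scale)
  qed
  \<comment> \<open>A bound for the joint rate of change of both sides; the summand 1 makes it
    positive.\<close>
  define B where "B = \<bar>\<sigma>\<bar> + \<kappa> * \<bar>f v\<bar> + 1"
  have B: "B > 0" using assms(3) by (simp add: B_def add_nonneg_pos)
  have A: "A > 0" using assms(2) by (simp add: A_def)
  show ?thesis
  proof
    show "\<kappa> * A / B > 0" using A B assms(3) by simp
    fix t assume "\<bar>t - t0\<bar> \<le> \<kappa> * A / B"
    then have "\<bar>t - t0\<bar> * B \<le> \<kappa> * A" using B by (simp add: field_simps)
    then have "\<bar>t - t0\<bar> * \<bar>\<sigma>\<bar> + \<kappa> * (\<bar>t - t0\<bar> * \<bar>f v\<bar>) \<le> \<kappa> * A"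
      by (simp add: B_def algebra_simps)
    moreover have "- (\<kappa> * (\<bar>t - t0\<bar> * \<bar>f v\<bar>)) \<le> \<kappa> * ((t - t0) * f v)"
    proof -
      have "- (\<bar>t - t0\<bar> * \<bar>f v\<bar>) \<le> (t - t0) * f v" by (simp flip: abs_mult)
      from mult_left_mono[OF this, of \<kappa>] show ?thesis using assms(3) by simp
    qed
    ultimately show "\<bar>(t - t0) * \<sigma>\<bar> \<le> \<kappa> * f (\<alpha> + t *\<^sub>R v)"
      unfolding f by (simp add: abs_mult distrib_left)
  qed
qed

text \<open>Snell's law is the common value \<open>\<beta>\<close> of the functionals on the edge.
  After subtracting their value \<open>r * \<beta>\<close> at the crossing point they measure, on
  both sides, the arc length counted from \<open>t0\<close>, so the clamped calibration proves
  minimality.\<close>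

lemma edge_crossing_minimizing:
  assumes l: "line c {a..t0} T \<alpha> v" and l': "line c {t0..b} T' \<alpha>' v'" and ab: "a < t0" "t0 < b"
    and F: "fnorm M T v = \<sigma>" "fnorm M T' v' = \<sigma>"
    and e: "e \<in> Ed T" "e \<in> Ed T'" "r > 0" "\<alpha> + t0 *\<^sub>R v = r *\<^sub>R u T e" "\<alpha>' + t0 *\<^sub>R v' = r *\<^sub>R u
        T' e"
    and lin: "\<And>T. T \<in> star M x \<Longrightarrow> linear (\<xi> T)" and le: "\<And>T a. T \<in> star M x \<Longrightarrow> \<xi> T a \<le> fnorm M T a"
    and xe: "\<And>T. T \<in> star M x \<Longrightarrow> e \<in> Ed T \<Longrightarrow> \<xi> T (u T e) = \<beta>"
    and xv: "\<xi> T v = \<sigma>" "\<xi> T' v' = \<sigma>"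
  shows "minimizing_at M x D c t0"
proof -
  have S: "T \<in> star M x" "T' \<in> star M x"
    using coordD(1)[OF lineD[OF l, of t0]] coordD(1)[OF lineD[OF l', of t0]] ab by auto
  obtain \<kappa> \<Psi> where k: "\<kappa> > 0" and cal: "calibration \<Psi>"
    and psi: "\<And>T a. T \<in> star M x \<Longrightarrow> e \<in> Ed T \<Longrightarrow> \<bar>\<xi> T a - r * \<beta>\<bar> \<le> \<kappa> * co T e a \<Longrightarrow> \<Psi> T a = \<xi> T a - r *
        \<beta>"
    using edge_calibration[of \<xi> e \<beta> "r * \<beta>", OF lin le xe] by metis
  have val: "\<xi> T (\<alpha> + t *\<^sub>R v) - r * \<beta> = (t - t0) * \<sigma>"
    if "T \<in> star M x" "e \<in> Ed T" "\<alpha> + t0 *\<^sub>R v = r *\<^sub>R u T e" "\<xi> T v = \<sigma>" for T \<alpha> v t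
  proof -
    have "\<alpha> + t *\<^sub>R v = r *\<^sub>R u T e + (t - t0) *\<^sub>R v" using that(3)[symmetric] by (simp add:
        algebra_simps)
    then show ?thesis using linear_add[OF lin[OF that(1)]] linear_scale[OF lin[OF that(1)]] xe
        that by simp
  qed
  have pos: "co T e (\<alpha> + t0 *\<^sub>R v) > 0" if "T \<in> star M x" "e \<in> Ed T" "\<alpha> + t0 *\<^sub>R v = r *\<^sub>R u T e"
      for T \<alpha> v
    unfolding that(3) using that e(3) by (simp add: co_simps co_u)
  obtain d1 where d1: "d1 > 0" "\<And>t. \<bar>t - t0\<bar> \<le> d1 \<Longrightarrow> \<bar>(t - t0) * \<sigma>\<bar> \<le> \<kappa> * co T e (\<alpha> + t *\<^sub>R v)"
    using affine_small[OF co_linear[OF S(1) e(1)] pos[OF S(1) e(1,4)] k, of \<sigma>] by metis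
  obtain d2 where d2: "d2 > 0" "\<And>t. \<bar>t - t0\<bar> \<le> d2 \<Longrightarrow> \<bar>(t - t0) * \<sigma>\<bar> \<le> \<kappa> * co T' e (\<alpha>' + t *\<^sub>R v')"
    using affine_small[OF co_linear[OF S(2) e(2)] pos[OF S(2) e(2,5)] k, of \<sigma>] by metis
  define d where "d = Min {d1, d2, t0 - a, b - t0}"
  have d: "d > 0" "d \<le> d1" "d \<le> d2" "d \<le> t0 - a" "d \<le> b - t0" using d1 d2 ab by (auto simp: d_def)
  show ?thesis unfolding minimizing_at_def
  proof (intro exI[of _ d] conjI ballI impI d(1))
    fix t1 t2 assume t: "\<bar>t1 - t0\<bar> < d" "\<bar>t2 - t0\<bar> < d" "t1 < t2"
    show "has_length M x c t1 t2 (tdist M x (c t1) (c t2))"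
    proof (rule broken_line_tdist[of c "t0 - d" t0 T \<alpha> v "t0 + d" T' \<alpha>' v' \<sigma> \<Psi>])
      show "line c {t0 - d..t0} T \<alpha> v" by (rule line_subset[OF l]) (use d in auto)
      show "line c {t0..t0 + d} T' \<alpha>' v'" by (rule line_subset[OF l']) (use d in auto)
      show "\<Psi> T (\<alpha> + t *\<^sub>R v) = (t - t0) * \<sigma>" if "t \<in> {t0 - d..t0}" for t
        using psi[OF S(1) e(1), of "\<alpha> + t *\<^sub>R v"] val[OF S(1) e(1,4) xv(1), of t] d1(2)[of t] that
            d by auto
      show "\<Psi> T' (\<alpha>' + t *\<^sub>R v') = (t - t0) * \<sigma>" if "t \<in> {t0..t0 + d}" for t
        using psi[OF S(2) e(2), of "\<alpha>' + t *\<^sub>R v'"] val[OF S(2) e(2,5) xv(2), of t] d2(2)[of t]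
            that d by auto
    qed (use t F cal in auto)
  qed
qed

lemma inner_line_minimizing:
  assumes l: "line c {a..b} T \<alpha> v" and ab: "a < t0" "t0 < b" and v: "v \<noteq> 0"
    and e: "\<forall>e\<in>Ed T. 0 < co T e (\<alpha> + t0 *\<^sub>R v)"
  shows "minimizing_at M x D c t0"
proof -
  have S: "T \<in> star M x" using coordD(1)[OF lineD[OF l, of t0]] ab by auto
  interpret F: strict_normed "fnorm M T" by (rule normed[OF S])
  define \<sigma> where "\<sigma> = fnorm M T v"
  obtain e f where ef: "e \<in> Ed T" "f \<in> Ed T" "f \<noteq> e" "Ed T = {e, f}" using two_edges[OF S] by blast
  have lin: "linear (F.supp v)" by (rule F.supp_linear[OF v])
  define k where "k = F.supp v (\<alpha> + t0 *\<^sub>R v)"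
  obtain \<kappa> \<Psi> where \<kappa>: "\<kappa> > 0" and cal: "calibration \<Psi>"
    and psi: "\<And>a. \<forall>e\<in>Ed T. \<bar>F.supp v a - k\<bar> \<le> \<kappa> * co T e a \<Longrightarrow> \<Psi> T a = F.supp v a - k"
    using inner_calibration[OF S lin F.supp_le[OF v], of k] by metis
  have val: "F.supp v (\<alpha> + t *\<^sub>R v) - k = (t - t0) * \<sigma>" for t
    unfolding k_def using lin by (simp add: linear_add linear_scale F.supp_self[OF v] \<sigma>_def
        algebra_simps)
  obtain d1 where d1: "d1 > 0" "\<And>t. \<bar>t - t0\<bar> \<le> d1 \<Longrightarrow> \<bar>(t - t0) * \<sigma>\<bar> \<le> \<kappa> * co T e (\<alpha> + t *\<^sub>R v)"
    using affine_small[OF co_linear[OF S ef(1)] _ \<kappa>, of \<alpha> t0 v \<sigma>] e ef by metis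
  obtain d2 where d2: "d2 > 0" "\<And>t. \<bar>t - t0\<bar> \<le> d2 \<Longrightarrow> \<bar>(t - t0) * \<sigma>\<bar> \<le> \<kappa> * co T f (\<alpha> + t *\<^sub>R v)"
    using affine_small[OF co_linear[OF S ef(2)] _ \<kappa>, of \<alpha> t0 v \<sigma>] e ef by metis
  define d where "d = Min {d1, d2, t0 - a, b - t0}"
  have d: "d > 0" "d \<le> d1" "d \<le> d2" "d \<le> t0 - a" "d \<le> b - t0" using d1 d2 ab by (auto simp: d_def)
  have eq: "\<Psi> T (\<alpha> + t *\<^sub>R v) = (t - t0) * \<sigma>" if "\<bar>t - t0\<bar> \<le> d" for t
    using psi[of "\<alpha> + t *\<^sub>R v"] val[of t] d1(2)[of t] d2(2)[of t] that d ef by auto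
  show ?thesis unfolding minimizing_at_def
  proof (intro exI[of _ d] conjI ballI impI d(1))
    fix t1 t2 assume t: "\<bar>t1 - t0\<bar> < d" "\<bar>t2 - t0\<bar> < d" "t1 < t2"
    show "has_length M x c t1 t2 (tdist M x (c t1) (c t2))"
    proof (rule broken_line_tdist[of c "t0 - d" t0 T \<alpha> v "t0 + d" T \<alpha> v \<sigma> \<Psi>])
      show "line c {t0 - d..t0} T \<alpha> v" by (rule line_subset[OF l]) (use d in auto)
      show "line c {t0..t0 + d} T \<alpha> v" by (rule line_subset[OF l]) (use d in auto)
    qed (use t cal eq in \<open>auto simp: \<sigma>_def\<close>)
  qed
qed

text \<open>\<open>s0\<close> is the time at which the line would be at the apex. On either side of
  it a global calibration is available, so minimality is not merely local and holds up to the
  apex.\<close>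

lemma radial_tdist:
  assumes l: "line c {a..b} T (- s0 *\<^sub>R v) v" and ab: "a < b" and s0: "s0 \<le> a \<or> b \<le> s0"
  shows "has_length M x c a b (tdist M x (c a) (c b))"
proof -
  have S: "T \<in> star M x" using coordD(1)[OF lineD[OF l, of a]] ab by auto
  interpret F: strict_normed "fnorm M T" by (rule normed[OF S])
  note h = line_has_length[OF l ab]
  have c: "coord (c a) T ((a - s0) *\<^sub>R v)" "coord (c b) T ((b - s0) *\<^sub>R v)"
    using lineD[OF l, of a] lineD[OF l, of b] ab by (auto simp: algebra_simps)
  have "tdist M x (c a) (c b) = (b - a) * fnorm M T v"
  proof (cases "s0 \<le> a")
    case True
    then have "fnorm M T ((b - s0) *\<^sub>R v) - fnorm M T ((a - s0) *\<^sub>R v) = (b - a) * fnorm M T v"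
      using ab F.hom[of "b - s0" v] F.hom[of "a - s0" v] by (simp add: left_diff_distrib)
    then show ?thesis by (rule calibrated_tdist[OF h radial_calibration(1) c])
  next
    case False
    have m: "- ((t - s0) *\<^sub>R v) = (s0 - t) *\<^sub>R v" for t by (simp add: algebra_simps)
    have "- fnorm M T (- ((b - s0) *\<^sub>R v)) - - fnorm M T (- ((a - s0) *\<^sub>R v)) = (b - a) * fnorm M
        T v"
      using ab False s0 F.hom[of "s0 - b" v] F.hom[of "s0 - a" v] unfolding m by (simp add:
          left_diff_distrib)
    then show ?thesis by (rule calibrated_tdist[OF h radial_calibration(2) c])
  qed
  then show ?thesis using h by simp
qed

end

subsection \<open>Local structure of geodesics\<close>

lemma smooth_piece_subset:
  assumes "smooth_piece M x c T a b g" "a \<le> a'" "a' < b'" "b' \<le> b"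
  shows "smooth_piece M x c T a' b' g"
  using assms smooth_on_subset[of "{a..b}" g "{a'..b'}"] unfolding smooth_piece_def by auto

lemma piece_speed_subset:
  assumes "smooth_piece M x c T a b g" "a \<le> a'" "a' < b'" "b' \<le> b" "t \<in> {a'..b'}"
  shows "piece_speed M T a' b' g t = piece_speed M T a b g t"
proof -
  have ab: "a < b" "smooth_on {a..b} g" using assms by (auto simp: smooth_piece_def)
  obtain g' where g': "\<And>t. t \<in> {a..b} \<Longrightarrow> (g has_vector_derivative g' t) (at t within {a..b})"
    using smooth_on_vector_derivative[OF ab(2)] by metis
  have t: "t \<in> {a..b}" using assms by auto
  have "(g has_vector_derivative g' t) (at t within {a'..b'})"
    by (rule has_vector_derivative_within_subset[OF g'[OF t]]) (use assms in auto)
  from vector_derivative_within_interval[OF this assms(3,5)] vector_derivative_within_interval[OF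
      g'[OF t] ab(1) t]
  show ?thesis by (simp add: piece_speed_def)
qed

lemma atLeastAtMost_subset_join: "{a..b} \<subseteq> D \<Longrightarrow> {b..d} \<subseteq> D \<Longrightarrow> {a..d::'b::linorder} \<subseteq> D"
  by (metis atLeastAtMost_iff linear subset_iff)

locale cone_geodesic = cone_structure M x Ed u co
  for M :: "'a pf_surface" and x :: 'a and Ed :: "'a set \<Rightarrow> 'e set" and u co +
  fixes D :: "real set" and c :: "real \<Rightarrow> 'a tpoint" and \<sigma> :: real
  assumes geodesic: "geodesic M x D c" and sigma_pos: "0 < \<sigma>" and speed: "const_speed M x D c \<sigma>"
begin

lemma interval: "is_interval D" and pws: "piecewise_smooth M x D c"
  and minimizing: "t0 \<in> D \<Longrightarrow> minimizing_at M x D c t0"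
  using geodesic unfolding geodesic_iff by auto

lemma has_length_sigma: "has_length M x c a b L \<Longrightarrow> {a..b} \<subseteq> D \<Longrightarrow> L = \<sigma> * (b - a)"
proof (induction rule: has_length.induct)
  case (piece T a b g)
  have "integral {a..b} (piece_speed M T a b g) = integral {a..b} (\<lambda>t. \<sigma>)"
    by (rule integral_cong) (rule const_speedD[OF speed piece(2,1)])
  then show ?case using smooth_piece_less[OF piece(1)] by simp
next
  case (join a b L d L')
  have "a < b" "b < d" using has_length_less[OF join.hyps(1)] has_length_less[OF join.hyps(2)] by
      auto
  then have "{a..b} \<subseteq> D" "{b..d} \<subseteq> D" using join.prems by auto
  then show ?case using join.IH by (simp add: algebra_simps)
qed

lemma local_tdist:
  assumes "t0 \<in> D"
  obtains \<epsilon> where "\<epsilon> > 0" "\<And>t1 t2. t1 \<in> D \<Longrightarrow> t2 \<in> D \<Longrightarrow> \<bar>t1 - t0\<bar> < \<epsilon> \<Longrightarrow> \<bar>t2 - t0\<bar> < \<epsilon> \<Longrightarrow> t1 < t2 \<Longrightarrow>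
    tdist M x (c t1) (c t2) = \<sigma> * (t2 - t1)"
proof -
  obtain \<epsilon> where e: "\<epsilon> > 0" "\<And>t1 t2. t1 \<in> D \<Longrightarrow> t2 \<in> D \<Longrightarrow> \<bar>t1 - t0\<bar> < \<epsilon> \<Longrightarrow> \<bar>t2 - t0\<bar> < \<epsilon> \<Longrightarrow> t1 < t2 \<Longrightarrow>
    has_length M x c t1 t2 (tdist M x (c t1) (c t2))"
    using minimizing[OF assms] unfolding minimizing_at_def by blast
  show ?thesis
    by (rule that[OF e(1)]) (rule has_length_sigma[OF e(2)], use is_interval_subset[OF interval]
        in auto)
qed

text \<open>Close to any time, an arc of \<open>g\<close> is as long as the distance of its ends,
  which is at most the norm of the chord. So the norms of chords add up, and equality in the
  triangle inequality puts all points on one segment. The velocity is locally constant, hence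
  constant by connectedness.\<close>

lemma smooth_piece_line:
  assumes sp: "smooth_piece M x c T a b g" and D: "{a..b} \<subseteq> D"
  obtains \<alpha> v where "v \<noteq> 0" "fnorm M T v = \<sigma>" "line c {a..b} T \<alpha> v"
proof -
  have ab: "a < b" "smooth_on {a..b} g" using sp by (auto simp: smooth_piece_def)
  have S: "T \<in> star M x" by (rule smooth_piece_star[OF sp])
  interpret F: strict_normed "fnorm M T" by (rule normed[OF S])
  obtain g' where g': "\<And>t. t \<in> {a..b} \<Longrightarrow> (g has_vector_derivative g' t) (at t within {a..b})"
    using smooth_on_vector_derivative[OF ab(2)] by metis
  have le: "fnorm M T (g s - g r) \<le> \<sigma> * (s - r)" if "a \<le> r" "r < s" "s \<le> b" for r s
  proof -
    have p: "smooth_piece M x c T r s g" by (rule smooth_piece_subset[OF sp that])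
    have "{r..s} \<subseteq> D" using that D by auto
    then show ?thesis using has_length_sigma[OF has_length.piece[OF p]] piece_length[OF p] by simp
  qed
  have nbhd: "\<exists>d>0. \<exists>w. \<forall>t\<in>{a..b}. \<bar>t - t0\<bar> < d \<longrightarrow> g' t = w" if t0: "t0 \<in> {a..b}" for t0
  proof -
    obtain \<epsilon> where e: "\<epsilon> > 0" "\<And>t1 t2. t1 \<in> D \<Longrightarrow> t2 \<in> D \<Longrightarrow> \<bar>t1 - t0\<bar> < \<epsilon> \<Longrightarrow> \<bar>t2 - t0\<bar> < \<epsilon> \<Longrightarrow> t1 < t2 \<Longrightarrow>
      tdist M x (c t1) (c t2) = \<sigma> * (t2 - t1)" using local_tdist[of t0] t0 D by blast
    have eq: "fnorm M T (g s - g r) = \<sigma> * (s - r)"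
      if "a \<le> r" "r < s" "s \<le> b" "\<bar>r - t0\<bar> < \<epsilon>" "\<bar>s - t0\<bar> < \<epsilon>" for r s
    proof -
      have rs: "r \<in> {a..b}" "s \<in> {a..b}" using that by auto
      have "r \<in> D" "s \<in> D" using rs D by blast+
      then have "\<sigma> * (s - r) = tdist M x (c r) (c s)" using e(2)[of r s] that by simp
      also have "\<dots> \<le> fnorm M T (g s - g r)"
        by (rule tdist_segment[OF smooth_piece_coord[OF sp rs(1)] smooth_piece_coord[OF sp rs(2)]])
      finally show ?thesis using le[of r s] that by simp
    qed
    define p where "p = max a (t0 - \<epsilon>/2)"
    define q where "q = min b (t0 + \<epsilon>/2)"
    have pq: "a \<le> p" "p < q" "q \<le> b" "\<bar>p - t0\<bar> < \<epsilon>" "\<bar>q - t0\<bar> < \<epsilon>"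
      using ab t0 e(1) by (auto simp: p_def q_def)
    \<comment> \<open>The mean velocity on \<open>[p, q]\<close>, which turns out to be the velocity
      near \<open>t0\<close>.\<close>
    define w where "w = (1 / (q - p)) *\<^sub>R (g q - g p)"
    have aff: "g t = (g p - p *\<^sub>R w) + t *\<^sub>R w" if t: "t \<in> {p..q}" for t
    proof -
      consider "t = p" | "t = q" | "p < t" "t < q" using t by force
      then show ?thesis
      proof cases
        case 1 then show ?thesis by simp
      next
        case 2
        have "g p - p *\<^sub>R w + q *\<^sub>R w = g p + (q - p) *\<^sub>R w" by (simp add: algebra_simps)
        also have "\<dots> = g q" using pq by (simp add: w_def)
        finally show ?thesis using 2 by simp
      next
        case 3
        have n: "fnorm M T (g t - g p) = \<sigma> * (t - p)" "fnorm M T (g q - g t) = \<sigma> * (q - t)"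
          "fnorm M T (g q - g p) = \<sigma> * (q - p)"
          using 3 pq by (auto intro!: eq)
        have nz: "g t - g p \<noteq> 0" "g q - g t \<noteq> 0"
          using n 3 sigma_pos F.zero_iff[of "g t - g p"] F.zero_iff[of "g q - g t"] by auto
        have "fnorm M T ((g t - g p) + (g q - g t)) = fnorm M T (g t - g p) + fnorm M T (g q - g t)"
          using n by (simp add: algebra_simps)
        then obtain k where k: "k > 0" "g q - g t = k *\<^sub>R (g t - g p)" using F.tri_eq[OF nz] by
            blast
        have "\<sigma> * (q - t) = fnorm M T (k *\<^sub>R (g t - g p))" using n(2) k(2) by simp
        also have "\<dots> = k * (\<sigma> * (t - p))" unfolding n(1)[symmetric] using k(1) by (intro F.hom) simp
        finally have "\<sigma> * (q - t) = k * (\<sigma> * (t - p))" .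
        then have "\<sigma> * (k * (t - p)) = \<sigma> * (q - t)" by (metis mult.left_commute)
        \<comment> \<open>Comparing norms identifies the factor with the ratio of the two durations,
          so the segment is traversed linearly in time.\<close>
        then have kk: "k * (t - p) = q - t" using sigma_pos by simp
        have "g q - g p = (g q - g t) + (g t - g p)" by simp
        also have "\<dots> = (k + 1) *\<^sub>R (g t - g p)" unfolding k(2) by (simp add: algebra_simps)
        finally have "(t - p) *\<^sub>R (g q - g p) = ((t - p) * (k + 1)) *\<^sub>R (g t - g p)" by simp
        also have "(t - p) * (k + 1) = q - p" using kk by (simp add: algebra_simps)
        finally have "(1 / (q - p)) *\<^sub>R ((t - p) *\<^sub>R (g q - g p)) = g t - g p" using pq by simp
        then have "(t - p) *\<^sub>R w = g t - g p" by (simp add: w_def)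
        then show ?thesis by (simp add: algebra_simps)
      qed
    qed
    have "g' t = w" if t: "t \<in> {a..b}" "\<bar>t - t0\<bar> < \<epsilon>/2" for t
    proof -
      have "t0 - \<epsilon>/2 \<le> t" "t \<le> t0 + \<epsilon>/2" using t(2) by linarith+
      then have tpq: "t \<in> {p..q}" using t by (simp add: p_def q_def)
      have "(g has_vector_derivative g' t) (at t within {p..q})"
        by (rule has_vector_derivative_within_subset[OF g'[OF t(1)]]) (use pq in auto)
      moreover have "(g has_vector_derivative w) (at t within {p..q})"
        by (rule has_vector_derivative_transform[OF tpq _ affine_vector_derivative]) (rule aff)
      ultimately show ?thesis using vector_derivative_within_interval[OF _ pq(2) tpq] by metis
    qed
    then show ?thesis using e(1) by (intro exI[of _ "\<epsilon>/2"] exI[of _ w] conjI) auto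
  qed
  have const: "g' s = g' a" if s: "s \<in> {a..b}" for s
  proof (rule connected_local_const[of "{a..b}"])
    show "\<forall>t\<in>{a..b}. \<forall>\<^sub>F s in at t within {a..b}. g' t = g' s"
    proof
      fix t assume t: "t \<in> {a..b}"
      obtain d w where d: "d > 0" "\<forall>s\<in>{a..b}. \<bar>s - t\<bar> < d \<longrightarrow> g' s = w" using nbhd[OF t] by blast
      then have "\<forall>s\<in>{a..b}. s \<noteq> t \<and> dist s t < d \<longrightarrow> g' t = g' s" using t by (auto simp:
          dist_real_def)
      then show "\<forall>\<^sub>F s in at t within {a..b}. g' t = g' s"
        using d(1) unfolding eventually_at by blast
    qed
  qed (use s ab in auto)
  define v where "v = g' a"
  obtain \<alpha> where "\<And>t. t \<in> {a..b} \<Longrightarrow> g t - t *\<^sub>R v = \<alpha>"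
  proof (rule has_vector_derivative_zero_constant[of "{a..b}" "\<lambda>t. g t - t *\<^sub>R v"])
    show "((\<lambda>t. g t - t *\<^sub>R v) has_vector_derivative 0) (at t within {a..b})" if "t \<in> {a..b}" for t
      using g'[OF that] const[OF that]
      by (auto intro!: derivative_eq_intros simp: v_def)
  qed auto
  then have g: "g t = \<alpha> + t *\<^sub>R v" if "t \<in> {a..b}" for t using that by (metis diff_add_cancel)
  have l: "line c {a..b} T \<alpha> v" unfolding line_def using smooth_piece_coord[OF sp] g by metis
  have n: "fnorm M T v = \<sigma>" by (rule const_speed_line[OF speed l ab(1) D])
  then have "v \<noteq> 0" using sigma_pos F.zero by auto
  then show ?thesis using that l n by blast
qed

lemma line_norm:
  assumes "line c {a..b} T \<alpha> v" "a < b" "{a..b} \<subseteq> D"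
  shows "fnorm M T v = \<sigma>" "v \<noteq> 0" "T \<in> star M x"
proof -
  show S: "T \<in> star M x" using coordD(1)[OF lineD[OF assms(1), of a]] assms by auto
  show n: "fnorm M T v = \<sigma>" by (rule const_speed_line[OF speed assms])
  show "v \<noteq> 0" using n sigma_pos strict_normed.zero[OF normed[OF S]] by auto
qed

text \<open>Induction over the concatenation of pieces, in which \<open>smooth_piece_line\<close>
  has already replaced each piece by a straight line.\<close>

lemma interval_induct [consumes 2, case_names line join]:
  assumes ab: "a < b" and D: "{a..b} \<subseteq> D"
    and line: "\<And>a b T \<alpha> v. a < b \<Longrightarrow> {a..b} \<subseteq> D \<Longrightarrow> line c {a..b} T \<alpha> v \<Longrightarrow> P a b"
    and join: "\<And>a b d. a < b \<Longrightarrow> b < d \<Longrightarrow> {a..d} \<subseteq> D \<Longrightarrow> P a b \<Longrightarrow> P b d \<Longrightarrow> P a d"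
  shows "P a b"
proof -
  have "a \<in> D" "b \<in> D" using ab D by auto
  then obtain L where "has_length M x c a b L" using pws ab unfolding piecewise_smooth_def by blast
  then show ?thesis using D
  proof (induction rule: has_length.induct)
    case (piece T a b g)
    then show ?case using smooth_piece_line[OF piece] line smooth_piece_less by metis
  next
    case (join a b L d L')
    have *: "a < b" "b < d" using has_length_less[OF join.hyps(1)] has_length_less[OF
        join.hyps(2)] by auto
    then have "{a..b} \<subseteq> D" "{b..d} \<subseteq> D" using join.prems by auto
    then show ?case using * join.IH join.prems assms(4) by blast
  qed
qed

lemma right_germ:
  assumes "a < b" "{a..b} \<subseteq> D"
  shows "\<exists>d T \<alpha> v. a < d \<and> d \<le> b \<and> line c {a..d} T \<alpha> v"
  using assms
proof (induction rule: interval_induct)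
  case (line a b T \<alpha> v) then show ?case by blast
next
  case (join a b d)
  then show ?case by (metis less_imp_le order_trans)
qed

text \<open>Sectors are convex, so the segment from \<open>c (b - h)\<close> to
  \<open>c (b + h)\<close> is a competitor, even if \<open>c b\<close> lies on an edge or is the
  apex. Its length is \<open>h * fnorm M T (v + w)\<close>, so minimality forces equality in the
  triangle inequality for \<open>v\<close> and \<open>w\<close>.\<close>

lemma same_cone_straight:
  assumes l: "line c {a..b} T \<alpha> v" "line c {b..d} T \<beta> w" and abd: "a < b" "b < d" "{a..d} \<subseteq> D"
  shows "\<beta> = \<alpha>" "w = v"
proof -
  have sub: "{a..b} \<subseteq> D" "{b..d} \<subseteq> D" "b \<in> D" using abd by auto
  note v = line_norm[OF l(1) abd(1) sub(1)] and w = line_norm[OF l(2) abd(2) sub(2)]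
  interpret F: strict_normed "fnorm M T" by (rule normed[OF v(3)])
  have eqb: "\<alpha> + b *\<^sub>R v = \<beta> + b *\<^sub>R w"
    using coord_unique[OF lineD[OF l(1), of b] lineD[OF l(2), of b]] abd by simp
  obtain \<epsilon> where e: "\<epsilon> > 0" "\<And>t1 t2. t1 \<in> D \<Longrightarrow> t2 \<in> D \<Longrightarrow> \<bar>t1 - b\<bar> < \<epsilon> \<Longrightarrow> \<bar>t2 - b\<bar> < \<epsilon> \<Longrightarrow> t1 < t2 \<Longrightarrow>
      tdist M x (c t1) (c t2) = \<sigma> * (t2 - t1)" using local_tdist[OF sub(3)] by blast
  define h where "h = Min {\<epsilon>/2, b - a, d - b}"
  have h: "h > 0" "h < \<epsilon>" "h \<le> b - a" "h \<le> d - b" using e(1) abd by (auto simp: h_def)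
  have "2 * h * \<sigma> = tdist M x (c (b - h)) (c (b + h))"
    using e(2)[of "b - h" "b + h"] h abd by (auto simp: subset_iff)
  also have "\<dots> \<le> fnorm M T ((\<beta> + (b + h) *\<^sub>R w) - (\<alpha> + (b - h) *\<^sub>R v))"
    by (rule tdist_segment; rule lineD, rule l, use h abd in auto)
  also have "(\<beta> + (b + h) *\<^sub>R w) - (\<alpha> + (b - h) *\<^sub>R v) = h *\<^sub>R (v + w)"
    using eqb by (simp add: algebra_simps)
  also have "fnorm M T (h *\<^sub>R (v + w)) = h * fnorm M T (v + w)" using h by (simp add: F.hom)
  finally have "2 * \<sigma> \<le> fnorm M T (v + w)" using h(1) by simp
  then have "fnorm M T (v + w) = fnorm M T v + fnorm M T w" using F.tri[of v w] v(1) w(1) by simp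
  then obtain k where k: "k > 0" "w = k *\<^sub>R v" using F.tri_eq[OF v(2) w(2)] by blast
  then have "\<sigma> = k * \<sigma>" using v(1) w(1) F.hom[of k v] by simp
  then have "k = 1" using sigma_pos by simp
  then show "w = v" using k by simp
  then show "\<beta> = \<alpha>" using eqb by simp
qed

lemma line_join: "line c {a..b} T \<alpha> v \<Longrightarrow> line c {b..d} T \<alpha> v \<Longrightarrow> line c {a..d} T \<alpha> v"
  unfolding line_def by (meson atLeastAtMost_iff linear)

text \<open>Moving the crossing point along the edge cannot shorten the curve, so the derivative of
  the length of the broken line vanishes.\<close>

lemma snell:
  assumes l: "line c {a..t0} T \<alpha> v" "line c {t0..b} T' \<alpha>' v'" and ab: "a < t0" "t0 < b" "{a..b} \<subseteq> D"
    and e: "e \<in> Ed T" "e \<in> Ed T'" "0 < r" "\<alpha> + t0 *\<^sub>R v = r *\<^sub>R u T e" "\<alpha>' + t0 *\<^sub>R v' = r *\<^sub>R u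
        T' e"
  shows "supp T v (u T e) = supp T' v' (u T' e)"
proof -
  have sub: "{a..t0} \<subseteq> D" "{t0..b} \<subseteq> D" "t0 \<in> D" using ab by auto
  note v = line_norm[OF l(1) ab(1) sub(1)] and v' = line_norm[OF l(2) ab(2) sub(2)]
  interpret F: strict_normed "fnorm M T" by (rule normed[OF v(3)])
  interpret F': strict_normed "fnorm M T'" by (rule normed[OF v'(3)])
  obtain \<epsilon> where eps: "\<epsilon> > 0" "\<And>t1 t2. t1 \<in> D \<Longrightarrow> t2 \<in> D \<Longrightarrow> \<bar>t1 - t0\<bar> < \<epsilon> \<Longrightarrow> \<bar>t2 - t0\<bar> < \<epsilon> \<Longrightarrow> t1 < t2 \<Longrightarrow>
      tdist M x (c t1) (c t2) = \<sigma> * (t2 - t1)" using local_tdist[OF sub(3)] by blast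
  define h where "h = Min {\<epsilon>/2, t0 - a, b - t0}"
  have h: "h > 0" "h < \<epsilon>" "h \<le> t0 - a" "h \<le> b - t0" using eps(1) ab by (auto simp: h_def)
  \<comment> \<open>By homogeneity \<open>h * f s\<close> is the length of the broken line from
    \<open>c (t0 - h)\<close> to \<open>c (t0 + h)\<close> whose crossing point is shifted by
    \<open>h * s\<close> along the edge. The bound \<open>r / h\<close> on \<open>s\<close> keeps
    this point on the edge ray.\<close>
  define f where "f s = fnorm M T (v + s *\<^sub>R u T e) + fnorm M T' (v' + s *\<^sub>R (- u T' e))" for s
  have min: "f 0 \<le> f s" if s: "\<bar>0 - s\<bar> < r / h" for s
  proof -
    have "\<bar>s\<bar> * h < r" using s h(1) by (simp add: pos_less_divide_eq)
    moreover have "h * (- \<bar>s\<bar>) \<le> h * s" using h(1) by (intro mult_left_mono) auto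
    ultimately have rs: "0 \<le> r + h * s" by (simp add: mult.commute)
    define m where "m = pt T ((r + h * s) *\<^sub>R u T e)"
    have m: "coord m T ((r + h * s) *\<^sub>R u T e)" unfolding m_def
      by (rule coord_pt[OF v(3) edge_in_sector[OF v(3) e(1) rs]])
    have m': "coord m T' ((r + h * s) *\<^sub>R u T' e)" by (rule coord_edge[OF m e(1,2) v'(3) rs])
    have "2 * h * \<sigma> = tdist M x (c (t0 - h)) (c (t0 + h))"
      using eps(2)[of "t0 - h" "t0 + h"] h ab by (auto simp: subset_iff)
    also have "\<dots> \<le> fnorm M T ((r + h * s) *\<^sub>R u T e - (\<alpha> + (t0 - h) *\<^sub>R v))
        + fnorm M T' ((\<alpha>' + (t0 + h) *\<^sub>R v') - (r + h * s) *\<^sub>R u T' e)"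
      by (rule tdist_two_segments[OF lineD[OF l(1)] m m' lineD[OF l(2)]]) (use h ab in auto)
    also have "(r + h * s) *\<^sub>R u T e - (\<alpha> + (t0 - h) *\<^sub>R v) = h *\<^sub>R (v + s *\<^sub>R u T e)"
    proof -
      have "(r + h * s) *\<^sub>R u T e = (\<alpha> + t0 *\<^sub>R v) + (h * s) *\<^sub>R u T e" unfolding e(4) by (simp
          add: algebra_simps)
      then show ?thesis by (simp add: algebra_simps)
    qed
    also have "(\<alpha>' + (t0 + h) *\<^sub>R v') - (r + h * s) *\<^sub>R u T' e = h *\<^sub>R (v' + s *\<^sub>R (- u T' e))"
    proof -
      have "(r + h * s) *\<^sub>R u T' e = (\<alpha>' + t0 *\<^sub>R v') + (h * s) *\<^sub>R u T' e" unfolding e(5) by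
          (simp add: algebra_simps)
      then show ?thesis by (simp add: algebra_simps)
    qed
    also have "fnorm M T (h *\<^sub>R (v + s *\<^sub>R u T e)) + fnorm M T' (h *\<^sub>R (v' + s *\<^sub>R (- u T' e))) =
        h * f s"
      using h by (simp add: F.hom F'.hom f_def distrib_left)
    finally have "2 * \<sigma> \<le> f s" using h(1) by simp
    then show ?thesis using v(1) v'(1) by (simp add: f_def)
  qed
  have "(f has_real_derivative (supp T v (u T e) + supp T' v' (- u T' e))) (at 0)"
    unfolding f_def[abs_def] by (intro DERIV_add F.supp_along[OF v(2)] F'.supp_along[OF v'(2)])
  then have "supp T v (u T e) + supp T' v' (- u T' e) = 0"
    by (rule DERIV_local_min[of _ _ _ "r / h"]) (use min e h in auto)
  then show ?thesis using linear_neg[OF F'.supp_linear[OF v'(2)], of "u T' e"] by simp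
qed

text \<open>A radial line is at the apex only at time \<open>s0\<close>. At any other change of cone
  the curve is on an edge ray, where it can be read as a radial line of the new cone as well; there
  \<open>same_cone_straight\<close> continues it along the ray, which can be read in
  \<open>T\<close> again.\<close>

lemma radial_forward:
  assumes "a < b" "{a..b} \<subseteq> D" "a0 < a" "{a0..a} \<subseteq> D" "line c {a0..a} T (- s0 *\<^sub>R v) v"
    "s0 \<in> {a..b} \<Longrightarrow> c s0 \<noteq> apex M x"
  shows "line c {a0..b} T (- s0 *\<^sub>R v) v"
  using assms
proof (induction arbitrary: a0 rule: interval_induct)
  case (line a b T' \<beta> w)
  note l = line.prems(3) and l' = line.hyps(3)
  have sub: "{a0..b} \<subseteq> D" by (rule atLeastAtMost_subset_join[OF line.prems(2) line.hyps(2)])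
  note v = line_norm[OF l line.prems(1,2)]
  show ?case
  proof (cases "T' = T")
    case True
    have "\<beta> = - s0 *\<^sub>R v" "w = v" using same_cone_straight[OF l _ line.prems(1) line.hyps(1) sub,
        of \<beta> w] l' True by auto
    then show ?thesis using line_join[OF l] l' True by blast
  next
    case False
    have T': "T' \<in> star M x" by (rule line_norm(3)[OF l' line.hyps(1,2)])
    have ca: "coord (c a) T ((a - s0) *\<^sub>R v)" using lineD[OF l, of a] line.prems(1) by (simp add:
        algebra_simps)
    have "a - s0 \<noteq> 0"
    proof
      assume "a - s0 = 0"
      then have "c s0 = apex M x" "s0 \<in> {a..b}" using coord_0_iff[OF ca] line.hyps(1) by auto
      then show False using line.prems(4) by blast
    qed
    have "T \<noteq> T'" using False by simp
    from coord_cases[OF ca lineD[OF l', of a] this] \<open>a - s0 \<noteq> 0\<close> v(2) line.hyps(1)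
    obtain e r where e: "e \<in> Ed T" "e \<in> Ed T'" "r > 0" "(a - s0) *\<^sub>R v = r *\<^sub>R u T e" by auto
    define k where "k = r / (a - s0)"
    have vk: "v = k *\<^sub>R u T e"
    proof -
      have "(1 / (a - s0)) *\<^sub>R ((a - s0) *\<^sub>R v) = (1 / (a - s0)) *\<^sub>R (r *\<^sub>R u T e)" unfolding e(4)
          ..
      then show ?thesis using \<open>a - s0 \<noteq> 0\<close> by (simp add: k_def)
    qed
    \<comment> \<open>\<open>coord_edge\<close> moves a point to another cone only for a nonnegative
      coefficient; membership in the sector supplies the sign.\<close>
    have pos: "0 \<le> (s - s0) * k" if "coord p T1 (((s - s0) * k) *\<^sub>R u T1 e)" "e \<in> Ed T1" for p s T1
    proof -
      have T1: "T1 \<in> star M x" "((s - s0) * k) *\<^sub>R u T1 e \<in> sector M x T1" using coordD[OF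
          that(1)] by auto
      then have "0 \<le> co T1 e (((s - s0) * k) *\<^sub>R u T1 e)" using in_sector that(2) by blast
      then show ?thesis using T1(1) that(2) by (simp add: co_simps co_u)
    qed
    have "line c {a0..a} T' (- s0 *\<^sub>R (k *\<^sub>R u T' e)) (k *\<^sub>R u T' e)" unfolding line_def
    proof
      fix s assume s: "s \<in> {a0..a}"
      have "- s0 *\<^sub>R v + s *\<^sub>R v = ((s - s0) * k) *\<^sub>R u T e" by (simp add: vk algebra_simps)
      then have cs: "coord (c s) T (((s - s0) * k) *\<^sub>R u T e)" using lineD[OF l s] by simp
      have "coord (c s) T' (((s - s0) * k) *\<^sub>R u T' e)"
        by (rule coord_edge[OF cs e(1,2) T' pos[OF cs e(1)]])
      then show "coord (c s) T' (- s0 *\<^sub>R (k *\<^sub>R u T' e) + s *\<^sub>R (k *\<^sub>R u T' e))" by (simp add: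
          algebra_simps)
    qed
    from same_cone_straight[OF this l' line.prems(1) line.hyps(1) sub]
    have bw: "\<beta> = - s0 *\<^sub>R (k *\<^sub>R u T' e)" "w = k *\<^sub>R u T' e" by auto
    have "line c {a..b} T (- s0 *\<^sub>R v) v" unfolding line_def
    proof
      fix s assume s: "s \<in> {a..b}"
      have "\<beta> + s *\<^sub>R w = ((s - s0) * k) *\<^sub>R u T' e" by (simp add: bw algebra_simps)
      then have cs: "coord (c s) T' (((s - s0) * k) *\<^sub>R u T' e)" using lineD[OF l' s] by simp
      have "coord (c s) T (((s - s0) * k) *\<^sub>R u T e)"
        by (rule coord_edge[OF cs e(2,1) v(3) pos[OF cs e(2)]])
      then show "coord (c s) T (- s0 *\<^sub>R v + s *\<^sub>R v)" by (simp add: vk algebra_simps)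
    qed
    then show ?thesis by (rule line_join[OF l])
  qed
next
  case (join a b d)
  have ab: "{a..b} \<subseteq> {a..d}" "{b..d} \<subseteq> {a..d}" using join.hyps by auto
  have l: "line c {a0..b} T (- s0 *\<^sub>R v) v" by (rule join.IH(1)[OF join.prems(1-3)]) (use
      join.prems(4) ab in auto)
  have "a0 < b" using join by simp
  moreover have "{a0..b} \<subseteq> D" 
    by (rule atLeastAtMost_subset_join[OF join.prems(2)]) (use join.hyps(3) ab in blast)
  ultimately show ?case by (rule join.IH(2)[OF _ _ l]) (use join.prems(4) ab in auto)
qed

text \<open>At an inner junction both lines belong to the same cone, in which a geodesic does not
  bend.\<close>

lemma inner_straight:
  assumes "a < b" "{a..b} \<subseteq> D" "\<And>t. t \<in> {a<..<b} \<Longrightarrow> inner (c t)"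
  shows "\<exists>T \<alpha> v. line c {a..b} T \<alpha> v"
  using assms
proof (induction rule: interval_induct)
  case (line a b T \<alpha> v) then show ?case by blast
next
  case (join a b d)
  obtain T \<alpha> v where l: "line c {a..b} T \<alpha> v" using join by fastforce
  obtain T' \<alpha>' v' where l': "line c {b..d} T' \<alpha>' v'" using join by fastforce
  have i: "inner (c b)" using join by auto
  have c: "coord (c b) T (\<alpha> + b *\<^sub>R v)" "coord (c b) T' (\<alpha>' + b *\<^sub>R v')"
    using lineD[OF l, of b] lineD[OF l', of b] join by auto
  have "T' = T" by (rule inner_unique[OF c(1) _ c(2)]) (use inner_pos[OF i c(1)] in blast)
  then have "\<alpha>' = \<alpha>" "v' = v" using same_cone_straight[OF l _ join.hyps(1-3), of \<alpha>' v'] l' by auto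
  then show ?case using line_join[OF l] l' \<open>T' = T\<close> by blast
qed

text \<open>On a straight piece these times are zeros of coordinates, which are affine in time. A
  coordinate that vanishes identically would make the line parallel to an edge through the origin
  and hence radial, which the last assumption excludes.\<close>

lemma finite_not_inner:
  assumes "a < b" "{a..b} \<subseteq> D"
    and "\<And>a b T \<alpha> v s. a < b \<Longrightarrow> {a..b} \<subseteq> D \<Longrightarrow> line c {a..b} T \<alpha> v \<Longrightarrow> \<alpha> + s *\<^sub>R v \<noteq> 0"
  shows "finite {t \<in> {a..b}. \<not> inner (c t)}"
  using assms(1,2)
proof (induction rule: interval_induct)
  case (line a b T \<alpha> v)
  note v = line_norm[OF line(3,1,2)]
  have "{t \<in> {a..b}. \<not> inner (c t)} \<subseteq> (\<Union>f\<in>Ed T. {t. co T f (\<alpha> + t *\<^sub>R v) = 0})"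
  proof
    fix t assume t: "t \<in> {t \<in> {a..b}. \<not> inner (c t)}"
    have ct: "coord (c t) T (\<alpha> + t *\<^sub>R v)" using lineD[OF line(3)] t by auto
    then obtain f where "f \<in> Ed T" "\<not> 0 < co T f (\<alpha> + t *\<^sub>R v)" using t unfolding inner_def by blast
    then show "t \<in> (\<Union>f\<in>Ed T. {t. co T f (\<alpha> + t *\<^sub>R v) = 0})"
      using coordD[OF ct] in_sector by (auto intro!: bexI[of _ f] antisym)
  qed
  moreover have "finite (\<Union>f\<in>Ed T. {t. co T f (\<alpha> + t *\<^sub>R v) = 0})"
  proof (intro finite_UN_I finite_Ed v(3))
    fix f assume f: "f \<in> Ed T"
    have "t = t'" if "co T f (\<alpha> + t *\<^sub>R v) = 0" "co T f (\<alpha> + t' *\<^sub>R v) = 0" for t t'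
    proof (rule ccontr)
      assume "t \<noteq> t'"
      have 1: "co T f \<alpha> + t * co T f v = 0" "co T f \<alpha> + t' * co T f v = 0" using that v(3) f by
          (simp_all add: co_simps)
      then have "t * co T f v = t' * co T f v" by linarith
      then have "(t - t') * co T f v = 0" by (simp add: left_diff_distrib)
      then have 2: "co T f v = 0" "co T f \<alpha> = 0" using \<open>t \<noteq> t'\<close> 1 by auto
      obtain e where e: "e \<in> Ed T" "e \<noteq> f" "Ed T = {f, e}" using other_edge[OF v(3) f] by blast
      have E: "v = co T e v *\<^sub>R u T e" "\<alpha> = co T e \<alpha> *\<^sub>R u T e"
        using on_edge_iff[OF v(3), of e f] 2 e by auto
      then have "co T e v \<noteq> 0" using v(2) by auto
      then have "\<alpha> + (- co T e \<alpha> / co T e v) *\<^sub>R v = 0"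
        by (subst E(2), subst (2) E(1)) (simp flip: scaleR_add_left)
      then show False using assms(3)[OF line(1-3)] by blast
    qed
    then have "{t. co T f (\<alpha> + t *\<^sub>R v) = 0} \<subseteq> {SOME t. co T f (\<alpha> + t *\<^sub>R v) = 0}"
      by (auto intro: someI2)
    then show "finite {t. co T f (\<alpha> + t *\<^sub>R v) = 0}" using finite_subset by blast
  qed
  ultimately show ?case using finite_subset by blast
next
  case (join a b d)
  have "{t \<in> {a..d}. \<not> inner (c t)} \<subseteq> {t \<in> {a..b}. \<not> inner (c t)} \<union> {t \<in> {b..d}. \<not> inner (c t)}"
      by auto
  then show ?case using join.IH finite_subset by blast
qed

end

subsection \<open>Finiteness of the number of crossings\<close>

context cone_structure
begin

lemma line_end_in_sector:
  assumes l: "line c {a..<b} T \<alpha> v" and ab: "a < b"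
  shows "\<alpha> + b *\<^sub>R v \<in> sector M x T"
proof -
  have T: "T \<in> star M x" using coordD(1)[OF lineD[OF l, of a]] ab by simp
  have "0 \<le> co T e (\<alpha> + b *\<^sub>R v)" if e: "e \<in> Ed T" for e
  proof (rule continuous_ge_on_closure[of "{a..<b}" "\<lambda>t. co T e (\<alpha> + t *\<^sub>R v)"])
    show "b \<in> closure {a..<b}" using ab by simp
    have "co T e (\<alpha> + t *\<^sub>R v) = co T e \<alpha> + t * co T e v" for t using T e by (simp add: co_simps)
    then show "continuous_on (closure {a..<b}) (\<lambda>t. co T e (\<alpha> + t *\<^sub>R v))"
      by (simp add: continuous_intros)
    show "0 \<le> co T e (\<alpha> + t *\<^sub>R v)" if "t \<in> {a..<b}" for t
      using coordD(2)[OF lineD[OF l that]] in_sector[OF T] e by blast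
  qed
  then show ?thesis using in_sector[OF T] by blast
qed

text \<open>Used in contrapositive form: a line that is not radial crosses every edge it meets
  transversally.\<close>

lemma parallel_radial:
  fixes v w \<alpha> :: "real^2"
  assumes "v \<noteq> 0" "v = k *\<^sub>R w" "\<alpha> + a *\<^sub>R v = s *\<^sub>R w"
  shows "\<alpha> + (a - s / k) *\<^sub>R v = 0"
proof -
  have "k \<noteq> 0"
  proof
    assume "k = 0"
    then have "v = 0" using assms(2) by simp
    then show False using assms(1) by simp
  qed
  have "\<alpha> + (a - s / k) *\<^sub>R v = (\<alpha> + a *\<^sub>R v) - (s / k) *\<^sub>R v" by (simp add: algebra_simps)
  also have "(s / k) *\<^sub>R v = s *\<^sub>R w" using assms(2) \<open>k \<noteq> 0\<close> by simp
  finally show ?thesis using assms(3) by simp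
qed

text \<open>Up to scaling, \<open>u T f + s *\<^sub>R u T e\<close> are the directions that point
  from \<open>e\<close> into the cone, and \<open>supp_exists_direction\<close> prescribes the value
  of the supporting functional on \<open>u T e\<close>.\<close>

lemma refracted_direction:
  assumes T: "T \<in> star M x" "e \<in> Ed T" and b: "- fnorm M T (- u T e) < \<beta>" "\<beta> < fnorm M T (u T e)"
  shows "\<exists>y. y \<noteq> 0 \<and> supp T y (u T e) = \<beta> \<and> (\<forall>f\<in>Ed T. f \<noteq> e \<longrightarrow> 0 < co T f y)"
proof -
  interpret F: strict_normed "fnorm M T" by (rule normed[OF T(1)])
  obtain f where f: "f \<in> Ed T" "f \<noteq> e" "Ed T = {e, f}" using other_edge[OF T] by blast
  have co: "co T f (u T f + s *\<^sub>R u T e) = 1" for s using T f by (simp add: co_simps co_u)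
  have nz: "u T f + s *\<^sub>R u T e \<noteq> 0" for s
    using co[of s] co_simps(1)[OF T(1) f(1)] by (metis zero_neq_one)
  obtain s where "F.supp (u T f + s *\<^sub>R u T e) (u T e) = \<beta>"
    using F.supp_exists_direction[OF nz b] by blast
  then show ?thesis using nz co f by (intro exI[of _ "u T f + s *\<^sub>R u T e"]) auto
qed

text \<open>There are finitely many ordered pairs of edges of a cone, so the constants of
  \<open>triangle_defect\<close> have a positive lower bound. One constant for all crossings makes
  the loss at each of them definite.\<close>

lemma uniform_defect:
  obtains \<kappa> where "\<kappa> > 0" "\<And>T e f s t. T \<in> star M x \<Longrightarrow> e \<in> Ed T \<Longrightarrow> f \<in> Ed T \<Longrightarrow> e \<noteq> f \<Longrightarrow> 0 \<le> s \<Longrightarrow> 0 \<le> t \<Longrightarrow>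
     fnorm M T (t *\<^sub>R u T f) \<le> fnorm M T (s *\<^sub>R u T e) + fnorm M T (t *\<^sub>R u T f - s *\<^sub>R u T e) - \<kappa>
         * fnorm M T (s *\<^sub>R u T e)"
proof -
  define P where "P i \<kappa> \<longleftrightarrow> (case i of (T, e, f) \<Rightarrow> \<forall>s\<ge>0. \<forall>t\<ge>0. e \<noteq> f \<longrightarrow>
     fnorm M T (t *\<^sub>R u T f) \<le> fnorm M T (s *\<^sub>R u T e) + fnorm M T (t *\<^sub>R u T f - s *\<^sub>R u T e) - \<kappa>
         * fnorm M T (s *\<^sub>R u T e))"
    for i and \<kappa> :: real
  define I where "I = (SIGMA T:star M x. Ed T \<times> Ed T)"
  have fin: "finite I" unfolding I_def using finite_star finite_Ed by (intro finite_SigmaI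
      finite_cartesian_product)
  have ex: "\<exists>k>0. P i k" if "i \<in> I" for i
  proof -
    obtain T e f where i: "i = (T, e, f)" "T \<in> star M x" "e \<in> Ed T" "f \<in> Ed T" using \<open>i \<in> I\<close>
        unfolding I_def by auto
    interpret F: strict_normed "fnorm M T" by (rule normed[OF i(2)])
    show ?thesis
    proof (cases "e = f")
      case True then show ?thesis unfolding P_def i by (intro exI[of _ 1]) simp
    next
      case False
      have "\<nexists>k. 0 < k \<and> u T e = k *\<^sub>R u T f"
        using u_scale_edge[OF i(2,3,4), of 1] False by auto
      then obtain \<kappa> where "\<kappa> > 0" "\<forall>s\<ge>0. \<forall>t\<ge>0. fnorm M T (t *\<^sub>R u T f) \<le> fnorm M T (s *\<^sub>R u T e) +
          fnorm M T (t *\<^sub>R u T f - s *\<^sub>R u T e) - \<kappa> * fnorm M T (s *\<^sub>R u T e)"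
        using F.triangle_defect[of "u T e" "u T f"] u_nonzero i by blast
      then show ?thesis unfolding P_def i by (intro exI[of _ \<kappa>]) simp
    qed
  qed
  have mono: "P i k'" if "P i k" "0 < k'" "k' \<le> k" "i \<in> I" for i k k'
  proof -
    obtain T e f where i: "i = (T, e, f)" "T \<in> star M x" "e \<in> Ed T" "f \<in> Ed T" using \<open>i \<in> I\<close>
        unfolding I_def by auto
    have "k' * fnorm M T a \<le> k * fnorm M T a" for a
      using that(3) strict_normed.nonneg[OF normed[OF i(2)]] by (rule mult_right_mono)
    then show ?thesis using that(1) unfolding P_def i by (smt (verit) case_prod_conv)
  qed
  \<comment> \<open>\<open>finite_uniform_pos\<close> asks for monotonicity at every index, so
    membership in \<open>I\<close> is made part of the predicate.\<close>
  obtain k where "k > 0" "\<And>i. i \<in> I \<Longrightarrow> P i k \<or> i \<notin> I"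
    using finite_uniform_pos[of I "\<lambda>i k. P i k \<or> i \<notin> I"] fin ex mono by metis
  then show ?thesis using that[of k] unfolding I_def P_def by fastforce
qed

lemma uniform_reversibility:
  obtains k where "k > 0" "\<And>T a. T \<in> star M x \<Longrightarrow> k * fnorm M T (- a) \<le> fnorm M T a"
proof -
  have ex: "\<exists>k>0. \<forall>a. k * fnorm M T (- a) \<le> fnorm M T a" if T: "T \<in> star M x" for T
  proof -
    obtain m where m: "m > 0" "\<And>a. m * norm a \<le> fnorm M T a"
      using strict_norm_bounded_below[OF norms[OF T]] by blast
    obtain K where K: "K > 0" "\<And>a. fnorm M T a \<le> K * norm a"
      using strict_norm_bounded_above[OF norms[OF T]] by blast
    have "m / K * fnorm M T (- a) \<le> fnorm M T a" for a
    proof -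
      have "m / K * fnorm M T (- a) \<le> m / K * (K * norm a)"
        using K(2)[of "- a"] m(1) K(1) by (intro mult_left_mono) auto
      also have "\<dots> = m * norm a" using K(1) by simp
      finally show ?thesis using m(2)[of a] by linarith
    qed
    then show ?thesis using m(1) K(1) by (intro exI[of _ "m / K"]) simp
  qed
  have mono: "\<forall>a. k' * fnorm M T (- a) \<le> fnorm M T a \<or> T \<notin> star M x"
    if "\<forall>a. k * fnorm M T (- a) \<le> fnorm M T a \<or> T \<notin> star M x" "k' \<le> k" for T k k'
    using that strict_normed.nonneg[OF normed] by (meson mult_right_mono order_trans)
  show ?thesis
    using finite_uniform_pos[OF finite_star, of "\<lambda>T k. \<forall>a. k * fnorm M T (- a) \<le> fnorm M T a \<or> T \<notin>
        star M x"] ex mono that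
    by metis
qed

end

text \<open>With \<open>r\<close> and \<open>g\<close> the distances of the crossing points from and to the apex, \<open>l\<close> the lengths
  of the segments between them and \<open>q = d F\<^sub>v(position)\<close>, which Snell's law makes continuous at
  the edges, infinitely many crossings are impossible: \<open>r - q\<close> decreases by a definite part of \<open>r\<close>
  at each crossing, so \<open>r\<close>, \<open>g\<close> and \<open>q\<close> tend to \<open>0\<close>, although \<open>g + q\<close> is nonnegative and strictly
  increasing.\<close>

lemma crossing_sequences_contradiction:
  fixes r g q l :: "nat \<Rightarrow> real"
  assumes q: "\<And>n. q (Suc n) = q n + l n" and rq: "\<And>n. q n \<le> r n" and gq: "\<And>n. - g n \<le> q n"
    and r: "\<And>n. r (Suc n) \<le> r n + l n - \<kappa> * r n" and g: "\<And>n. g n < g (Suc n) + l n"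
    and gr: "\<And>n. k * g n \<le> r n" and pos: "\<And>n. 0 \<le> g n" "\<And>n. 0 \<le> r n" and \<kappa>: "\<kappa> > 0" and k: "k > 0"
  shows False
proof -
  have d: "\<kappa> * r n \<le> (r n - q n) - (r (Suc n) - q (Suc n))" for n using q[of n] r[of n] by simp
  have dec: "decseq (\<lambda>n. r n - q n)"
  proof (rule decseq_SucI)
    show "r (Suc n) - q (Suc n) \<le> r n - q n" for n
      using d[of n] pos(2)[of n] \<kappa> by (smt (verit) mult_nonneg_nonneg)
  qed
  then obtain L where L: "(\<lambda>n. r n - q n) \<longlonglongrightarrow> L"
    using decseq_convergent[OF dec, of 0] rq by (metis diff_ge_0_iff_ge)
  \<comment> \<open>The increments of a convergent sequence tend to 0, and divided by
    \<open>\<kappa>\<close> they dominate \<open>r\<close>.\<close>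
  have "(\<lambda>n. ((r n - q n) - (r (Suc n) - q (Suc n))) / \<kappa>) \<longlonglongrightarrow> (L - L) / \<kappa>"
    by (intro tendsto_intros L LIMSEQ_Suc[OF L]) (use \<kappa> in auto)
  then have "(\<lambda>n. ((r n - q n) - (r (Suc n) - q (Suc n))) / \<kappa>) \<longlonglongrightarrow> 0" by simp
  then have r0: "r \<longlonglongrightarrow> 0"
  proof (rule tendsto_sandwich[OF _ _ tendsto_const, rotated 2])
    show "\<forall>\<^sub>F n in sequentially. r n \<le> ((r n - q n) - (r (Suc n) - q (Suc n))) / \<kappa>"
      using d \<kappa> by (intro always_eventually allI) (simp add: pos_le_divide_eq mult.commute)
  qed (use pos in auto)
  have g0: "g \<longlonglongrightarrow> 0"
  proof (rule tendsto_sandwich[OF _ _ tendsto_const])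
    show "\<forall>\<^sub>F n in sequentially. g n \<le> r n / k"
      using gr k by (intro always_eventually allI) (simp add: pos_le_divide_eq mult.commute)
    show "(\<lambda>n. r n / k) \<longlonglongrightarrow> 0" using tendsto_divide[OF r0 tendsto_const, of k] k by simp
  qed (use pos in auto)
  have q0: "q \<longlonglongrightarrow> 0"
    by (rule tendsto_sandwich[of "\<lambda>n. - g n" q sequentially r 0])
       (use rq gq r0 tendsto_minus[OF g0] in auto)
  have "g n + q n < g (Suc n) + q (Suc n)" for n using g[of n] q[of n] by simp
  then have inc: "incseq (\<lambda>n. g n + q n)" "g 0 + q 0 < g 1 + q 1"
    by (auto intro!: incseq_SucI less_imp_le)
  have "(\<lambda>n. g n + q n) \<longlonglongrightarrow> 0 + 0" by (intro tendsto_add g0 q0)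
  then have "g 1 + q 1 \<le> 0" using incseq_le[OF inc(1)] by fastforce
  then show False using inc(2) gq[of 0] by simp
qed

context cone_geodesic
begin

text \<open>A segment that is not radial joins different edges of its cone, which supplies the
  inequalities of \<open>crossing_sequences_contradiction\<close>. The times \<open>z n\<close> may
  converge or not, so spiralling in finite time and winding around the apex forever are both
  excluded.\<close>

lemma no_infinite_crossings:
  fixes z :: "nat \<Rightarrow> real"
  assumes z: "\<And>n. z n < z (Suc n)" "\<And>n. {z n..z (Suc n)} \<subseteq> D"
    and l: "\<And>n. line c {z n..z (Suc n)} (T n) (\<alpha> n) (v n)"
    and edge: "\<And>n. \<not> inner (c (z n))" "\<And>n. c (z n) \<noteq> apex M x"
    and nr: "\<And>n s. \<alpha> n + s *\<^sub>R v n \<noteq> 0"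
  shows False
proof -
  obtain \<kappa> where \<kappa>: "\<kappa> > 0" and defect: "\<And>T e f s t. T \<in> star M x \<Longrightarrow> e \<in> Ed T \<Longrightarrow> f \<in> Ed T \<Longrightarrow> e \<noteq> f \<Longrightarrow>
      0 \<le> s \<Longrightarrow> 0 \<le> t \<Longrightarrow>
     fnorm M T (t *\<^sub>R u T f) \<le> fnorm M T (s *\<^sub>R u T e) + fnorm M T (t *\<^sub>R u T f - s *\<^sub>R u T e) - \<kappa>
         * fnorm M T (s *\<^sub>R u T e)"
    using uniform_defect by metis
  obtain k where k: "k > 0" "\<And>T a. T \<in> star M x \<Longrightarrow> k * fnorm M T (- a) \<le> fnorm M T a"
    using uniform_reversibility by metis
  define P where "P n = \<alpha> n + z n *\<^sub>R v n" for n
  define Q where "Q n = \<alpha> n + z (Suc n) *\<^sub>R v n" for n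
  have coP: "coord (c (z n)) (T n) (P n)" for n unfolding P_def using lineD[OF l] z(1)[of n] by simp
  have coQ: "coord (c (z (Suc n))) (T n) (Q n)" for n unfolding Q_def using lineD[OF l] z(1)[of n]
      by simp
  note v = line_norm[OF l z(1,2)]
  have PQ: "Q n = P n + (z (Suc n) - z n) *\<^sub>R v n" for n by (simp add: P_def Q_def algebra_simps)
  have PQ': "Q n - P n = (z (Suc n) - z n) *\<^sub>R v n" for n by (simp add: PQ)
  have edges: "\<exists>e f s t. e \<in> Ed (T n) \<and> f \<in> Ed (T n) \<and> e \<noteq> f \<and> 0 < s \<and> 0 < t \<and> P n = s *\<^sub>R u (T n)
      e \<and> Q n = t *\<^sub>R u (T n) f" for n
  proof -
    obtain e s where e: "e \<in> Ed (T n)" "0 < s" "P n = s *\<^sub>R u (T n) e" using not_inner_cases[OF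
        coP edge] by metis
    obtain f t where f: "f \<in> Ed (T n)" "0 < t" "Q n = t *\<^sub>R u (T n) f" using not_inner_cases[OF
        coQ edge] by metis
    have "e \<noteq> f"
    proof
      assume "e = f"
      then have "(z (Suc n) - z n) *\<^sub>R v n = (t - s) *\<^sub>R u (T n) e" using PQ'[of n] e f by (simp
          add: algebra_simps)
      then have "(1 / (z (Suc n) - z n)) *\<^sub>R ((z (Suc n) - z n) *\<^sub>R v n) = (1 / (z (Suc n) - z n))
          *\<^sub>R ((t - s) *\<^sub>R u (T n) e)" by simp
      then have "v n = ((t - s) / (z (Suc n) - z n)) *\<^sub>R u (T n) e" using z(1)[of n] by simp
      from parallel_radial[OF v(2) this, of "\<alpha> n" "z n" s] show False using nr e(3) by (simp add:
          P_def)
    qed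
    then show ?thesis using e f by blast
  qed
  define r where "r n = fnorm M (T n) (P n)" for n
  define g where "g n = fnorm M (T n) (- P n)" for n
  define q where "q n = supp (T n) (v n) (P n)" for n
  define len where "len n = (z (Suc n) - z n) * \<sigma>" for n
  \<comment> \<open>\<open>coord_norm\<close> allows the distances at the next crossing to be
    computed in the cone that is being left.\<close>
  have rQ: "r (Suc n) = fnorm M (T n) (Q n)" "g (Suc n) = fnorm M (T n) (- Q n)" for n
    using coord_norm[OF coQ[of n] coP[of "Suc n"], of 1] coord_norm[OF coQ[of n] coP[of "Suc n"],
        of "-1"]
    by (simp_all add: r_def g_def)
  have len: "fnorm M (T n) (Q n - P n) = len n" for n
    unfolding PQ' len_def using strict_normed.hom[OF normed[OF v(3)]] v(1) z(1)[of n] by simp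
  \<comment> \<open>Snell's law, carried from the edge vector to the crossing point by
    linearity.\<close>
  have qQ: "q (Suc n) = supp (T n) (v n) (Q n)" for n
  proof (cases "T n = T (Suc n)")
    case True
    have "{z n..z (Suc (Suc n))} \<subseteq> D" by (rule atLeastAtMost_subset_join[OF z(2) z(2)])
    from same_cone_straight[OF l _ z(1) z(1) this, of "\<alpha> (Suc n)" "v (Suc n)"] l[of "Suc n"] True
    have "v (Suc n) = v n" by simp
    moreover have "P (Suc n) = Q n" using coord_unique[OF coP[of "Suc n"]] coQ[of n] True by simp
    ultimately show ?thesis using True by (simp add: q_def)
  next
    case False
    have "Q n \<noteq> 0" using nr by (simp add: Q_def)
    then obtain e s where e: "e \<in> Ed (T n)" "e \<in> Ed (T (Suc n))" "s > 0" "Q n = s *\<^sub>R u (T n) e"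
        "P (Suc n) = s *\<^sub>R u (T (Suc n)) e"
      using coord_cases[OF coQ coP False] by blast
    have D: "{z n..z (Suc (Suc n))} \<subseteq> D" by (rule atLeastAtMost_subset_join[OF z(2) z(2)])
    have "supp (T n) (v n) (u (T n) e) = supp (T (Suc n)) (v (Suc n)) (u (T (Suc n)) e)"
      by (rule snell[OF l l z(1) z(1) D e(1,2,3)]) (use e in \<open>simp_all add: P_def Q_def\<close>)
    then show ?thesis
      using linear_scale[OF strict_normed.supp_linear[OF normed[OF v(3)] v(2)]] e by (simp add:
          q_def)
  qed
  show False
  proof (rule crossing_sequences_contradiction[of q len r g \<kappa> k])
    fix n
    interpret F: strict_normed "fnorm M (T n)" by (rule normed[OF v(3)])
    obtain e f s t where ef: "e \<in> Ed (T n)" "f \<in> Ed (T n)" "e \<noteq> f" "0 < s" "0 < t" "P n = s *\<^sub>R u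
        (T n) e" "Q n = t *\<^sub>R u (T n) f"
      using edges by metis
    have lin: "linear (F.supp (v n))" by (rule F.supp_linear[OF v(2)])
    have "q (Suc n) = F.supp (v n) (P n + (z (Suc n) - z n) *\<^sub>R v n)" using qQ[of n] PQ[of n] by
        simp
    also have "\<dots> = q n + len n"
      using lin v by (simp add: linear_add linear_scale F.supp_self len_def q_def)
    finally show "q (Suc n) = q n + len n" .
    show "q n \<le> r n" unfolding q_def r_def by (rule F.supp_le[OF v(2)])
    show "- g n \<le> q n" unfolding q_def g_def by (rule F.supp_ge[OF v(2)])
    show "r (Suc n) \<le> r n + len n - \<kappa> * r n"
    proof -
      have "r n = fnorm M (T n) (s *\<^sub>R u (T n) e)" "r (Suc n) = fnorm M (T n) (t *\<^sub>R u (T n) f)"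
        using rQ(1)[of n] ef by (simp_all add: r_def)
      then show ?thesis using defect[OF v(3) ef(1-3), of s t] ef len[of n] by simp
    qed
    have "- P n = - Q n + (Q n - P n)" by simp
    then have le: "g n \<le> g (Suc n) + len n"
      using F.tri[of "- Q n" "Q n - P n"] rQ(2)[of n] len[of n] by (simp add: g_def[of n])
    \<comment> \<open>Equality in the triangle inequality would put \<open>P n\<close> and
      \<open>Q n\<close> on one ray from the apex, but they lie on different edges.\<close>
    have "g n \<noteq> g (Suc n) + len n"
    proof
      assume "g n = g (Suc n) + len n"
      then have "fnorm M (T n) (- Q n + (Q n - P n)) = fnorm M (T n) (- Q n) + fnorm M (T n) (Q n
          - P n)"
        using rQ(2)[of n] len[of n] by (simp add: g_def[of n])
      moreover have "Q n \<noteq> 0" unfolding Q_def by (rule nr)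
      then have "- Q n \<noteq> 0" by simp
      moreover have "Q n - P n \<noteq> 0" unfolding PQ' using z(1)[of n] v(2)[of n] by simp
      ultimately obtain m where m: "m > 0" "Q n - P n = m *\<^sub>R (- Q n)" using F.tri_eq by blast
      have "P n = Q n - (Q n - P n)" by simp
      also have "\<dots> = (1 + m) *\<^sub>R Q n" unfolding m(2) by (simp add: algebra_simps)
      finally have "P n = (1 + m) *\<^sub>R Q n" .
      then have "s *\<^sub>R u (T n) e = ((1 + m) * t) *\<^sub>R u (T n) f" using ef by simp
      from u_scale_edge[OF v(3) ef(1,2) this] show False using ef(3,4) by simp
    qed
    then show "g n < g (Suc n) + len n" using le by simp
    show "k * g n \<le> r n" unfolding g_def r_def by (rule k(2)[OF v(3)])
    show "0 \<le> g n" "0 \<le> r n" unfolding g_def r_def by (rule F.nonneg)+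
  qed (use \<kappa> k in auto)
qed

lemma lines_agree:
  assumes "line c {a..b} T \<alpha> v" "line c {a..b} T \<beta> w" "a < b"
  shows "\<beta> = \<alpha>" "w = v"
proof -
  have eq: "\<alpha> + t *\<^sub>R v = \<beta> + t *\<^sub>R w" if "t \<in> {a..b}" for t
    using coord_unique[OF lineD[OF assms(1) that] lineD[OF assms(2) that]] .
  have "\<alpha> + a *\<^sub>R v = \<beta> + a *\<^sub>R w" "\<alpha> + b *\<^sub>R v = \<beta> + b *\<^sub>R w" using eq assms(3) by auto
  moreover have "(b - a) *\<^sub>R v = (\<alpha> + b *\<^sub>R v) - (\<alpha> + a *\<^sub>R v)" "(b - a) *\<^sub>R w = (\<beta> + b *\<^sub>R w) -
      (\<beta> + a *\<^sub>R w)"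
    by (simp_all add: algebra_simps)
  ultimately have "(b - a) *\<^sub>R v = (b - a) *\<^sub>R w" by simp
  then show "w = v" using assms(3) by simp
  then show "\<beta> = \<alpha>" using \<open>\<alpha> + a *\<^sub>R v = \<beta> + a *\<^sub>R w\<close> by simp
qed

text \<open>\<open>J\<close> may be unbounded or not closed, so \<open>inner_straight\<close> is
  applied to compact parts of it that contain \<open>{p..q}\<close>. The midpoint of
  \<open>p\<close> and \<open>q\<close> is inner, so all these lines belong to one cone and
  agree.\<close>

lemma interval_line:
  assumes J: "is_interval J" "J \<subseteq> D" and pq: "p \<in> J" "q \<in> J" "p < q"
    and inn: "\<And>s t t'. s \<in> J \<Longrightarrow> t' \<in> J \<Longrightarrow> s < t \<Longrightarrow> t < t' \<Longrightarrow> inner (c t)"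
  shows "\<exists>T \<alpha> v. line c J T \<alpha> v"
proof -
  have line: "\<exists>T \<alpha> v. line c {p'..q'} T \<alpha> v" if "p' \<in> J" "q' \<in> J" "p' < q'" for p' q'
  proof (rule inner_straight[OF that(3)])
    show "{p'..q'} \<subseteq> D" using is_interval_subset[OF J(1) that(1,2)] J(2) by blast
    show "inner (c s)" if "s \<in> {p'<..<q'}" for s
      using inn[OF \<open>p' \<in> J\<close> \<open>q' \<in> J\<close>] that by simp
  qed
  obtain T \<alpha> v where l: "line c {p..q} T \<alpha> v" using line[OF pq] by blast
  have "coord (c t) T (\<alpha> + t *\<^sub>R v)" if t: "t \<in> J" for t
  proof -
    define p' where "p' = min p t"
    define q' where "q' = max q t"
    have pq': "p' \<in> J" "q' \<in> J" "p' \<le> p" "q \<le> q'" "p' \<le> t" "t \<le> q'" using pq t by (auto simp: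
        p'_def q'_def min_def max_def)
    then have "p' < q'" using pq(3) by simp
    then obtain T' \<alpha>' v' where l': "line c {p'..q'} T' \<alpha>' v'" using line[OF pq'(1,2)] by blast
    have sub: "line c {p..q} T' \<alpha>' v'" by (rule line_subset[OF l']) (use pq' in auto)
    define m where "m = (p + q) / 2"
    have m: "p < m" "m < q" using pq by (auto simp: m_def)
    have i: "inner (c m)" by (rule inn[OF pq(1,2) m])
    have cm: "coord (c m) T (\<alpha> + m *\<^sub>R v)" using lineD[OF l, of m] m by simp
    have cm': "coord (c m) T' (\<alpha>' + m *\<^sub>R v')" using lineD[OF sub, of m] m by simp
    have T: "T' = T" by (rule inner_unique(1)[OF cm _ cm']) (use inner_pos[OF i cm] in blast)
    have "\<alpha>' = \<alpha>" "v' = v" using lines_agree[OF l _ pq(3), of \<alpha>' v'] sub T by auto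
    then show ?thesis using lineD[OF l', of t] T pq' by simp
  qed
  then show ?thesis unfolding line_def by blast
qed

text \<open>A compact part of \<open>D\<close> contains finitely many crossings by
  \<open>finite_not_inner\<close>. If there were infinitely many in all, each would have a next one,
  and dependent choice would produce the sequence refuted by
  \<open>no_infinite_crossings\<close>.\<close>

lemma finite_forward_crossings:
  assumes nr: "\<And>a b T \<alpha> v s. a < b \<Longrightarrow> {a..b} \<subseteq> D \<Longrightarrow> line c {a..b} T \<alpha> v \<Longrightarrow> \<alpha> + s *\<^sub>R v \<noteq> 0"
    and na: "\<And>t. t \<in> D \<Longrightarrow> c t \<noteq> apex M x" and t1: "t1 \<in> D"
  shows "finite {t \<in> D. t1 \<le> t \<and> \<not> inner (c t)}"
proof (rule ccontr)
  define Z where "Z = {t \<in> D. t1 \<le> t \<and> \<not> inner (c t)}"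
  assume "infinite {t \<in> D. t1 \<le> t \<and> \<not> inner (c t)}"
  then have inf: "infinite Z" by (simp add: Z_def)
  have fin: "finite (Z \<inter> {..d})" if d: "d \<in> D" for d
  proof (cases "t1 < d")
    case True
    have "finite {t \<in> {t1..d}. \<not> inner (c t)}"
      by (rule finite_not_inner[OF True is_interval_subset[OF interval t1 d] nr])
    then show ?thesis by (rule finite_subset[rotated]) (auto simp: Z_def)
  next
    case False
    then have "Z \<inter> {..d} \<subseteq> {d}" by (auto simp: Z_def)
    then show ?thesis using finite_subset by blast
  qed
  have nxt: "\<exists>w. w \<in> Z \<and> y < w \<and> (\<forall>t\<in>{y<..<w}. inner (c t))" if y: "y \<in> Z" for y
  proof -
    have "\<not> Z \<subseteq> Z \<inter> {..y}" using inf fin[of y] y finite_subset unfolding Z_def by blast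
    then obtain w0 where w0: "w0 \<in> Z" "y < w0" by fastforce
    define W where "W = {w \<in> Z \<inter> {..w0}. y < w}"
    have W: "finite W" "W \<noteq> {}"
    proof -
      show "finite W" by (rule finite_subset[OF _ fin[of w0]]) (use w0 in \<open>auto simp: W_def Z_def\<close>)
      show "W \<noteq> {}" using w0 unfolding W_def by blast
    qed
    have m: "Min W \<in> W" by (rule Min_in[OF W])
    have "inner (c t)" if t: "t \<in> {y<..<Min W}" for t
    proof (rule ccontr)
      assume "\<not> inner (c t)"
      moreover have "t \<in> D" using is_interval_subset[OF interval, of y w0] y w0 t m unfolding
          W_def Z_def by auto
      ultimately have "t \<in> W" using t y m unfolding W_def Z_def by auto
      then show False using Min_le[OF W(1)] t by fastforce
    qed
    then show ?thesis using m unfolding W_def by blast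
  qed
  obtain z0 where "z0 \<in> Z" using inf by (metis ex_in_conv finite.emptyI)
  then have "\<exists>z. \<forall>n. z n \<in> Z \<and> (z n < z (Suc n) \<and> (\<forall>t\<in>{z n<..<z (Suc n)}. inner (c t)))"
    by (intro dependent_nat_choice) (use nxt in blast)+
  then obtain z where z: "\<And>n. z n \<in> Z" "\<And>n::nat. z n < z (Suc n)" "\<And>n t. t \<in> {z n<..<z (Suc n)} \<Longrightarrow>
      inner (c t)"
    by metis
  have zD: "z n \<in> D" "\<not> inner (c (z n))" for n using z(1)[of n] by (auto simp: Z_def)
  have sub: "{z n..z (Suc n)} \<subseteq> D" for n by (rule is_interval_subset[OF interval zD(1) zD(1)])
  have "\<forall>n. \<exists>T \<alpha> v. line c {z n..z (Suc n)} T \<alpha> v"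
    using inner_straight[OF z(2) sub z(3)] by simp
  then obtain T \<alpha> v where l: "\<And>n. line c {z n..z (Suc n)} (T n) (\<alpha> n) (v n)" by metis
  show False
    by (rule no_infinite_crossings[where z = z and T = T and \<alpha> = \<alpha> and v = v])
       (fact z(2) sub l zD(2) na[OF zD(1)] nr[OF z(2) sub l])+
qed

end

subsection \<open>Extending geodesics\<close>

context cone_geodesic
begin

text \<open>\<open>b\<close> is the supremum of \<open>D\<close> and may or may not belong to it.
  The new curve is straight up to and including \<open>b\<close> and straight on \<open>E\<close>,
  so that of all the clauses of a geodesic only minimality on \<open>E\<close> is left to the
  caller.\<close>

lemma extend:
  assumes t1: "t1 \<in> D" "t1 < b" "D \<subseteq> {..b}" "{t1..<b} \<subseteq> D"
    and agree: "\<And>t. t \<in> D \<Longrightarrow> c' t = c t"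
    and l: "line c' {t1..b} T \<alpha> v" and l': "line c' E T' \<alpha>' v'"
    and E: "is_interval E" "b \<in> E" "E \<subseteq> {b..}"
    and F: "fnorm M T' v' = \<sigma>"
    and min: "\<And>t0. t0 \<in> E \<Longrightarrow> minimizing_at M x (D \<union> E) c' t0"
  shows "geodesic M x (D \<union> E) c'"
proof -
  have lt: "t \<in> D" if "t \<in> D \<union> E" "t < b" for t using that E(3) by force
  have ge: "t \<in> E" if "t \<in> D \<union> E" "b \<le> t" for t
  proof (cases "t \<in> D")
    case True
    then have "t = b" using that(2) t1(3) by force
    then show ?thesis using E(2) by simp
  qed (use that in blast)
  have subE: "{p..q} \<subseteq> E" if "p \<in> E" "q \<in> E" for p q using is_interval_subset[OF E(1) that] .
  have F0: "fnorm M T v = \<sigma>"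
  proof (rule const_speed_line[OF speed])
    have sub: "{t1..(t1 + b) / 2} \<subseteq> {t1..<b}" using t1(2) by auto
    show "{t1..(t1 + b) / 2} \<subseteq> D" using sub t1(4) by blast
    then show "line c {t1..(t1 + b) / 2} T \<alpha> v"
      using l agree sub unfolding line_def by (metis atLeastAtMost_iff atLeastLessThan_iff
          less_imp_le subset_iff)
    show "t1 < (t1 + b) / 2" using t1(2) by simp
  qed
  have S: "T \<in> star M x" "T' \<in> star M x"
    using coordD(1)[OF lineD[OF l, of b]] coordD(1)[OF lineD[OF l' E(2)]] t1 by auto
  have v0: "v \<noteq> 0" "v' \<noteq> 0"
    using F F0 sigma_pos strict_normed.zero[OF normed] S by auto
  have int: "is_interval (D \<union> E)" unfolding is_interval_1
  proof (intro ballI allI impI)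
    fix p q r assume p: "p \<in> D \<union> E" and q: "q \<in> D \<union> E" and r: "p \<le> r \<and> r \<le> q"
    show "r \<in> D \<union> E"
    proof (cases "r < b")
      case True
      have "p \<in> D" using lt[OF p] True r by simp
      moreover have "max r t1 \<in> {t1..<b}" using True t1(2) by auto
      then have "max r t1 \<in> D" using t1(4) by blast
      ultimately have "{p..max r t1} \<subseteq> D" by (rule is_interval_subset[OF interval])
      then show ?thesis using r by auto
    next
      case False
      then have "q \<in> E" using ge[OF q] r by simp
      moreover have "r \<in> {b..q}" using False r by auto
      ultimately show ?thesis using subE[OF E(2)] by blast
    qed
  qed
  have cD: "has_length M x c' p q L" if "has_length M x c p q L" "p \<in> D" "q \<in> D" for p q L
    by (rule has_length_cong[OF that(1)]) (use agree is_interval_subset[OF interval that(2,3)] in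
        \<open>metis subsetD\<close>)
  have pD: "\<exists>L. has_length M x c' p q L" if "p \<in> D" "q \<in> D" "p < q" for p q
    using pws that cD unfolding piecewise_smooth_def by meson
  have pb: "\<exists>L. has_length M x c' p b L" if p: "p \<in> D" "p < b" for p
  proof (cases "t1 \<le> p")
    case True
    have "line c' {p..b} T \<alpha> v" by (rule line_subset[OF l]) (use True in auto)
    then show ?thesis using line_has_length p(2) by blast
  next
    case False
    then obtain L where "has_length M x c' p t1 L" using pD[OF p(1) t1(1)] by auto
    then show ?thesis using has_length.join[OF _ line_has_length[OF l t1(2)]] by blast
  qed
  have bE: "\<exists>L. has_length M x c' p q L" if "p \<in> E" "q \<in> E" "p < q" for p q
  proof -
    have "line c' {p..q} T' \<alpha>' v'" by (rule line_subset[OF l' subE[OF that(1,2)]])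
    then show ?thesis using line_has_length that(3) by blast
  qed
  have ps: "piecewise_smooth M x (D \<union> E) c'" unfolding piecewise_smooth_def
  proof (intro ballI impI)
    fix p q assume pq: "p \<in> D \<union> E" "q \<in> D \<union> E" "p < q"
    consider "q < b" | "b \<le> p" | "p < b" "q = b" | "p < b" "b < q" using pq(3) by linarith
    then show "\<exists>L. has_length M x c' p q L"
    proof cases
      case 1
      then have "p \<in> D" "q \<in> D" using lt[OF pq(1)] lt[OF pq(2)] pq(3) by linarith+
      then show ?thesis using pD pq(3) by blast
    next
      case 2
      then have "p \<in> E" "q \<in> E" using ge[OF pq(1)] ge[OF pq(2)] pq(3) by linarith+
      then show ?thesis using bE pq(3) by blast
    next
      case 3
      then have "p \<in> D" using lt[OF pq(1)] by blast
      then show ?thesis using pb 3 by blast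
    next
      case 4
      have "p \<in> D" "q \<in> E" using lt[OF pq(1)] ge[OF pq(2)] 4 by auto
      then obtain L L' where L: "has_length M x c' p b L" and "has_length M x c' b q L'"
        using pb bE[OF E(2)] 4 by blast
      from has_length.join[OF this] show ?thesis by blast
    qed
  qed
  have sp: "const_speed M x (D \<union> E) c' \<sigma>" unfolding const_speed_def
  proof (intro allI impI ballI)
    fix T0 p q g t assume pq: "{p..q} \<subseteq> D \<union> E" and piece: "smooth_piece M x c' T0 p q g" and t: "t
        \<in> {p..q}"
    have pltq: "p < q" by (rule smooth_piece_less[OF piece])
    \<comment> \<open>A smooth piece may straddle the seam; its speed at \<open>t\<close> is read
      off on a side of \<open>t\<close> where the curve is straight or is the old geodesic.\<close>
    consider "t < b" | "b \<le> t" "t < q" | "b < t" "t = q" | "t = b" "t = q" using t by force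
    then show "piece_speed M T0 p q g t = \<sigma>"
    proof cases
      case 1
      define m where "m = min q ((t + b) / 2)"
      have m: "p < m" "m \<le> q" "t \<le> m" "m < b" using 1 t pltq by (auto simp: m_def min_def)
      have sub: "{p..m} \<subseteq> D"
      proof
        fix r assume r: "r \<in> {p..m}"
        then have "r \<in> {p..q}" "r < b" using m by auto
        then show "r \<in> D" using lt pq by blast
      qed
      have "smooth_piece M x c' T0 p m g" by (rule smooth_piece_subset[OF piece order_refl m(1,2)])
      then have "smooth_piece M x c T0 p m g"
        using smooth_piece_cong[of p m c' c] agree sub by blast
      then have "piece_speed M T0 p m g t = \<sigma>" by (rule const_speedD[OF speed sub]) (use m t in
          auto)
      then show ?thesis using piece_speed_subset[OF piece order_refl m(1,2), of t] m t by simp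
    next
      case 2
      have "{t..q} \<subseteq> E" using subE ge pq t by (metis 2(1) atLeastAtMost_iff order_refl order_trans
          subset_iff)
      then have "line c' {t..q} T' \<alpha>' v'" by (rule line_subset[OF l'])
      from line_piece_speed[OF this 2(2) _ _ v0(2) piece, of t] show ?thesis using t F by simp
    next
      case 3
      define r where "r = max p b"
      have r: "r < t" "b \<le> r" "r \<in> {p..q}" using 3 pltq by (auto simp: r_def)
      have "r \<in> D \<union> E" "t \<in> D \<union> E" using pq r t by blast+
      then have "r \<in> E" "t \<in> E" using ge[of r] ge[of t] r 3 by linarith+
      then have "{r..t} \<subseteq> E" by (rule subE)
      then have "line c' {r..t} T' \<alpha>' v'" by (rule line_subset[OF l'])
      from line_piece_speed[OF this r(1) _ _ v0(2) piece, of t] show ?thesis using t F r by simp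
    next
      case 4
      define r where "r = max p t1"
      have r: "r < b" "t1 \<le> r" "r \<in> {p..q}" using 4 pltq t1 by (auto simp: r_def)
      have "line c' {r..b} T \<alpha> v" by (rule line_subset[OF l]) (use r in auto)
      from line_piece_speed[OF this r(1) _ _ v0(1) piece, of t] show ?thesis using t F0 r 4 by simp
    qed
  qed
  have mn: "minimizing_at M x (D \<union> E) c' t0" if t0: "t0 \<in> D \<union> E" for t0
  proof (cases "t0 < b")
    case False then show ?thesis using min ge[OF t0] by simp
  next
    case True
    obtain \<epsilon> where e: "\<epsilon> > 0" "\<And>t1 t2. t1 \<in> D \<Longrightarrow> t2 \<in> D \<Longrightarrow> \<bar>t1 - t0\<bar> < \<epsilon> \<Longrightarrow> \<bar>t2 - t0\<bar> < \<epsilon> \<Longrightarrow> t1 < t2 \<Longrightarrow>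
        has_length M x c t1 t2 (tdist M x (c t1) (c t2))"
      using minimizing[OF lt[OF t0 True]] unfolding minimizing_at_def by blast
    define d where "d = min \<epsilon> (b - t0)"
    have d: "d > 0" "d \<le> \<epsilon>" "d \<le> b - t0" using e(1) True by (auto simp: d_def)
    show ?thesis unfolding minimizing_at_def
    proof (intro exI[of _ d] conjI ballI impI d(1))
      fix p q assume pq: "p \<in> D \<union> E" "q \<in> D \<union> E" "\<bar>p - t0\<bar> < d" "\<bar>q - t0\<bar> < d" "p < q"
      have "p < b" "q < b" using pq(3,4) d by linarith+
      then have D: "p \<in> D" "q \<in> D" using lt pq(1,2) by blast+
      have "has_length M x c p q (tdist M x (c p) (c q))" by (rule e(2)[OF D]) (use pq d in auto)
      from cD[OF this D] show "has_length M x c' p q (tdist M x (c' p) (c' q))" using agree D by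
          simp
    qed
  qed
  have "b > t1" "t1 \<in> D \<union> E" "b \<in> D \<union> E" using t1 E by auto
  then show ?thesis unfolding geodesic_iff using int ps sp mn sigma_pos by blast
qed

text \<open>Radial lines minimize globally on each side of the apex, so \<open>E\<close> may be a
  whole half line or may end at the apex, at time \<open>s0\<close>.\<close>

lemma extend_radial:
  assumes t1: "t1 \<in> D" "t1 < b" "D \<subseteq> {..b}" "{t1..<b} \<subseteq> D"
    and l: "line c (D \<inter> {t1..}) T (- s0 *\<^sub>R v) v"
    and E: "is_interval E" "b \<in> E" "E \<subseteq> {b..}" and s0: "s0 \<le> t1 \<or> E \<subseteq> {..s0}"
    and sec: "\<And>t. t \<in> E \<Longrightarrow> (t - s0) *\<^sub>R v \<in> sector M x T"
  shows "\<exists>c'. geodesic M x (D \<union> E) c' \<and> (\<forall>t\<in>D. c' t = c t)"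
proof (intro exI conjI ballI)
  define c' where "c' t = (if t < b then c t else pt T ((t - s0) *\<^sub>R v))" for t
  have eq: "- s0 *\<^sub>R v + t *\<^sub>R v = (t - s0) *\<^sub>R v" for t by (simp add: algebra_simps)
  have S: "T \<in> star M x" using coordD(1)[OF lineD[OF l, of t1]] t1 by auto
  show agree: "c' t = c t" if t: "t \<in> D" for t
  proof (cases "t < b")
    case False
    then have "coord (c t) T ((t - s0) *\<^sub>R v)" using lineD[OF l, of t] t1 t eq by auto
    then show ?thesis using False pt_eq by (simp add: c'_def)
  qed (simp add: c'_def)
  have lE: "line c' E T (- s0 *\<^sub>R v) v" unfolding line_def
  proof
    fix t assume t: "t \<in> E"
    then have "\<not> t < b" using E(3) by auto
    then show "coord (c' t) T (- s0 *\<^sub>R v + t *\<^sub>R v)" unfolding eq using coord_pt[OF S sec[OF t]]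
        by (simp add: c'_def)
  qed
  have lD: "line c' {t1..<b} T (- s0 *\<^sub>R v) v" unfolding line_def
  proof
    fix t assume t: "t \<in> {t1..<b}"
    then have "t \<in> D \<inter> {t1..}" using t1(4) by auto
    then show "coord (c' t) T (- s0 *\<^sub>R v + t *\<^sub>R v)" using lineD[OF l] agree by auto
  qed
  have l1: "line c' ({t1..<b} \<union> E) T (- s0 *\<^sub>R v) v" using lD lE unfolding line_def by blast
  have mid: "(t1 + b) / 2 \<in> {t1..<b}" "t1 < (t1 + b) / 2" using t1(2) by auto
  have "line c {t1..(t1 + b) / 2} T (- s0 *\<^sub>R v) v"
    by (rule line_subset[OF l]) (use t1 mid in \<open>auto intro!: subsetD[OF t1(4)]\<close>)
  moreover have "{t1..(t1 + b) / 2} \<subseteq> D" using t1(4) mid by (auto intro!: subsetD[OF t1(4)])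
  ultimately have F: "fnorm M T v = \<sigma>" using line_norm(1)[OF _ mid(2)] by blast
  have iv: "{p..q} \<subseteq> {t1..<b} \<union> E" if "p \<in> {t1..<b} \<union> E" "q \<in> {t1..<b} \<union> E" for p q
  proof
    fix r assume r: "r \<in> {p..q}"
    have "t1 \<le> p" using that(1) E(3) t1(2) by auto
    show "r \<in> {t1..<b} \<union> E"
    proof (cases "r < b")
      case False
      then have "q \<in> E" using that(2) r by auto
      then show ?thesis using is_interval_subset[OF E(1,2), of q] False r by auto
    qed (use r \<open>t1 \<le> p\<close> in auto)
  qed
  show "geodesic M x (D \<union> E) c'"
  proof (rule extend[OF t1 agree _ lE E F])
    show "line c' {t1..b} T (- s0 *\<^sub>R v) v"
    proof (rule line_subset[OF l1], rule subsetI)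
      fix t assume "t \<in> {t1..b}"
      then show "t \<in> {t1..<b} \<union> E" using E(2) by (cases "t = b") auto
    qed
    fix t0 assume t0: "t0 \<in> E"
    then have "b \<le> t0" using E(3) by auto
    show "minimizing_at M x (D \<union> E) c' t0" unfolding minimizing_at_def
    \<comment> \<open>This radius keeps all times after \<open>t1\<close>, where \<open>c'\<close>
      is a single radial line.\<close>
    proof (intro exI[of _ "t0 - t1"] conjI ballI impI)
      show "0 < t0 - t1" using \<open>b \<le> t0\<close> t1 by simp
      fix p q assume pq: "p \<in> D \<union> E" "q \<in> D \<union> E" "\<bar>p - t0\<bar> < t0 - t1" "\<bar>q - t0\<bar> < t0 - t1" "p < q"
      have in': "r \<in> {t1..<b} \<union> E" if "r \<in> D \<union> E" "t1 < r" for r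
        using that t1(3) E(2) by (cases "r = b") force+
      have t1pq: "t1 < p" "t1 < q" using pq(3,4) by linarith+
      have P: "p \<in> {t1..<b} \<union> E" "q \<in> {t1..<b} \<union> E" using in' pq(1,2) t1pq by blast+
      have "line c' {p..q} T (- s0 *\<^sub>R v) v" by (rule line_subset[OF l1 iv[OF P]])
      then show "has_length M x c' p q (tdist M x (c' p) (c' q))"
      proof (rule radial_tdist[OF _ pq(5)])
        have "q \<le> s0" if "E \<subseteq> {..s0}" using P(2) that E(2) by auto
        then show "s0 \<le> p \<or> q \<le> s0" using s0 t1pq by auto
      qed
    qed
  qed
qed

text \<open>The end point \<open>P\<close> lies in the closed sector and is nonzero, as the line is
  not radial. If it is inner, the line goes on straight; on an edge it is refracted into another
  cone at this edge.\<close>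

lemma extend_nonradial:
  assumes t1: "t1 \<in> D" "t1 < b" "D \<subseteq> {..b}" "{t1..<b} \<subseteq> D"
    and l: "line c (D \<inter> {t1..}) T \<alpha> v" and nr: "\<And>s. \<alpha> + s *\<^sub>R v \<noteq> 0"
  shows "\<exists>D' c'. D \<subset> D' \<and> geodesic M x D' c' \<and> (\<forall>t\<in>D. c' t = c t)"
proof -
  have l0: "line c {t1..<b} T \<alpha> v" by (rule line_subset[OF l]) (use t1 in auto)
  have S: "T \<in> star M x" using coordD(1)[OF lineD[OF l0, of t1]] t1 by simp
  interpret F: strict_normed "fnorm M T" by (rule normed[OF S])
  define P where "P = \<alpha> + b *\<^sub>R v"
  have P: "P \<in> sector M x T" unfolding P_def by (rule line_end_in_sector[OF l0 t1(2)])
  have cP: "coord (pt T P) T P" by (rule coord_pt[OF S P])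
  have cb: "c b = pt T P" if "b \<in> D" using lineD[OF l, of b] pt_eq that t1 by (auto simp: P_def)
  have mid: "(t1 + b) / 2 \<in> {t1..<b}" "t1 < (t1 + b) / 2" using t1(2) by auto
  have "{t1..(t1 + b) / 2} \<subseteq> {t1..<b}" using mid by auto
  then have sub: "line c {t1..(t1 + b) / 2} T \<alpha> v" "{t1..(t1 + b) / 2} \<subseteq> D"
    using line_subset[OF l0] t1(4) by blast+
  note v = line_norm[OF sub(1) mid(2) sub(2)]
  \<comment> \<open>In both cases the new line is in the interior of a cone after time
    \<open>b\<close>, so that only minimality at \<open>b\<close> itself needs separate
    arguments.\<close>
  have *: ?thesis
    if T': "T' \<in> star M x" "fnorm M T' v' = \<sigma>" "v' \<noteq> 0" and \<delta>: "\<delta> > 0"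
      and pos: "\<And>t e. b < t \<Longrightarrow> t < b + \<delta> \<Longrightarrow> e \<in> Ed T' \<Longrightarrow> 0 < co T' e (\<alpha>' + t *\<^sub>R v')"
      and P': "coord (pt T P) T' (\<alpha>' + b *\<^sub>R v')"
      and min: "\<And>c' D'. line c' {t1..b} T \<alpha> v \<Longrightarrow> line c' {b..<b + \<delta>} T' \<alpha>' v' \<Longrightarrow> minimizing_at M x
          D' c' b"
    for T' \<alpha>' v' \<delta>
  proof -
    define c' where "c' t = (if t < b then c t else pt T' (\<alpha>' + t *\<^sub>R v'))" for t
    have agree: "c' t = c t" if "t \<in> D" for t
    proof (cases "t < b")
      case False
      then have "t = b" using that t1 by force
      then show ?thesis using cb that pt_eq[OF P'] by (simp add: c'_def)
    qed (simp add: c'_def)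
    define E where "E = {b..<b + \<delta>}"
    have E: "is_interval E" "b \<in> E" "E \<subseteq> {b..}" using \<delta> by (auto simp: E_def is_interval_1)
    have lE: "line c' E T' \<alpha>' v'" unfolding line_def
    proof
      fix t assume t: "t \<in> E"
      have "\<alpha>' + t *\<^sub>R v' \<in> sector M x T'"
      proof (cases "t = b")
        case True then show ?thesis using coordD(2)[OF P'] by simp
      next
        case False
        then show ?thesis using pos[of t] t in_sector[OF T'(1)] unfolding E_def by (force intro:
            less_imp_le)
      qed
      then show "coord (c' t) T' (\<alpha>' + t *\<^sub>R v')" using coord_pt[OF T'(1)] t by (auto simp: c'_def
          E_def)
    qed
    have lT: "line c' {t1..b} T \<alpha> v" unfolding line_def
    proof
      fix t assume t: "t \<in> {t1..b}"
      show "coord (c' t) T (\<alpha> + t *\<^sub>R v)"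
      proof (cases "t = b")
        case True
        then show ?thesis using cP pt_eq[OF P'] by (simp add: c'_def P_def)
      next
        case False
        then show ?thesis using lineD[OF l0, of t] t by (simp add: c'_def)
      qed
    qed
    have "geodesic M x (D \<union> E) c'"
    proof (rule extend[OF t1 agree lT lE E T'(2)])
      fix t0 assume t0: "t0 \<in> E"
      show "minimizing_at M x (D \<union> E) c' t0"
      proof (cases "t0 = b")
        case True then show ?thesis using min lT lE unfolding E_def by blast
      next
        case False
        then have t0b: "b < t0" "t0 < b + \<delta>" using t0 by (auto simp: E_def)
        have "line c' {b..(t0 + (b + \<delta>)) / 2} T' \<alpha>' v'" by (rule line_subset[OF lE]) (use t0b in
            \<open>auto simp: E_def\<close>)
        then show ?thesis
          by (rule inner_line_minimizing[OF _ t0b(1) _ T'(3)]) (use t0b pos in auto)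
      qed
    qed
    moreover have "b + \<delta>/2 \<in> E" "b + \<delta>/2 \<notin> D" using \<delta> t1 by (auto simp: E_def)
    ultimately show ?thesis using agree by (intro exI[of _ "D \<union> E"] exI[of _ c']) blast
  qed
  show ?thesis
  proof (cases "\<forall>e\<in>Ed T. 0 < co T e P")
    case True
    obtain e f where ef: "e \<in> Ed T" "f \<in> Ed T" "f \<noteq> e" "Ed T = {e, f}" using two_edges[OF S] by
        blast
    obtain d1 where d1: "d1 > 0" "\<And>t. \<bar>t - b\<bar> \<le> d1 \<Longrightarrow> \<bar>(t - b) * 1\<bar> \<le> 1 * co T e (\<alpha> + t *\<^sub>R v)"
      using affine_small[OF co_linear[OF S ef(1)], of \<alpha> b v 1 1] True ef unfolding P_def by (metis
          zero_less_one)
    obtain d2 where d2: "d2 > 0" "\<And>t. \<bar>t - b\<bar> \<le> d2 \<Longrightarrow> \<bar>(t - b) * 1\<bar> \<le> 1 * co T f (\<alpha> + t *\<^sub>R v)"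
      using affine_small[OF co_linear[OF S ef(2)], of \<alpha> b v 1 1] True ef unfolding P_def by (metis
          zero_less_one)
    define \<delta> where "\<delta> = min d1 d2"
    have \<delta>: "\<delta> > 0" using d1 d2 by (simp add: \<delta>_def)
    show ?thesis
    proof (rule *[OF S v(1,2) \<delta>, of \<alpha>])
      show "0 < co T e' (\<alpha> + t *\<^sub>R v)" if "b < t" "t < b + \<delta>" "e' \<in> Ed T" for t e'
      proof -
        have "t - b \<le> d1" "t - b \<le> d2" using that by (simp_all add: \<delta>_def)
        then show ?thesis using d1(2)[of t] d2(2)[of t] that ef by auto
      qed
      show "coord (pt T P) T (\<alpha> + b *\<^sub>R v)" using cP by (simp add: P_def)
      show "minimizing_at M x D' c' b" if "line c' {t1..b} T \<alpha> v" "line c' {b..<b + \<delta>} T \<alpha> v" for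
          c' D'
      proof (rule inner_line_minimizing[of c' t1 "b + \<delta>/2" T \<alpha> v])
        show "line c' {t1..b + \<delta>/2} T \<alpha> v"
          unfolding line_def using lineD[OF that(1)] lineD[OF that(2)] \<delta>
          by (metis atLeastAtMost_iff atLeastLessThan_iff field_sum_of_halves
              less_add_same_cancel1 half_gt_zero add_le_less_mono add_strict_left_mono
              linorder_not_le order.strict_trans1 order_less_imp_le add.assoc)
      qed (use True t1 \<delta> v in \<open>auto simp: P_def\<close>)
    qed
  next
    case False
    have "P \<noteq> 0" unfolding P_def by (rule nr)
    then have ni: "\<not> inner (pt T P)" "pt T P \<noteq> apex M x"
      using False inner_pos[OF _ cP] coord_0_iff[OF cP] by blast+
    obtain e r where e: "e \<in> Ed T" "0 < r" "P = r *\<^sub>R u T e" using not_inner_cases[OF cP ni] by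
        metis
    define \<beta> where "\<beta> = F.supp v (u T e)"
    \<comment> \<open>Transversality makes the bounds \<open>b1\<close> and \<open>b2\<close>
      strict, because the functional supporting at \<open>v\<close> attains the norm only on the ray
      of \<open>v\<close>.\<close>
    have npar: "v \<noteq> k *\<^sub>R u T e" for k
      using parallel_radial[OF v(2), of k "u T e" \<alpha> b r] nr e(3) by (auto simp: P_def)
    have u0: "u T e \<noteq> 0" by (rule u_nonzero[OF S e(1)])
    have b1: "\<beta> < fnorm M T (u T e)"
    proof -
      have "\<beta> \<noteq> fnorm M T (u T e)"
      proof
        assume "\<beta> = fnorm M T (u T e)"
        then obtain k where "k > 0" "u T e = k *\<^sub>R v" using F.supp_eq[OF v(2) u0] by (auto simp:
            \<beta>_def)
        then have "v = (1 / k) *\<^sub>R u T e" by simp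
        then show False using npar by blast
      qed
      then show ?thesis using F.supp_le[OF v(2), of "u T e"] by (simp add: \<beta>_def)
    qed
    have b2: "- fnorm M T (- u T e) < \<beta>"
    proof -
      have "\<beta> \<noteq> - fnorm M T (- u T e)"
      proof
        assume "\<beta> = - fnorm M T (- u T e)"
        then have "F.supp v (- u T e) = fnorm M T (- u T e)"
          using linear_neg[OF F.supp_linear[OF v(2)], of "u T e"] by (simp add: \<beta>_def)
        then obtain k where k: "k > 0" "- u T e = k *\<^sub>R v" using F.supp_eq[OF v(2), of "- u T e"]
            u0 by auto
        have "v = (1 / k) *\<^sub>R (k *\<^sub>R v)" using k(1) by simp
        also have "\<dots> = (- 1 / k) *\<^sub>R u T e" unfolding k(2)[symmetric] by simp
        finally show False using npar by blast
      qed
      then show ?thesis using F.supp_ge[OF v(2), of "u T e"] by (simp add: \<beta>_def)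
    qed
    obtain T' where T': "T' \<in> star M x" "T' \<noteq> T" "e \<in> Ed T'" using edge_shared[OF S e(1)] by blast
    \<comment> \<open>The calibration needs a functional with value \<open>\<beta>\<close> on the
      edge in every cone at \<open>e\<close>, not just in \<open>T\<close> and
      \<open>T'\<close>.\<close>
    have "\<exists>y. y \<noteq> 0 \<and> supp T0 y (u T0 e) = \<beta> \<and> (\<forall>f\<in>Ed T0. f \<noteq> e \<longrightarrow> 0 < co T0 f y)"
      if T0: "T0 \<in> star M x" "e \<in> Ed T0" for T0
      using refracted_direction[OF T0, of \<beta>] edge_norm[OF S T0(1) e(1) T0(2), of 1]
        edge_norm[OF S T0(1) e(1) T0(2), of "-1"] b1 b2 by simp
    then obtain Y where Y: "\<And>T0. T0 \<in> star M x \<Longrightarrow> e \<in> Ed T0 \<Longrightarrow> Y T0 \<noteq> 0 \<and> supp T0 (Y T0) (u T0 e) =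
        \<beta> \<and>
      (\<forall>f\<in>Ed T0. f \<noteq> e \<longrightarrow> 0 < co T0 f (Y T0))" by metis
    define \<xi> where "\<xi> T0 = (if T0 = T then F.supp v else if e \<in> Ed T0 then supp T0 (Y T0) else
        (\<lambda>_. 0))" for T0
    interpret F': strict_normed "fnorm M T'" by (rule normed[OF T'(1)])
    define y where "y = Y T'"
    have y: "y \<noteq> 0" "F'.supp y (u T' e) = \<beta>" "\<And>f. f \<in> Ed T' \<Longrightarrow> f \<noteq> e \<Longrightarrow> 0 < co T' f y"
      using Y[OF T'(1,3)] by (auto simp: y_def)
    \<comment> \<open>Scales the refracted direction to the speed of the geodesic.\<close>
    define k where "k = \<sigma> / fnorm M T' y"
    have k: "k > 0" using sigma_pos F'.pos[OF y(1)] by (simp add: k_def)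
    define v' where "v' = k *\<^sub>R y"
    have v': "v' \<noteq> 0" "fnorm M T' v' = \<sigma>" using k y(1) F'.pos[OF y(1)] by (auto simp: v'_def
        F'.hom) (simp add: k_def)
    define \<alpha>' where "\<alpha>' = r *\<^sub>R u T' e - b *\<^sub>R v'"
    have at: "\<alpha>' + t *\<^sub>R v' = r *\<^sub>R u T' e + (t - b) *\<^sub>R v'" for t by (simp add: \<alpha>'_def
        algebra_simps)
    have coe: "co T' e (\<alpha>' + b *\<^sub>R v') > 0" unfolding at using e(2) T' by (simp add: co_simps co_u)
    \<comment> \<open>With both constants 1 this says that the coordinate along \<open>e\<close> is
      at least the elapsed time, hence positive after \<open>b\<close>.\<close>
    obtain \<delta> where \<delta>: "\<delta> > 0" "\<And>t. \<bar>t - b\<bar> \<le> \<delta> \<Longrightarrow> \<bar>(t - b) * 1\<bar> \<le> 1 * co T' e (\<alpha>' + t *\<^sub>R v')"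
      using affine_small[OF co_linear[OF T'(1,3)] coe zero_less_one, of 1] by metis
    show ?thesis
    proof (rule *[OF T'(1) v'(2,1) \<delta>(1), of \<alpha>'])
      show "0 < co T' f (\<alpha>' + t *\<^sub>R v')" if t: "b < t" "t < b + \<delta>" "f \<in> Ed T'" for t f
      proof (cases "f = e")
        case True then show ?thesis using \<delta>(2)[of t] t by auto
      next
        case False
        have "co T' f (\<alpha>' + t *\<^sub>R v') = (t - b) * (k * co T' f y)"
          unfolding at using False T' t(3) by (simp add: co_simps co_u v'_def)
        then show ?thesis using y(3)[OF t(3) False] k t by simp
      qed
      show "coord (pt T P) T' (\<alpha>' + b *\<^sub>R v')"
        unfolding at using coord_edge[of "pt T P" T r e T'] cP e T' by simp
      show "minimizing_at M x D' c' b" if l1: "line c' {t1..b} T \<alpha> v" and l2: "line c' {b..<b + \<delta>}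
          T' \<alpha>' v'" for c' D'
      proof (rule edge_crossing_minimizing[OF l1 _ t1(2) _ v(1) v'(2) e(1) T'(3) e(2), of "b +
          \<delta>/2" \<alpha>' \<xi> \<beta>])
        show "line c' {b..b + \<delta>/2} T' \<alpha>' v'" by (rule line_subset[OF l2]) (use \<delta>(1) in auto)
        show "linear (\<xi> T0)" if "T0 \<in> star M x" for T0
          unfolding \<xi>_def using F.supp_linear[OF v(2)] strict_normed.supp_linear[OF normed[OF
              that]] Y[OF that]
          by (auto intro: linear_zero)
        show "\<xi> T0 a \<le> fnorm M T0 a" if "T0 \<in> star M x" for T0 a
          unfolding \<xi>_def using F.supp_le[OF v(2)] strict_normed.supp_le[OF normed[OF that]] Y[OF
              that]
            strict_normed.nonneg[OF normed[OF that]] by auto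
        show "\<xi> T0 (u T0 e) = \<beta>" if "T0 \<in> star M x" "e \<in> Ed T0" for T0
          unfolding \<xi>_def using Y[OF that] that by (auto simp: \<beta>_def)
        show "\<xi> T v = \<sigma>" using F.supp_self[OF v(2)] v(1) by (simp add: \<xi>_def)
        have "\<xi> T' v' = k * F'.supp y y"
          using T' linear_scale[OF F'.supp_linear[OF y(1)]] by (simp add: \<xi>_def v'_def y_def)
        also have "\<dots> = \<sigma>" using F'.supp_self[OF y(1)] F'.pos[OF y(1)] by (simp add: k_def)
        finally show "\<xi> T' v' = \<sigma>" .
      qed (use e at \<delta>(1) in \<open>auto simp: P_def\<close>)
    qed
  qed
qed

end

subsection \<open>Maximal geodesics\<close>

context cone_structure
begin

text \<open>Edges and gluing do not involve the norms, and \<open>edge_norm\<close> covers both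
  signs of \<open>s\<close>, so it survives the reflection.\<close>

lemma reverse_structure: "cone_structure (reverse M) x Ed u co"
proof (rule cone_structure.intro, goal_cases)
  case 1 show ?case using finite_star by simp
next
  case (2 T) then show ?case using strict_norm_reverse[OF norms] by simp
next
  case (3 T) then show ?case using card_Ed by simp
next
  case (4 T e) then show ?case using co_linear by simp
next
  case (5 T e f) then show ?case using co_u by simp
next
  case (6 T a) then show ?case using co_sum by simp
next
  case (7 T) then show ?case using sector by simp
next
  case (8 T a T' b) then show ?case by (simp add: glue)
next
  case (9 T T' e s)
  then show ?case using edge_norm[of T T' e "- s"] by simp
next
  case (10 T e) then show ?case using edge_shared by simp
next
  case (11 T T' e f) then show ?case using edge_unique by simp
qed

lemma reverse_line: "cone_structure.line (reverse M) x = line"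
  by (simp add: fun_eq_iff cone_structure.line_def[OF reverse_structure] line_def
      cone_structure.coord_def[OF reverse_structure] coord_def)

lemma reverse_inner: "cone_structure.inner (reverse M) x Ed co = inner"
  by (simp add: fun_eq_iff cone_structure.inner_def[OF reverse_structure] inner_def
      cone_structure.coord_def[OF reverse_structure] coord_def)

lemma line_reverse:
  assumes "line c J T \<alpha> v"
  shows "line (\<lambda>t. c (- t)) (uminus ` J) T \<alpha> (- v)"
  unfolding line_def
proof
  fix t assume "t \<in> uminus ` J"
  then have "- t \<in> J" by (simp add: mem_uminus_image)
  from lineD[OF assms this] show "coord (c (- t)) T (\<alpha> + t *\<^sub>R - v)" by simp
qed

lemma inner_not_in_edge:
  assumes "inner p" "p \<in> P"
  shows "\<not> in_edge M x P"
proof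
  assume "in_edge M x P"
  then obtain T T' where T: "T \<noteq> T'" "P \<subseteq> mcone M x T \<inter> mcone M x T'"
    unfolding in_edge_def cone_edges_def by blast
  then obtain a b where c: "coord p T a" "coord p T' b" using assms(2) unfolding mcone_def
      coord_def by blast
  then show False using inner_unique(1)[OF c(1) _ c(2)] inner_pos[OF assms(1) c(1)] T(1) by blast
qed

lemma mcone_iff: "p \<in> mcone M x T \<longleftrightarrow> (\<exists>a. coord p T a)"
  unfolding mcone_def coord_def by blast

end

context cone_geodesic
begin

lemma nondegenerate: obtains a d where "a \<in> D" "d \<in> D" "a < d"
  using geodesic unfolding geodesic_iff by blast

lemma sup_facts:
  assumes "t1 \<in> D" "d \<in> D" "t1 < d" "y \<notin> D" "t1 < y"
  obtains b where "t1 < b" "D \<subseteq> {..b}" "{t1..<b} \<subseteq> D" "b \<le> y"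
proof -
  have below: "t \<le> y" if "t \<in> D" for t
  proof (rule ccontr)
    assume "\<not> t \<le> y"
    then have "y \<in> {t1..t}" using assms(5) by simp
    then show False using is_interval_subset[OF interval assms(1) that] assms(4) by blast
  qed
  have bdd: "bdd_above D" using below by (intro bdd_aboveI)
  show ?thesis
  proof
    show "D \<subseteq> {..Sup D}" using cSup_upper[OF _ bdd] by auto
    show "t1 < Sup D" using cSup_upper[OF assms(2) bdd] assms(3) by simp
    show "{t1..<Sup D} \<subseteq> D"
    proof
      fix r assume r: "r \<in> {t1..<Sup D}"
      then obtain d' where "d' \<in> D" "r < d'" using less_cSup_iff[OF _ bdd, of r] assms(1) by auto
      then show "r \<in> D" using is_interval_subset[OF interval assms(1), of d'] r by auto
    qed
    show "Sup D \<le> y" using below assms(1) by (intro cSup_least) auto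
  qed
qed

text \<open>In a single cone the curve would be one line through a point of the edge
  \<open>e\<close>. Its coordinate along the other edge is a multiple of \<open>t - t0\<close> and
  nonnegative on both sides, hence zero; so the line would run along \<open>e\<close> and be
  radial.\<close>

lemma crossing_distinct:
  assumes l: "line c {a..t0} T \<alpha> v" "line c {t0..b} T' \<beta> w" and ab: "a < t0" "t0 < b" "{a..b} \<subseteq> D"
    and nr: "\<And>s. \<alpha> + s *\<^sub>R v \<noteq> 0" and edge: "\<not> inner (c t0)" "c t0 \<noteq> apex M x"
  shows "T \<noteq> T'"
proof
  assume "T = T'"
  then have l2: "line c {t0..b} T \<alpha> v" using same_cone_straight[OF l(1) _ ab, of \<beta> w] l(2) by simp
  have sub: "{a..t0} \<subseteq> D" using ab by auto
  note v = line_norm[OF l(1) ab(1) sub]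
  have ct: "coord (c t0) T (\<alpha> + t0 *\<^sub>R v)" using lineD[OF l2, of t0] ab by simp
  obtain e r where e: "e \<in> Ed T" "0 < r" "\<alpha> + t0 *\<^sub>R v = r *\<^sub>R u T e"
    using not_inner_cases[OF ct edge] by metis
  obtain f where f: "f \<in> Ed T" "f \<noteq> e" "Ed T = {e, f}" using other_edge[OF v(3) e(1)] by blast
  have co: "co T f (\<alpha> + t *\<^sub>R v) = (t - t0) * co T f v" for t
  proof -
    have "\<alpha> + t *\<^sub>R v = r *\<^sub>R u T e + (t - t0) *\<^sub>R v" unfolding e(3)[symmetric] by (simp add:
        algebra_simps)
    then show ?thesis using v(3) e(1) f by (simp add: co_simps co_u)
  qed
  have "0 \<le> (a - t0) * co T f v" "0 \<le> (b - t0) * co T f v"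
    using coordD(2)[OF lineD[OF l(1), of a]] coordD(2)[OF lineD[OF l2, of b]] ab in_sector[OF
        v(3)] f(1) co
    by (metis atLeastAtMost_iff less_imp_le order_refl)+
  then have "co T f v = 0" using ab by (auto simp: zero_le_mult_iff)
  then have "v = co T e v *\<^sub>R u T e" using on_edge_iff[OF v(3) f(3,2)] by blast
  from parallel_radial[OF v(2) this e(3)] show False using nr by blast
qed

end

locale maximal_cone_geodesic = cone_geodesic +
  assumes maximal: "maximal_geodesic M x D c"
begin

lemma unextendable: "D \<subset> D' \<Longrightarrow> geodesic M x D' c' \<Longrightarrow> \<forall>t\<in>D. c' t = c t \<Longrightarrow> False"
  using maximal unfolding maximal_geodesic_def by blast

text \<open>Interpreting the locale for the reversed curve turns each forward statement into its
  backward counterpart.\<close>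

lemma reverse_maximal:
  "maximal_cone_geodesic (reverse M) x Ed u co (uminus ` D) (\<lambda>t. c (- t)) \<sigma>"
  by (intro maximal_cone_geodesic.intro cone_geodesic.intro reverse_structure
      cone_geodesic_axioms.intro
      maximal_cone_geodesic_axioms.intro geodesic_reverse[OF geodesic] sigma_pos
          const_speed_reverse[OF speed]
      maximal_geodesic_reverse[OF maximal])

section \<open>Radial maximal geodesics\<close>

lemma radial_ray_maximal:
  assumes t1: "t1 \<in> D" "d \<in> D" "t1 < d" and l: "line c (D \<inter> {t1..}) T (- s0 *\<^sub>R v) v" and s0: "s0
      \<le> t1"
  shows "{t1..} \<subseteq> D"
proof (rule ccontr)
  assume "\<not> {t1..} \<subseteq> D"
  then obtain y where y: "y \<notin> D" "t1 < y" using t1(1) by (metis atLeast_iff less_eq_real_def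
      subsetI)
  obtain b where b: "t1 < b" "D \<subseteq> {..b}" "{t1..<b} \<subseteq> D" "b \<le> y" by (rule sup_facts[OF t1 y])
  have cd: "coord (c d) T ((d - s0) *\<^sub>R v)" using lineD[OF l, of d] t1 by (simp add: algebra_simps)
  have sec: "(t - s0) *\<^sub>R v \<in> sector M x T" if t: "t \<in> {b..}" for t
  proof -
    \<comment> \<open>A nonnegative multiple of a vector known to lie in the sector; the zero
      summand fits the form of \<open>sector_convex\<close>.\<close>
    have "(t - s0) *\<^sub>R v = ((t - s0) / (d - s0)) *\<^sub>R ((d - s0) *\<^sub>R v) + 0 *\<^sub>R ((d - s0) *\<^sub>R v)"
      using s0 t1 by simp
    also have "\<dots> \<in> sector M x T"
      by (rule sector_convex[OF coordD(1)[OF cd] coordD(2)[OF cd] coordD(2)[OF cd]]) (use s0 t1 b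
          t in auto)
    finally show ?thesis .
  qed
  have iv: "is_interval {b..}" by (auto simp: is_interval_1)
  obtain c' where "geodesic M x (D \<union> {b..}) c'" "\<forall>t\<in>D. c' t = c t"
    using extend_radial[OF t1(1) b(1-3) l iv _ order_refl disjI1[OF s0] sec] by auto
  moreover have "D \<subset> D \<union> {b..}"
  proof -
    have "b + 1 \<notin> D"
    proof
      assume "b + 1 \<in> D"
      then have "b + 1 \<in> {..b}" using b(2) by blast
      then show False by simp
    qed
    moreover have "b + 1 \<in> D \<union> {b..}" by simp
    ultimately show ?thesis by blast
  qed
  ultimately show False using unextendable by blast
qed

text \<open>Such a geodesic can be continued up to and including the time \<open>s0\<close>, at
  which it reaches the apex.\<close>

lemma no_maximal_incoming_segment:
  assumes l: "line c D T (- s0 *\<^sub>R v) v" and D: "D \<subseteq> {..<s0}"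
  shows False
proof -
  obtain t1 d where t1: "t1 \<in> D" "d \<in> D" "t1 < d" by (rule nondegenerate)
  have s0: "s0 \<notin> D" "t1 < s0" using D t1 by auto
  obtain b where b: "t1 < b" "D \<subseteq> {..b}" "{t1..<b} \<subseteq> D" "b \<le> s0" by (rule sup_facts[OF t1 s0])
  have c1: "coord (c t1) T ((t1 - s0) *\<^sub>R v)" using lineD[OF l, of t1] t1 by (simp add:
      algebra_simps)
  have sec: "(t - s0) *\<^sub>R v \<in> sector M x T" if t: "t \<in> {b..s0}" for t
  proof -
    have "(t - s0) *\<^sub>R v = ((t - s0) / (t1 - s0)) *\<^sub>R ((t1 - s0) *\<^sub>R v) + 0 *\<^sub>R ((t1 - s0) *\<^sub>R v)"
      using s0 t1 by simp
    also have "\<dots> \<in> sector M x T"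
      by (rule sector_convex[OF coordD(1)[OF c1] coordD(2)[OF c1] coordD(2)[OF c1]])
         (use s0 t1 b t in \<open>auto simp: divide_nonpos_neg\<close>)
    finally show ?thesis .
  qed
  have l1: "line c (D \<inter> {t1..}) T (- s0 *\<^sub>R v) v" by (rule line_subset[OF l]) auto
  have iv: "is_interval {b..s0}" by (auto simp: is_interval_1)
  have "b \<in> {b..s0}" "{b..s0} \<subseteq> {b..}" "s0 \<le> t1 \<or> {b..s0} \<subseteq> {..s0}" using b by auto
  from extend_radial[OF t1(1) b(1-3) l1 iv this sec]
  obtain c' where "geodesic M x (D \<union> {b..s0}) c'" "\<forall>t\<in>D. c' t = c t" by blast
  moreover have "s0 \<in> D \<union> {b..s0}" using b(4) by simp
  then have "D \<subset> D \<union> {b..s0}" using s0(1) by blast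
  ultimately show False using unextendable by blast
qed

text \<open>A straight piece that starts at the apex is radial. A radial line is at the apex only
  once, so \<open>radial_forward\<close> keeps it radial, and maximality makes the ray
  infinite.\<close>

lemma forward_from_apex:
  assumes t0: "t0 \<in> D" "c t0 = apex M x" and t: "t \<in> D" "t0 < t"
  shows "{t0..} \<subseteq> D" "\<exists>T v. straight_on M x c {t0..} T v"
proof -
  obtain d T \<alpha> v where d: "t0 < d" "d \<le> t" and l: "line c {t0..d} T \<alpha> v"
    using right_germ[OF t(2) is_interval_subset[OF interval t0(1) t(1)]] by blast
  have sub: "{t0..d} \<subseteq> D" using is_interval_subset[OF interval t0(1) t(1)] d by auto
  note v = line_norm[OF l d(1) sub]
  have "\<alpha> + t0 *\<^sub>R v = 0" using coord_0_iff[OF lineD[OF l, of t0]] d t0(2) by simp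
  then have \<alpha>: "\<alpha> = - t0 *\<^sub>R v" by (simp add: eq_neg_iff_add_eq_0)
  have "line c (D \<inter> {t0..}) T (- t0 *\<^sub>R v) v" unfolding line_def
  proof
    fix s assume s: "s \<in> D \<inter> {t0..}"
    show "coord (c s) T (- t0 *\<^sub>R v + s *\<^sub>R v)"
    proof (cases "s \<le> d")
      case True then show ?thesis using lineD[OF l, of s] s \<alpha> by simp
    next
      case False
      then have ds: "d < s" by simp
      have "{d..s} \<subseteq> D" using is_interval_subset[OF interval t0(1), of s] s d by auto
      from radial_forward[OF ds this d(1) sub l[unfolded \<alpha>]] d(1) s ds show ?thesis
        using lineD[of c "{t0..s}" T "- t0 *\<^sub>R v" v s] by auto
    qed
  qed
  note l' = this
  show D: "{t0..} \<subseteq> D" by (rule radial_ray_maximal[OF t0(1) t l' order_refl])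
  have "line c {t0..} T (- t0 *\<^sub>R v) v" by (rule line_subset[OF l']) (use D in auto)
  then show "\<exists>T v. straight_on M x c {t0..} T v" unfolding straight_on_iff using v by blast
qed

lemma backward_to_apex:
  assumes t0: "t0 \<in> D" "c t0 = apex M x" and t: "t \<in> D" "t < t0"
  shows "{..t0} \<subseteq> D" "\<exists>T v. straight_on M x c {..t0} T v"
proof -
  interpret R: maximal_cone_geodesic "reverse M" x Ed u co "uminus ` D" "\<lambda>t. c (- t)" \<sigma>
    by (rule reverse_maximal)
  have r: "- t0 \<in> uminus ` D" "c (- (- t0)) = apex (reverse M) x" "- t \<in> uminus ` D" "- t0 < - t"
    using t0 t by auto
  show "{..t0} \<subseteq> D"
  proof
    fix s assume "s \<in> {..t0}"
    then have "- s \<in> uminus ` D" using R.forward_from_apex(1)[OF r] by auto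
    then show "s \<in> D" by (simp add: mem_uminus_image)
  qed
  obtain T v where "straight_on (reverse M) x (\<lambda>t. c (- t)) {- t0..} T v" using
      R.forward_from_apex(2)[OF r] by blast
  then have v: "T \<in> star M x" "v \<noteq> 0" and "\<exists>\<alpha>. line (\<lambda>t. c (- t)) {- t0..} T \<alpha> v"
    unfolding R.straight_on_iff reverse_line by auto
  then obtain \<alpha> where "line (\<lambda>t. c (- t)) {- t0..} T \<alpha> v" by blast
  from line_reverse[OF this] have "line c {..t0} T \<alpha> (- v)" by simp
  then show "\<exists>T v. straight_on M x c {..t0} T v" unfolding straight_on_iff using v by (intro
      exI[of _ T] exI[of _ "- v"]) auto
qed

lemma radial_right:
  assumes na: "\<And>t. t \<in> D \<Longrightarrow> c t \<noteq> apex M x"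
    and l: "line c {a..b} T (- s0 *\<^sub>R v) v" "a < b" "{a..b} \<subseteq> D"
  shows "line c (D \<inter> {a..}) T (- s0 *\<^sub>R v) v"
  unfolding line_def
proof
  fix s assume s: "s \<in> D \<inter> {a..}"
  show "coord (c s) T (- s0 *\<^sub>R v + s *\<^sub>R v)"
  proof (cases "s \<le> b")
    case True then show ?thesis using lineD[OF l(1), of s] s by simp
  next
    case False
    then have bs: "b < s" by simp
    have bD: "b \<in> D" using l by auto
    have sub: "{b..s} \<subseteq> D" using is_interval_subset[OF interval bD, of s] s by auto
    have "line c {a..s} T (- s0 *\<^sub>R v) v"
      by (rule radial_forward[OF bs sub l(2,3,1)]) (use na sub in blast)
    from lineD[OF this, of s] show ?thesis using bs l(2) by simp
  qed
qed

text \<open>A radial piece would make the whole geodesic radial, to the right by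
  \<open>radial_right\<close> and to the left by reversal. The time \<open>s\<close> of the apex is
  missing from the interval \<open>D\<close>, so \<open>D\<close> lies on one side of it, and the
  geodesic could be extended to the apex, after reversal if \<open>D\<close> lies to the
  right.\<close>

lemma nonradial:
  assumes na: "\<And>t. t \<in> D \<Longrightarrow> c t \<noteq> apex M x"
    and ab: "a < b" "{a..b} \<subseteq> D" and l: "line c {a..b} T \<alpha> v"
  shows "\<alpha> + s *\<^sub>R v \<noteq> 0"
proof
  assume "\<alpha> + s *\<^sub>R v = 0"
  then have \<alpha>: "\<alpha> = - s *\<^sub>R v" by (simp add: eq_neg_iff_add_eq_0)
  interpret R: maximal_cone_geodesic "reverse M" x Ed u co "uminus ` D" "\<lambda>t. c (- t)" \<sigma>
    by (rule reverse_maximal)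
  have na': "c (- t) \<noteq> apex (reverse M) x" if "t \<in> uminus ` D" for t using na that by (auto simp:
      mem_uminus_image)
  have right: "line c (D \<inter> {a..}) T (- s *\<^sub>R v) v" by (rule radial_right[OF na l[unfolded \<alpha>] ab])
  have "line (\<lambda>t. c (- t)) {- b..- a} T (- (- s) *\<^sub>R (- v)) (- v)" using line_reverse[OF l] \<alpha> by
      simp
  moreover have "{- b..- a} \<subseteq> uminus ` D"
  proof
    fix t assume "t \<in> {- b..- a}"
    then have "- t \<in> {a..b}" by simp
    then show "t \<in> uminus ` D" using ab(2) by (auto simp: mem_uminus_image)
  qed
  ultimately have "line (\<lambda>t. c (- t)) (uminus ` D \<inter> {- b..}) T (- (- s) *\<^sub>R (- v)) (- v)"
    using ab(1) by (intro R.radial_right[unfolded reverse_line] na') simp_all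
  from line_reverse[OF this] have left: "line c (uminus ` (uminus ` D \<inter> {- b..})) T (- s *\<^sub>R v) v"
      by simp
  have all: "line c D T (- s *\<^sub>R v) v" unfolding line_def
  proof
    fix t assume t: "t \<in> D"
    show "coord (c t) T (- s *\<^sub>R v + t *\<^sub>R v)"
    proof (cases "a \<le> t")
      case True then show ?thesis using lineD[OF right] t by simp
    next
      case False
      then have "t \<in> uminus ` (uminus ` D \<inter> {- b..})" using t ab by (simp add: mem_uminus_image)
      then show ?thesis by (rule lineD[OF left])
    qed
  qed
  have "s \<notin> D"
  proof
    assume s: "s \<in> D"
    from coord_0_iff[OF lineD[OF all s]] na[OF s] show False by simp
  qed
  have "D \<subseteq> {..<s} \<or> D \<subseteq> {s<..}"
  proof (rule ccontr)
    assume "\<not> ?thesis"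
    then obtain p q where "p \<in> D" "\<not> p < s" "q \<in> D" "\<not> s < q" by auto
    then have "{q..p} \<subseteq> D" "s \<in> {q..p}" using is_interval_subset[OF interval] by simp_all
    then show False using \<open>s \<notin> D\<close> by blast
  qed
  then consider "D \<subseteq> {..<s}" | "D \<subseteq> {s<..}" by blast
  then show False
  proof cases
    case 1 then show False by (rule no_maximal_incoming_segment[OF all])
  next
    case 2
    have "line (\<lambda>t. c (- t)) (uminus ` D) T (- (- s) *\<^sub>R (- v)) (- v)" using line_reverse[OF all]
        by simp
    moreover have "uminus ` D \<subseteq> {..<- s}" using 2 by auto
    ultimately show False using R.no_maximal_incoming_segment[unfolded reverse_line] by blast
  qed
qed

text \<open>Before a finite right end there are only finitely many crossings. After the last one the
  geodesic is a single line that is not radial, and \<open>extend_nonradial\<close> continues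
  it.\<close>

lemma unbounded_right:
  assumes na: "\<And>t. t \<in> D \<Longrightarrow> c t \<noteq> apex M x" and t1: "t1 \<in> D"
  shows "{t1..} \<subseteq> D"
proof (rule ccontr)
  assume "\<not> {t1..} \<subseteq> D"
  then obtain y where y: "y \<notin> D" "t1 < y" using t1(1) by (metis atLeast_iff less_eq_real_def
      subsetI)
  obtain a d where a: "a \<in> D" "d \<in> D" "a < d" by (rule nondegenerate)
  have "a < y"
  proof (rule ccontr)
    assume "\<not> a < y"
    then have "y \<in> {t1..a}" using y(2) by simp
    then show False using is_interval_subset[OF interval t1 a(1)] y(1) by blast
  qed
  from sup_facts[OF a y(1) this] obtain b where b: "a < b" "D \<subseteq> {..b}" "{a..<b} \<subseteq> D" "b \<le> y" .
  \<comment> \<open>Inserting \<open>a\<close> makes the set nonempty. Omitting \<open>b\<close>,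
    which may itself be a crossing time, leaves a nondegenerate interval after the maximum.\<close>
  define Z where "Z = insert a ({t \<in> D. a \<le> t \<and> \<not> inner (c t)} \<inter> {..<b})"
  have fin: "finite Z" unfolding Z_def using finite_forward_crossings[OF nonradial[OF na] na a(1)]
      by simp
  define t2 where "t2 = Max Z"
  have "t2 \<in> Z" unfolding t2_def using fin by (intro Max_in) (auto simp: Z_def)
  then have t2: "t2 \<in> D" "t2 < b" "a \<le> t2" using a b by (auto simp: Z_def)
  define q where "q = (t2 + b) / 2"
  have q: "t2 < q" "q \<in> D" using t2 b(3) by (auto simp: q_def subset_iff)
  have "\<exists>T \<alpha> v. line c (D \<inter> {t2..}) T \<alpha> v"
  proof (rule interval_line[of _ t2 q])
    show "is_interval (D \<inter> {t2..})" using interval by (auto simp: is_interval_1)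
    show "inner (c t)" if "s \<in> D \<inter> {t2..}" "t' \<in> D \<inter> {t2..}" "s < t" "t < t'" for s t t'
    proof (rule ccontr)
      assume "\<not> inner (c t)"
      moreover have "t \<in> D" using is_interval_subset[OF interval, of s t'] that by auto
      moreover have "a \<le> t" "t < b" using that t2 b by auto
      ultimately have "t \<in> Z" by (simp add: Z_def)
      then have "t \<le> t2" unfolding t2_def using fin by simp
      then show False using that by simp
    qed
  qed (use t2 q in auto)
  then obtain T \<alpha> v where l: "line c (D \<inter> {t2..}) T \<alpha> v" by blast
  have sub: "{t2..q} \<subseteq> D" by (rule is_interval_subset[OF interval t2(1) q(2)])
  have lq: "line c {t2..q} T \<alpha> v" by (rule line_subset[OF l]) (use sub in auto)
  have nr: "\<alpha> + s *\<^sub>R v \<noteq> 0" for s by (rule nonradial[OF _ q(1) sub lq]) (rule na)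
  have "{t2..<b} \<subseteq> D" using b(3) t2(3) by auto
  from extend_nonradial[OF t2(1,2) b(2) this l nr] show False using unextendable by blast
qed

lemma unbounded:
  assumes na: "\<And>t. t \<in> D \<Longrightarrow> c t \<noteq> apex M x"
  shows "D = UNIV" "finite {t. \<not> inner (c t)}"
proof -
  interpret R: maximal_cone_geodesic "reverse M" x Ed u co "uminus ` D" "\<lambda>t. c (- t)" \<sigma>
    by (rule reverse_maximal)
  have na': "c (- t) \<noteq> apex (reverse M) x" if "t \<in> uminus ` D" for t using na that by (auto simp:
      mem_uminus_image)
  obtain a where a: "a \<in> D" using nondegenerate by blast
  then have a': "- a \<in> uminus ` D" by simp
  have 1: "{a..} \<subseteq> D" by (rule unbounded_right[OF na a])
  have 2: "{- a..} \<subseteq> uminus ` D" by (rule R.unbounded_right[OF na' a'])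
  show D: "D = UNIV"
  proof (intro equalityI subsetI UNIV_I)
    fix t :: real
    show "t \<in> D"
    proof (cases "a \<le> t")
      case False
      then have "- t \<in> uminus ` D" using 2 by auto
      then show ?thesis by (simp add: mem_uminus_image)
    qed (use 1 in auto)
  qed
  have f1: "finite {t \<in> D. a \<le> t \<and> \<not> inner (c t)}"
    by (rule finite_forward_crossings[OF nonradial[OF na] na a])
  have f2: "finite {t \<in> uminus ` D. - a \<le> t \<and> \<not> inner (c (- t))}"
    using R.finite_forward_crossings[OF R.nonradial[OF na'] na' a'] unfolding reverse_inner .
  have "{t. \<not> inner (c t)} \<subseteq> {t \<in> D. a \<le> t \<and> \<not> inner (c t)} \<union> uminus ` {t \<in> uminus ` D. - a \<le> t \<and>
      \<not> inner (c (- t))}"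
  proof
    fix t assume t: "t \<in> {t. \<not> inner (c t)}"
    show "t \<in> {t \<in> D. a \<le> t \<and> \<not> inner (c t)} \<union> uminus ` {t \<in> uminus ` D. - a \<le> t \<and> \<not> inner (c (-
        t))}"
      using t D by (cases "a \<le> t") (auto simp: mem_uminus_image)
  qed
  then show "finite {t. \<not> inner (c t)}" using f1 f2 finite_subset by blast
qed

end

subsection \<open>Triangles at a vertex\<close>

text \<open>Cramer's rule with the determinant \<open>d\<close>, which is nonzero for independent
  \<open>p\<close> and \<open>q\<close>.\<close>

lemma plane_coordinates:
  fixes p q :: "real^2"
  assumes ind: "\<And>s t. s *\<^sub>R p + t *\<^sub>R q = 0 \<Longrightarrow> s = 0 \<and> t = 0"
  shows "\<exists>f g :: real^2 \<Rightarrow> real. linear f \<and> linear g \<and> f p = 1 \<and> f q = 0 \<and> g p = 0 \<and> g q = 1 \<and>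
    (\<forall>a. f a *\<^sub>R p + g a *\<^sub>R q = a)"
proof -
  define d where "d = p $ 1 * q $ 2 - p $ 2 * q $ 1"
  have "d \<noteq> 0"
  proof
    assume d: "d = 0"
    have "q $ 2 *\<^sub>R p + (- p $ 2) *\<^sub>R q = 0" "q $ 1 *\<^sub>R p + (- p $ 1) *\<^sub>R q = 0"
      using d by (auto simp: vec_eq_iff forall_2 d_def algebra_simps)
    from ind[OF this(1)] ind[OF this(2)] have "p = 0" by (simp add: vec_eq_iff forall_2)
    then show False using ind[of 1 0] by simp
  qed
  define f :: "real^2 \<Rightarrow> real" where "f a = (a $ 1 * q $ 2 - a $ 2 * q $ 1) / d" for a
  define g :: "real^2 \<Rightarrow> real" where "g a = (p $ 1 * a $ 2 - p $ 2 * a $ 1) / d" for a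
  have lin: "linear f" "linear g"
    by (rule linearI; simp add: f_def g_def add_divide_distrib diff_divide_distrib algebra_simps)+
  have val: "f p = 1" "f q = 0" "g p = 0" "g q = 1"
    using \<open>d \<noteq> 0\<close> by (simp_all add: f_def g_def) (simp_all add: d_def mult.commute)
  have "f a *\<^sub>R p + g a *\<^sub>R q = a" for a
  proof -
    have "(f a *\<^sub>R p + g a *\<^sub>R q) $ i = a $ i" if "i = 1 \<or> i = 2" for i
    proof -
      have "d * ((f a *\<^sub>R p + g a *\<^sub>R q) $ i) = (a $ 1 * q $ 2 - a $ 2 * q $ 1) * p $ i + (p $ 1 *
          a $ 2 - p $ 2 * a $ 1) * q $ i"
        using \<open>d \<noteq> 0\<close> by (simp add: f_def g_def distrib_left)
      also have "\<dots> = d * a $ i" using that by (auto simp: d_def algebra_simps)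
      finally show ?thesis using \<open>d \<noteq> 0\<close> by simp
    qed
    then show ?thesis by (simp add: vec_eq_iff forall_2)
  qed
  then show ?thesis using lin val by (intro exI[of _ f] exI[of _ g]) simp
qed

lemma noncollinear_independent:
  fixes A B C :: "'v::euclidean_space"
  assumes "\<not> collinear {A, B, C}" "s *\<^sub>R (B - A) + t *\<^sub>R (C - A) = 0"
  shows "s = 0 \<and> t = 0"
proof -
  have nc: "\<not> collinear {0, B - A, C - A}"
    using assms(1) collinear_3[of B A C] by (simp add: insert_commute)
  have "s = 0"
  proof (rule ccontr)
    assume "s \<noteq> 0"
    have "s *\<^sub>R (B - A) = (- t) *\<^sub>R (C - A)" using assms(2) by (simp add: eq_neg_iff_add_eq_0)
    then have "(1 / s) *\<^sub>R (s *\<^sub>R (B - A)) = (1 / s) *\<^sub>R ((- t) *\<^sub>R (C - A))" by (rule arg_cong)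
    then have "B - A = (- t / s) *\<^sub>R (C - A)" using \<open>s \<noteq> 0\<close> by simp
    then have "collinear {0, C - A, B - A}" unfolding collinear_lemma by blast
    then show False using nc by (simp add: insert_commute)
  qed
  moreover have "C - A \<noteq> 0" using nc by (auto simp: collinear_lemma)
  ultimately show ?thesis using assms(2) by simp
qed

locale pf_surface_at_vertex =
  fixes M :: "'a pf_surface" and x :: 'a
  assumes surface: "pf_finsler_surface M" and vertex: "x \<in> pf_vertices M"
begin

lemmas conditions = surface[unfolded pf_finsler_surface_def]
lemmas topological = conditions[THEN conjunct1]
lemmas cover = conditions[THEN conjunct2, THEN conjunct1]
lemmas locally_finite = conditions[THEN conjunct2, THEN conjunct2, THEN conjunct1, rule_format]
lemmas flat_triangle = conditions[THEN conjunct2, THEN conjunct2, THEN conjunct2, THEN conjunct1,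
    rule_format]
lemmas intersection = conditions[THEN conjunct2, THEN conjunct2, THEN conjunct2, THEN conjunct2,
  THEN conjunct1, rule_format]
lemmas isometric_edges = conditions[THEN conjunct2, THEN conjunct2, THEN conjunct2, THEN conjunct2,
  THEN conjunct2, rule_format]

lemma norm_strict: "T \<in> triangles M \<Longrightarrow> strict_norm (fnorm M T)"
  by (rule minkowski_norm_imp_strict_norm[OF flat_triangle[THEN conjunct1]])

lemma triangle_chart:
  assumes "T \<in> triangles M"
  obtains A B C where "\<not> collinear {A, B, C}"
    "homeomorphic_map (subtopology (surf M) T) (top_of_set (convex hull {A, B, C})) (chart M T)"
    "inj_on (chart M T) T" "chart M T ` T = convex hull {A, B, C}"
proof -
  obtain A B C where nc: "\<not> collinear {A, B, C}"
    and h: "homeomorphic_map (subtopology (surf M) T) (top_of_set (convex hull {A, B, C})) (chart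
        M T)"
    using flat_triangle[OF assms, THEN conjunct2] by (elim exE conjE)
  have "T \<subseteq> topspace (surf M)" using cover assms by blast
  then have ts: "topspace (subtopology (surf M) T) = T" by auto
  have "inj_on (chart M T) T" "chart M T ` T = convex hull {A, B, C}"
    using homeomorphic_imp_injective_map[OF h] homeomorphic_imp_surjective_map[OF h] ts by simp_all
  then show ?thesis using that nc h by blast
qed

lemma chart_inj: "T \<in> triangles M \<Longrightarrow> inj_on (chart M T) T"
  using triangle_chart by metis

lemma chart_diff_nonzero: "T \<in> triangles M \<Longrightarrow> p \<in> T \<Longrightarrow> q \<in> T \<Longrightarrow> p \<noteq> q \<Longrightarrow> chart M T q - chart M T p \<noteq> 0"
  using chart_inj inj_onD by fastforce

lemma intersection_cases:
  assumes "T \<in> triangles M" "T' \<in> triangles M" "T \<noteq> T'" "p \<in> T" "p \<in> T'"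
  shows "T \<inter> T' \<in> tri_edges M T \<and> T \<inter> T' \<in> tri_edges M T' \<or>
     (p \<in> tri_vertices M T \<and> p \<in> tri_vertices M T' \<and> T \<inter> T' = {p})"
proof -
  have "T \<inter> T' = {} \<or> T \<inter> T' \<in> tri_edges M T \<inter> tri_edges M T' \<or>
        (\<exists>p \<in> tri_vertices M T \<inter> tri_vertices M T'. T \<inter> T' = {p})"
    by (rule intersection[OF assms(1-3)])
  then show ?thesis
  proof (elim disjE bexE)
    fix p' assume "p' \<in> tri_vertices M T \<inter> tri_vertices M T'" "T \<inter> T' = {p'}"
    moreover have "p \<in> T \<inter> T'" using assms(4,5) by simp
    ultimately show ?thesis by simp
  qed (use assms(4,5) in auto)
qed

lemma edge_lengths:
  assumes "T \<in> triangles M" "T' \<in> triangles M" "T \<noteq> T'" "T \<inter> T' \<in> tri_edges M T" "T \<inter> T' \<in>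
      tri_edges M T'"
    "p \<in> T \<inter> T'" "q \<in> T \<inter> T'"
  shows "fnorm M T (chart M T q - chart M T p) = fnorm M T' (chart M T' q - chart M T' p)"
  by (rule isometric_edges[OF assms(1-3) IntI[OF assms(4,5)] assms(6,7)])

lemma noncollinear_affine_independent:
  fixes A B C :: "real^2"
  shows "\<not> collinear {A, B, C} \<Longrightarrow> \<not> affine_dependent {A, B, C}"
  by (simp add: collinear_3_eq_affine_dependent)

section \<open>Edges and vertices of one triangle\<close>

lemma edge_segment:
  assumes nc: "\<not> collinear {A, B, C}" and e: "K edge_of (convex hull {A, B, C :: real^2})"
  obtains P Q where "P \<in> {A, B, C}" "Q \<in> {A, B, C}" "P \<noteq> Q" "K = closed_segment P Q"
proof -
  have ai: "\<not> affine_dependent {A, B, C}" by (rule noncollinear_affine_independent[OF nc])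
  have f: "K face_of (convex hull {A, B, C})" "aff_dim K = 1" using e by (auto simp: edge_of_def)
  obtain c where c: "c \<subseteq> {A, B, C}" "K = convex hull c"
    using f(1) face_of_convex_hull_affine_independent[OF ai] by blast
  have "\<not> affine_dependent c" using ai c(1) affine_dependent_subset by blast
  then have "int (card c) - 1 = 1"
    using f(2) c(2) aff_dim_affine_independent[of c] by (simp add: aff_dim_convex_hull)
  then have "card c = 2" by simp
  then obtain P Q where "c = {P, Q}" "P \<noteq> Q" by (auto simp: card_2_iff)
  then show ?thesis using that[of P Q] c by (simp add: segment_convex_hull)
qed

lemma segment_edge:
  assumes nc: "\<not> collinear {A, B, C}" and PQ: "P \<in> {A, B, C}" "Q \<in> {A, B, C}" "P \<noteq> Q"
  shows "closed_segment P Q edge_of (convex hull {A, B, C :: real^2})"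
proof -
  have ai: "\<not> affine_dependent {A, B, C}" by (rule noncollinear_affine_independent[OF nc])
  have "closed_segment P Q face_of (convex hull {A, B, C})"
    unfolding segment_convex_hull face_of_convex_hull_affine_independent[OF ai]
    by (rule exI[of _ "{P, Q}"]) (use PQ in auto)
  moreover have "aff_dim (closed_segment P Q) = 1"
    using PQ(3) by (simp add: segment_convex_hull aff_dim_convex_hull aff_dim_2)
  ultimately show ?thesis by (simp add: edge_of_def)
qed

lemma vertex_iff:
  assumes "\<not> collinear {A, B, C}" "chart M T ` T = convex hull {A, B, C}" "p \<in> T"
  shows "p \<in> tri_vertices M T \<longleftrightarrow> chart M T p \<in> {A, B, C}"
  unfolding tri_vertices_def assms(2)
  using assms(3) extreme_point_of_convex_hull_affine_independent[OF
      noncollinear_affine_independent[OF assms(1)]] by simp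

lemma edge_of_iff:
  assumes nc: "\<not> collinear {A, B, C}" and T: "chart M T ` T = convex hull {A, B, C}"
  shows "e \<in> tri_edges M T \<longleftrightarrow> e \<subseteq> T \<and> (\<exists>P\<in>{A, B, C}. \<exists>Q\<in>{A, B, C}. P \<noteq> Q \<and> chart M T ` e =
      closed_segment P Q)"
  unfolding tri_edges_def T using edge_segment[OF nc] segment_edge[OF nc] by (metis (no_types,
      lifting) mem_Collect_eq)

lemma star_triangle: "T \<in> star M x \<Longrightarrow> T \<in> triangles M" "T \<in> star M x \<Longrightarrow> x \<in> T"
  by (auto simp: star_def)

text \<open>By hypothesis \<open>x\<close> is a vertex of just some triangle \<open>T0\<close>. If
  it were interior to the common edge in another triangle, lengths along the edge would add up at
  \<open>x\<close>, also in the metric of \<open>T0\<close>; strict convexity would then place its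
  image strictly between two points of the chart of \<open>T0\<close>, where it is extreme. The
  charts are compared through lengths, since no affine relation between them on the edge is
  assumed.\<close>

lemma vertex_of_star:
  assumes T: "T \<in> star M x"
  shows "x \<in> tri_vertices M T"
proof -
  obtain T0 where T0: "T0 \<in> triangles M" "x \<in> tri_vertices M T0" using vertex by (auto simp:
      pf_vertices_def)
  have x0: "x \<in> T0" using T0 by (auto simp: tri_vertices_def)
  show ?thesis
  proof (cases "T = T0")
    case False
    note t = star_triangle[OF T]
    from intersection_cases[OF t(1) T0(1) False t(2) x0] show ?thesis
    proof
      assume e: "T \<inter> T0 \<in> tri_edges M T \<and> T \<inter> T0 \<in> tri_edges M T0"
      obtain A B C where nc: "\<not> collinear {A, B, C}" and im: "chart M T ` T = convex hull {A, B, C}"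
        by (rule triangle_chart[OF t(1)])
      obtain P Q where PQ: "P \<in> {A, B, C}" "Q \<in> {A, B, C}" "P \<noteq> Q" "chart M T ` (T \<inter> T0) =
          closed_segment P Q"
        using e edge_of_iff[OF nc im, of "T \<inter> T0"] by blast
      define X where "X = chart M T x"
      have X: "X \<in> closed_segment P Q" unfolding PQ(4)[symmetric] X_def using t x0 by blast
      show ?thesis
      proof (rule ccontr)
        assume "x \<notin> tri_vertices M T"
        then have "X \<noteq> P" "X \<noteq> Q" using vertex_iff[OF nc im t(2)] PQ by (auto simp: X_def)
        obtain s where s: "0 \<le> s" "s \<le> 1" "X = (1 - s) *\<^sub>R P + s *\<^sub>R Q" using X by (auto simp:
            closed_segment_def)
        have "P \<in> chart M T ` (T \<inter> T0)" "Q \<in> chart M T ` (T \<inter> T0)" unfolding PQ(4) by auto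
        then obtain p q where p: "p \<in> T \<inter> T0" "chart M T p = P" and q: "q \<in> T \<inter> T0" "chart M T q =
            Q" by blast
        have ne: "p \<noteq> x" "q \<noteq> x" using p q \<open>X \<noteq> P\<close> \<open>X \<noteq> Q\<close> by (auto simp: X_def)
        interpret F: strict_normed "fnorm M T" using norm_strict[OF t(1)] by unfold_locales
        interpret F0: strict_normed "fnorm M T0" using norm_strict[OF T0(1)] by unfold_locales
        have xin: "x \<in> T \<inter> T0" using t x0 by blast
        note el = edge_lengths[OF t(1) T0(1) False e[THEN conjunct1] e[THEN conjunct2]]
        have XPQ: "X - P = s *\<^sub>R (Q - P)" "Q - X = (1 - s) *\<^sub>R (Q - P)" unfolding s(3) by
            (simp_all add: algebra_simps)
        have "fnorm M T (X - P) + fnorm M T (Q - X) = s * fnorm M T (Q - P) + (1 - s) * fnorm M T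
            (Q - P)"
          unfolding XPQ using s F.hom[of s "Q - P"] F.hom[of "1 - s" "Q - P"] by simp
        then have "fnorm M T (Q - P) = fnorm M T (X - P) + fnorm M T (Q - X)"
          by (simp add: left_diff_distrib)
        then have "fnorm M T0 (chart M T0 q - chart M T0 p) = fnorm M T0 (chart M T0 x - chart M
            T0 p) + fnorm M T0 (chart M T0 q - chart M T0 x)"
          using el[OF p(1) q(1)] el[OF p(1) xin] el[OF xin q(1)] p q by (simp add: X_def)
        then have "fnorm M T0 ((chart M T0 x - chart M T0 p) + (chart M T0 q - chart M T0 x)) =
            fnorm M T0 (chart M T0 x - chart M T0 p) + fnorm M T0 (chart M T0 q - chart M T0 x)"
          by simp
        moreover have nz: "chart M T0 x - chart M T0 p \<noteq> 0" "chart M T0 q - chart M T0 x \<noteq> 0"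
          using chart_diff_nonzero[OF T0(1)] ne p q x0 by auto
        ultimately obtain k where k: "k > 0" "chart M T0 q - chart M T0 x = k *\<^sub>R (chart M T0 x -
            chart M T0 p)"
          using F0.tri_eq by blast
        define P0 where "P0 = chart M T0 p"
        define Q0 where "Q0 = chart M T0 q"
        define X0 where "X0 = chart M T0 x"
        have kk: "Q0 - X0 = k *\<^sub>R (X0 - P0)" using k by (simp add: P0_def Q0_def X0_def)
        \<comment> \<open>\<open>X0\<close> divides the segment from \<open>P0\<close> to
          \<open>Q0\<close> in the ratio of 1 to \<open>k\<close>, so \<open>Q0\<close> has the
          weight \<open>1 / (1 + k)\<close>.\<close>
        have "(1 + k) *\<^sub>R X0 = k *\<^sub>R P0 + Q0" using kk by (simp add: algebra_simps)
        then have "(1 / (1 + k)) *\<^sub>R ((1 + k) *\<^sub>R X0) = (1 / (1 + k)) *\<^sub>R (k *\<^sub>R P0 + Q0)" by simp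
        moreover have "k / (1 + k) = 1 - 1 / (1 + k)" using k(1) by (simp add: field_simps)
        ultimately have "X0 = (1 - 1 / (1 + k)) *\<^sub>R P0 + (1 / (1 + k)) *\<^sub>R Q0"
          using k(1) by (simp add: scaleR_add_right)
        moreover have "P0 \<noteq> Q0"
        proof -
          have "p \<noteq> q" using p q PQ(3) by auto
          then show ?thesis using chart_diff_nonzero[OF T0(1), of p q] p q by (simp add: P0_def
              Q0_def)
        qed
        ultimately have "X0 \<in> open_segment P0 Q0"
          unfolding in_segment using k(1) by (intro conjI exI[of _ "1 / (1 + k)"]) auto
        moreover have "X0 extreme_point_of (chart M T0 ` T0)" using T0(2) by (simp add:
            tri_vertices_def X0_def)
        ultimately show False using p q unfolding extreme_point_of_def P0_def Q0_def by blast
      qed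
    qed simp
  qed (use T0 in simp)
qed

definition vedges :: "'a set \<Rightarrow> 'a set set" where
  "vedges T = {e \<in> tri_edges M T. x \<in> e}"

text \<open>The choice does not depend on the triangle, so that the edge vectors of all triangles at \<open>e\<close>
  are glued to each other.\<close>

definition edge_point :: "'a set \<Rightarrow> 'a" where
  "edge_point e = (SOME p. p \<in> e \<and> p \<noteq> x)"

definition edge_vector :: "'a set \<Rightarrow> 'a set \<Rightarrow> real^2" where
  "edge_vector T e = chart M T (edge_point e) - chart M T x"

text \<open>\<open>x\<close> is one of the three vertices, so two edges contain it. The edge vectors
  lead to the chosen \<open>edge_point\<close>, which may lie before the vertices \<open>B\<close>
  and \<open>C\<close>; hence the factors \<open>\<mu>\<close> and \<open>\<nu>\<close>.\<close>

lemma star_structure: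
  assumes T: "T \<in> star M x"
  obtains B C e f \<mu> \<nu> where "\<not> collinear {chart M T x, B, C}" "chart M T ` T = convex hull {chart
      M T x, B, C}"
    "vedges T = {e, f}" "e \<noteq> f" "e \<subseteq> T" "f \<subseteq> T"
    "chart M T ` e = closed_segment (chart M T x) B" "chart M T ` f = closed_segment (chart M T x)
        C"
    "0 < \<mu>" "\<mu> \<le> 1" "edge_vector T e = \<mu> *\<^sub>R (B - chart M T x)"
    "0 < \<nu>" "\<nu> \<le> 1" "edge_vector T f = \<nu> *\<^sub>R (C - chart M T x)"
    "edge_point e \<in> e" "edge_point f \<in> f" "edge_point e \<noteq> x" "edge_point f \<noteq> x"
proof -
  note t = star_triangle[OF T]
  obtain A0 B0 C0 where nc0: "\<not> collinear {A0, B0, C0}" and im0: "chart M T ` T = convex hull {A0,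
      B0, C0}"
    by (rule triangle_chart[OF t(1)])
  define A where "A = chart M T x"
  have "A \<in> {A0, B0, C0}" using vertex_iff[OF nc0 im0 t(2)] vertex_of_star[OF T] by (simp add:
      A_def)
  then obtain B C where BC: "{A, B, C} = {A0, B0, C0}" by (metis insertE insert_commute singletonD)
  have nc: "\<not> collinear {A, B, C}" and im: "chart M T ` T = convex hull {A, B, C}" using nc0 im0
      BC by auto
  have dist: "A \<noteq> B" "A \<noteq> C" "B \<noteq> C" using nc by (auto simp: insert_commute)
  have ind: "s = 0 \<and> t = 0" if "s *\<^sub>R (B - A) + t *\<^sub>R (C - A) = 0" for s t
    by (rule noncollinear_independent[OF nc that])
  have inj: "inj_on (chart M T) T" by (rule chart_inj[OF t(1)])
  define e where "e = {p \<in> T. chart M T p \<in> closed_segment A B}"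
  define f where "f = {p \<in> T. chart M T p \<in> closed_segment A C}"
  have sub: "closed_segment P Q \<subseteq> convex hull {A, B, C}" if "P \<in> {A, B, C}" "Q \<in> {A, B, C}" for P Q
    unfolding segment_convex_hull using that by (intro hull_mono) auto
  have ime: "chart M T ` e = closed_segment A B" and imf: "chart M T ` f = closed_segment A C"
    using sub[of A B] sub[of A C] im unfolding e_def f_def by (auto simp: set_eq_iff image_iff
        subset_iff) metis+
  have xe: "x \<in> e" "x \<in> f" using t by (auto simp: e_def f_def A_def)
  have esub: "e \<subseteq> T" "f \<subseteq> T" by (auto simp: e_def f_def)
  have notBC: "A \<notin> closed_segment B C"
  proof
    assume "A \<in> closed_segment B C"
    then obtain s where "A = (1 - s) *\<^sub>R B + s *\<^sub>R C" by (auto simp: closed_segment_def)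
    then have "(1 - s) *\<^sub>R (B - A) + s *\<^sub>R (C - A) = 0" by (simp add: algebra_simps)
    from ind[OF this] show False by auto
  qed
  have vE: "vedges T = {e, f}"
  proof (intro equalityI subsetI)
    fix h assume "h \<in> vedges T"
    then have h: "h \<subseteq> T" "x \<in> h" and "\<exists>P\<in>{A, B, C}. \<exists>Q\<in>{A, B, C}. P \<noteq> Q \<and> chart M T ` h =
        closed_segment P Q"
      using edge_of_iff[OF nc im, of h] by (auto simp: vedges_def)
    then obtain P Q where PQ: "P \<in> {A, B, C}" "Q \<in> {A, B, C}" "P \<noteq> Q" "chart M T ` h =
        closed_segment P Q" by blast
    have A: "A \<in> closed_segment P Q" unfolding PQ(4)[symmetric] A_def using h by blast
    have "closed_segment P Q = closed_segment A B \<or> closed_segment P Q = closed_segment A C"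
      using PQ(1-3) A notBC closed_segment_commute by (metis insertE singletonD)
    then have "chart M T ` h = chart M T ` e \<or> chart M T ` h = chart M T ` f" using ime imf PQ(4)
        by simp
    then show "h \<in> {e, f}" using inj_on_image_eq_iff[OF inj h(1)] esub by blast
  next
    fix h assume "h \<in> {e, f}"
    then show "h \<in> vedges T" using edge_of_iff[OF nc im, of h] ime imf xe esub dist unfolding
        vedges_def by blast
  qed
  have pt: "edge_point h \<in> h \<and> edge_point h \<noteq> x \<and> (\<exists>\<mu>. 0 < \<mu> \<and> \<mu> \<le> 1 \<and> edge_vector T h = \<mu> *\<^sub>R (P
      - A))"
    if h: "chart M T ` h = closed_segment A P" "A \<noteq> P" "h \<subseteq> T" for h P
  proof -
    have "P \<in> chart M T ` h" unfolding h(1) by simp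
    then obtain p where "p \<in> h" "chart M T p = P" by blast
    then have "p \<in> h \<and> p \<noteq> x" using h(2) by (auto simp: A_def)
    then have ep: "edge_point h \<in> h \<and> edge_point h \<noteq> x" unfolding edge_point_def by (rule someI)
    then have "chart M T (edge_point h) \<in> closed_segment A P" unfolding h(1)[symmetric] by blast
    then obtain s where s: "0 \<le> s" "s \<le> 1" "chart M T (edge_point h) = (1 - s) *\<^sub>R A + s *\<^sub>R P" by
        (auto simp: closed_segment_def)
    have ev: "edge_vector T h = s *\<^sub>R (P - A)" unfolding edge_vector_def s(3) A_def[symmetric] by
        (simp add: algebra_simps)
    have "edge_point h \<in> T" "x \<noteq> edge_point h" using ep h(3) by auto
    then have "edge_vector T h \<noteq> 0" unfolding edge_vector_def by (rule chart_diff_nonzero[OF t])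
    then have "s \<noteq> 0" using ev by auto
    then show ?thesis using ep ev s by (intro conjI exI[of _ s]) auto
  qed
  obtain \<mu> where mu: "0 < \<mu>" "\<mu> \<le> 1" "edge_vector T e = \<mu> *\<^sub>R (B - A)" using pt[OF ime dist(1)
      esub(1)] by blast
  obtain \<nu> where nu: "0 < \<nu>" "\<nu> \<le> 1" "edge_vector T f = \<nu> *\<^sub>R (C - A)" using pt[OF imf dist(2)
      esub(2)] by blast
  have "e \<noteq> f"
  proof
    assume "e = f"
    then have "\<mu> *\<^sub>R (B - A) + (- \<nu>) *\<^sub>R (C - A) = 0" using mu nu by simp
    from ind[OF this] show False using mu by simp
  qed
  show ?thesis
    by (rule that[of B C e f \<mu> \<nu>])
       (use nc im vE \<open>e \<noteq> f\<close> esub ime imf mu nu pt[OF ime dist(1) esub(1)] pt[OF imf dist(2)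
           esub(2)] in \<open>simp_all add: A_def\<close>)
qed

end

context pf_surface_at_vertex
begin

lemma vedges_props:
  assumes T: "T \<in> star M x" and e: "e \<in> vedges T"
  shows "e \<subseteq> T" "x \<in> e" "edge_point e \<in> e" "edge_point e \<noteq> x"
    "\<And>q. q \<in> e \<Longrightarrow> \<exists>r\<ge>0. chart M T q - chart M T x = r *\<^sub>R edge_vector T e"
proof -
  obtain B C e1 e2 \<mu> \<nu> where s: "vedges T = {e1, e2}" "e1 \<subseteq> T" "e2 \<subseteq> T"
    "chart M T ` e1 = closed_segment (chart M T x) B" "chart M T ` e2 = closed_segment (chart M T
        x) C"
    "0 < \<mu>" "edge_vector T e1 = \<mu> *\<^sub>R (B - chart M T x)"
    "0 < \<nu>" "edge_vector T e2 = \<nu> *\<^sub>R (C - chart M T x)"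
    "edge_point e1 \<in> e1" "edge_point e2 \<in> e2" "edge_point e1 \<noteq> x" "edge_point e2 \<noteq> x"
    by (rule star_structure[OF T])
  have ray: "\<exists>r\<ge>0. chart M T q - chart M T x = r *\<^sub>R edge_vector T h"
    if h: "chart M T ` h = closed_segment (chart M T x) P" "0 < \<mu>" "edge_vector T h = \<mu> *\<^sub>R (P -
        chart M T x)" and q: "q \<in> h"
    for h P \<mu> q
  proof -
    have "chart M T q \<in> closed_segment (chart M T x) P" unfolding h(1)[symmetric] using q by blast
    then obtain t where t: "0 \<le> t" "chart M T q = (1 - t) *\<^sub>R chart M T x + t *\<^sub>R P" by (auto
        simp: closed_segment_def)
    have "chart M T q - chart M T x = t *\<^sub>R (P - chart M T x)" unfolding t(2) by (simp add:
        algebra_simps)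
    also have "\<dots> = (t / \<mu>) *\<^sub>R edge_vector T h" using h(2,3) by simp
    finally show ?thesis using t(1) h(2) by (intro exI[of _ "t / \<mu>"]) simp
  qed
  show "e \<subseteq> T" "edge_point e \<in> e" "edge_point e \<noteq> x" using e s by auto
  show "x \<in> e" using e by (simp add: vedges_def)
  show "\<exists>r\<ge>0. chart M T q - chart M T x = r *\<^sub>R edge_vector T e" if "q \<in> e" for q
  proof -
    have "e = e1 \<or> e = e2" using e s(1) by simp
    then show ?thesis
    proof
      assume "e = e1"
      then show ?thesis using ray[OF s(4,6,7), of q] that by simp
    next
      assume "e = e2"
      then show ?thesis using ray[OF s(5,8,9), of q] that by simp
    qed
  qed
qed

text \<open>Barycentric coordinates relative to the vertex \<open>x\<close> are, up to the positive
  factors \<open>\<mu>\<close> and \<open>\<nu>\<close> and a scaling, coordinates with respect to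
  the edge vectors.\<close>

lemma edge_frame:
  assumes T: "T \<in> star M x"
  obtains e f where "vedges T = {e, f}" "e \<noteq> f"
    "\<And>s t. s *\<^sub>R edge_vector T e + t *\<^sub>R edge_vector T f = 0 \<Longrightarrow> s = 0 \<and> t = 0"
    "\<And>a. a \<in> sector M x T \<longleftrightarrow> (\<exists>s\<ge>0. \<exists>t\<ge>0. a = s *\<^sub>R edge_vector T e + t *\<^sub>R edge_vector T f)"
proof -
  obtain B C e f \<mu> \<nu> where nc: "\<not> collinear {chart M T x, B, C}" and im: "chart M T ` T = convex
      hull {chart M T x, B, C}"
    and v: "vedges T = {e, f}" "e \<noteq> f"
    and mu: "0 < \<mu>" "edge_vector T e = \<mu> *\<^sub>R (B - chart M T x)"
    and nu: "0 < \<nu>" "edge_vector T f = \<nu> *\<^sub>R (C - chart M T x)"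
    by (rule star_structure[OF T])
  define A where "A = chart M T x"
  have ind: "s = 0 \<and> t = 0" if "s *\<^sub>R edge_vector T e + t *\<^sub>R edge_vector T f = 0" for s t
    using noncollinear_independent[OF nc, of "s * \<mu>" "t * \<nu>"] that mu nu by simp
  have sec: "a \<in> sector M x T \<longleftrightarrow> (\<exists>s\<ge>0. \<exists>t\<ge>0. a = s *\<^sub>R edge_vector T e + t *\<^sub>R edge_vector T f)"
      for a
  proof
    assume "a \<in> sector M x T"
    then obtain r q where r: "0 \<le> r" "q \<in> T" "a = r *\<^sub>R (chart M T q - A)" by (auto simp:
        sector_def A_def)
    have "chart M T q \<in> convex hull {A, B, C}" using im r(2) by (auto simp: A_def)
    then obtain k l m where k: "0 \<le> l" "0 \<le> m" "k + l + m = 1" "chart M T q = k *\<^sub>R A + l *\<^sub>R B +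
        m *\<^sub>R C"
      by (auto simp: convex_hull_3)
    have kk: "k = 1 - l - m" using k(3) by simp
    have "chart M T q - A = l *\<^sub>R (B - A) + m *\<^sub>R (C - A)" unfolding k(4) kk by (simp add:
        algebra_simps)
    then have "a = (r * l) *\<^sub>R (B - A) + (r * m) *\<^sub>R (C - A)" unfolding r(3) by (simp add:
        scaleR_add_right)
    then have "a = (r * l / \<mu>) *\<^sub>R edge_vector T e + (r * m / \<nu>) *\<^sub>R edge_vector T f"
      using mu nu by (simp add: A_def)
    moreover have "0 \<le> r * l / \<mu>" "0 \<le> r * m / \<nu>" using r k mu nu by auto
    ultimately show "\<exists>s\<ge>0. \<exists>t\<ge>0. a = s *\<^sub>R edge_vector T e + t *\<^sub>R edge_vector T f" by blast
  next
    assume "\<exists>s\<ge>0. \<exists>t\<ge>0. a = s *\<^sub>R edge_vector T e + t *\<^sub>R edge_vector T f"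
    then obtain s t where st: "0 \<le> s" "0 \<le> t" "a = s *\<^sub>R edge_vector T e + t *\<^sub>R edge_vector T f"
        by blast
    \<comment> \<open>Dividing \<open>a\<close> by \<open>N\<close> moves it, in coordinates
      relative to \<open>A\<close>, onto the segment from \<open>B\<close> to \<open>C\<close> and
      so into the triangle.\<close>
    define N where "N = s * \<mu> + t * \<nu>"
    have a: "a = (s * \<mu>) *\<^sub>R (B - A) + (t * \<nu>) *\<^sub>R (C - A)" using st(3) mu nu by (simp add: A_def)
    have N0: "0 \<le> s * \<mu>" "0 \<le> t * \<nu>" using st mu nu by auto
    show "a \<in> sector M x T"
    proof (cases "N = 0")
      case True
      then have z: "s * \<mu> = 0" "t * \<nu> = 0" using add_nonneg_eq_0_iff[OF N0] unfolding N_def by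
          blast+
      have "a = 0 *\<^sub>R (chart M T x - chart M T x)" unfolding a z by simp
      then show ?thesis unfolding sector_def using star_triangle(2)[OF T] by blast
    next
      case False
      then have N: "0 < N" using N0 by (simp add: N_def)
      define l where "l = s * \<mu> / N"
      define m where "m = t * \<nu> / N"
      have lm: "0 \<le> l" "0 \<le> m" "l + m = 1" using N N0 by (auto simp: l_def m_def N_def
          add_divide_distrib[symmetric])
      have "l *\<^sub>R B + m *\<^sub>R C \<in> convex hull {A, B, C}"
        unfolding convex_hull_3 using lm by (intro CollectI exI[of _ 0] exI[of _ l] exI[of _ m])
            simp
      then obtain q where q: "q \<in> T" "chart M T q = l *\<^sub>R B + m *\<^sub>R C" using im by (force simp:
          A_def)
      have "l *\<^sub>R B + m *\<^sub>R C - A = l *\<^sub>R (B - A) + m *\<^sub>R (C - A)"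
      proof -
        have "A = l *\<^sub>R A + m *\<^sub>R A" using lm(3) by (metis scaleR_left_distrib scaleR_one)
        then show ?thesis by (simp add: algebra_simps)
      qed
      then have "N *\<^sub>R (chart M T q - A) = (N * l) *\<^sub>R (B - A) + (N * m) *\<^sub>R (C - A)" unfolding
          q(2) by (simp add: scaleR_add_right)
      also have "\<dots> = a" using N unfolding a l_def m_def by simp
      finally have "a = N *\<^sub>R (chart M T q - chart M T x)" by (simp add: A_def)
      then show ?thesis unfolding sector_def using q(1) N by (intro CollectI exI[of _ N] exI[of _
          q]) simp
    qed
  qed
  show ?thesis by (rule that[OF v ind sec])
qed

section \<open>Common edges of two triangles\<close>

lemma edge_vectors_parallel:
  assumes T: "T \<in> star M x" and ef: "e \<in> vedges T" "h \<in> vedges T" and par: "edge_vector T e = r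
      *\<^sub>R edge_vector T h"
  shows "e = h"
proof (rule ccontr)
  assume ne: "e \<noteq> h"
  obtain e1 e2 where E: "vedges T = {e1, e2}"
    "\<And>s t. s *\<^sub>R edge_vector T e1 + t *\<^sub>R edge_vector T e2 = 0 \<Longrightarrow> s = 0 \<and> t = 0"
    using edge_frame[OF T] by metis
  have "1 *\<^sub>R edge_vector T e + (- r) *\<^sub>R edge_vector T h = 0" using par by simp
  moreover have "(- r) *\<^sub>R edge_vector T h + 1 *\<^sub>R edge_vector T e = 0" using par by simp
  moreover have "e = e1 \<and> h = e2 \<or> e = e2 \<and> h = e1" using ef ne E(1) by auto
  ultimately show False using E(2)[of 1 "- r"] E(2)[of "- r" 1] by auto
qed

lemma edge_vector_nonzero: "T \<in> star M x \<Longrightarrow> e \<in> vedges T \<Longrightarrow> edge_vector T e \<noteq> 0"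
  unfolding edge_vector_def
  using chart_diff_nonzero[of T x "edge_point e"] star_triangle vedges_props(1,3,4) by (metis
      subsetD)

text \<open>The intersection contains \<open>edge_point e\<close> besides \<open>x\<close>, so it is
  an edge of both triangles. The vector of \<open>e\<close> is a multiple of its vector, and
  different edges at \<open>x\<close> have independent vectors.\<close>

lemma common_edge:
  assumes T: "T \<in> star M x" "T' \<in> star M x" "T \<noteq> T'" and e: "e \<in> vedges T" "e \<in> vedges T'"
  shows "T \<inter> T' = e" "T \<inter> T' \<in> tri_edges M T" "T \<inter> T' \<in> tri_edges M T'"
proof -
  note t = star_triangle[OF T(1)] and t' = star_triangle[OF T(2)]
  have p: "edge_point e \<in> T \<inter> T'" "edge_point e \<noteq> x"
    using vedges_props(1,3,4)[OF T(1) e(1)] vedges_props(1)[OF T(2) e(2)] by auto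
  then have "T \<inter> T' \<noteq> {x}" by blast
  then show te: "T \<inter> T' \<in> tri_edges M T" "T \<inter> T' \<in> tri_edges M T'"
    using intersection_cases[OF t(1) t'(1) T(3) t(2) t'(2)] by auto
  have h: "T \<inter> T' \<in> vedges T" using te t t' by (simp add: vedges_def)
  obtain r where "chart M T (edge_point e) - chart M T x = r *\<^sub>R edge_vector T (T \<inter> T')"
    using vedges_props(5)[OF T(1) h p(1)] by blast
  then have "edge_vector T e = r *\<^sub>R edge_vector T (T \<inter> T')" by (simp add: edge_vector_def)
  from edge_vectors_parallel[OF T(1) e(1) h this] show "T \<inter> T' = e" by (rule sym)
qed

text \<open>As the norms are not symmetric, the two signs of \<open>s\<close> are treated
  separately: they correspond to the two directions between \<open>x\<close> and
  \<open>edge_point e\<close>.\<close>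

lemma edge_vector_norm:
  assumes T: "T \<in> star M x" "T' \<in> star M x" and e: "e \<in> vedges T" "e \<in> vedges T'"
  shows "fnorm M T (s *\<^sub>R edge_vector T e) = fnorm M T' (s *\<^sub>R edge_vector T' e)"
proof (cases "T = T'")
  case False
  note t = star_triangle[OF T(1)] and t' = star_triangle[OF T(2)]
  note c = common_edge[OF T False e]
  have p: "x \<in> T \<inter> T'" "edge_point e \<in> T \<inter> T'" using vedges_props(2,3)[OF T(1) e(1)] c(1) by
      simp_all
  note el = edge_lengths[OF t(1) t'(1) False c(2,3)]
  interpret F: strict_normed "fnorm M T" using norm_strict[OF t(1)] by unfold_locales
  interpret F': strict_normed "fnorm M T'" using norm_strict[OF t'(1)] by unfold_locales
  have 1: "fnorm M T (edge_vector T e) = fnorm M T' (edge_vector T' e)"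
    using el[OF p] by (simp add: edge_vector_def)
  have 2: "fnorm M T (- edge_vector T e) = fnorm M T' (- edge_vector T' e)"
    using el[OF p(2,1)] by (simp add: edge_vector_def)
  show ?thesis
  proof (cases "0 \<le> s")
    case True then show ?thesis using 1 by (simp add: F.hom F'.hom)
  next
    case False
    then show ?thesis using 2 F.hom[of "- s" "- edge_vector T e"] F'.hom[of "- s" "- edge_vector
        T' e"] by simp
  qed
qed simp

text \<open>In each chart \<open>q\<close> is a nonnegative multiple of the edge vector away from
  \<open>x\<close>. The part of the edge from \<open>x\<close> to \<open>q\<close> has the same
  length in both metrics, so the multiples coincide.\<close>

lemma edge_ray:
  assumes T: "T \<in> star M x" "T' \<in> star M x" "T \<noteq> T'" and e: "e \<in> vedges T" "e \<in> vedges T'" and q: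
      "q \<in> e"
  shows "\<exists>r\<ge>0. chart M T q - chart M T x = r *\<^sub>R edge_vector T e \<and> chart M T' q - chart M T' x = r
      *\<^sub>R edge_vector T' e"
proof -
  note t = star_triangle[OF T(1)] and t' = star_triangle[OF T(2)]
  note c = common_edge[OF T e]
  obtain r where r: "r \<ge> 0" "chart M T q - chart M T x = r *\<^sub>R edge_vector T e"
    using vedges_props(5)[OF T(1) e(1) q] by blast
  obtain r' where r': "r' \<ge> 0" "chart M T' q - chart M T' x = r' *\<^sub>R edge_vector T' e"
    using vedges_props(5)[OF T(2) e(2) q] by blast
  interpret F: strict_normed "fnorm M T" using norm_strict[OF t(1)] by unfold_locales
  interpret F': strict_normed "fnorm M T'" using norm_strict[OF t'(1)] by unfold_locales
  have "r * fnorm M T (edge_vector T e) = r' * fnorm M T' (edge_vector T' e)"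
    using edge_lengths[OF t(1) t'(1) T(3) c(2,3), of x q] c(1) q vedges_props(2)[OF T(1) e(1)] r r'
    by (simp add: F.hom F'.hom)
  moreover have "fnorm M T (edge_vector T e) = fnorm M T' (edge_vector T' e)"
    using edge_vector_norm[OF T(1,2) e, of 1] by simp
  moreover have "fnorm M T' (edge_vector T' e) \<noteq> 0" using edge_vector_nonzero[OF T(2) e(2)]
      F'.zero_iff by simp
  ultimately have "r = r'" by simp
  then show ?thesis using r r' by blast
qed

text \<open>By \<open>edge_ray\<close> a point of a common edge is the same multiple of the edge
  vector in both charts. Conversely \<open>edge_point e\<close>, chosen independently of the
  triangle, realises the gluing of the edge vectors.\<close>

lemma glue_iff:
  "((T, a), (T', b)) \<in> glue M x \<longleftrightarrow> T \<in> star M x \<and> T' \<in> star M x \<and>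
     (T = T' \<and> a = b \<and> a \<in> sector M x T \<or> a = 0 \<and> b = 0 \<or>
      (\<exists>e\<in>vedges T \<inter> vedges T'. \<exists>s>0. a = s *\<^sub>R edge_vector T e \<and> b = s *\<^sub>R edge_vector T' e))"
  (is "?L \<longleftrightarrow> ?R")
proof
  assume ?L
  then obtain q r where T: "T \<in> star M x" "T' \<in> star M x" and q: "q \<in> T \<inter> T'" "0 \<le> r"
    and ab: "a = r *\<^sub>R (chart M T q - chart M T x)" "b = r *\<^sub>R (chart M T' q - chart M T' x)"
    by (auto simp: glue_def)
  show ?R
  proof (cases "T = T'")
    case True
    then have "a = b" "a \<in> sector M x T" using ab q by (auto simp: sector_def)
    then show ?thesis using T True by blast
  next
    case False
    note t = star_triangle[OF T(1)] and t' = star_triangle[OF T(2)]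
    from intersection_cases[OF t(1) t'(1) False t(2) t'(2)] show ?thesis
    proof
      assume e: "T \<inter> T' \<in> tri_edges M T \<and> T \<inter> T' \<in> tri_edges M T'"
      then have E: "T \<inter> T' \<in> vedges T" "T \<inter> T' \<in> vedges T'" using t t' by (auto simp: vedges_def)
      obtain s where s: "s \<ge> 0" "chart M T q - chart M T x = s *\<^sub>R edge_vector T (T \<inter> T')"
        "chart M T' q - chart M T' x = s *\<^sub>R edge_vector T' (T \<inter> T')"
        using edge_ray[OF T False E q(1)] by blast
      then have ab': "a = (r * s) *\<^sub>R edge_vector T (T \<inter> T')" "b = (r * s) *\<^sub>R edge_vector T' (T \<inter>
          T')" using ab by auto
      show ?thesis
      proof (cases "r * s = 0")
        case True then show ?thesis using ab' T by auto
      next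
        case False
        then have "0 < r * s" using s(1) q(2) by (simp add: less_le)
        then show ?thesis using ab' T E by blast
      qed
    next
      assume "x \<in> tri_vertices M T \<and> x \<in> tri_vertices M T' \<and> T \<inter> T' = {x}"
      then have "q = x" using q by blast
      then show ?thesis using ab T by auto
    qed
  qed
next
  assume R: ?R
  then have T: "T \<in> star M x" "T' \<in> star M x" by auto
  note t = star_triangle[OF T(1)] and t' = star_triangle[OF T(2)]
  have I: ?L if "q \<in> T \<inter> T'" "0 \<le> r" "a = r *\<^sub>R (chart M T q - chart M T x)" "b = r *\<^sub>R (chart M
      T' q - chart M T' x)" for q r
    unfolding glue_def using T that by blast
  from R consider "T = T'" "a = b" "a \<in> sector M x T" | "a = 0" "b = 0"
    | e s where "e \<in> vedges T" "e \<in> vedges T'" "0 < s" "a = s *\<^sub>R edge_vector T e" "b = s *\<^sub>R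
        edge_vector T' e" by blast
  then show ?L
  proof cases
    case 1
    then obtain r q where "0 \<le> r" "q \<in> T" "a = r *\<^sub>R (chart M T q - chart M T x)" by (auto simp:
        sector_def)
    then show ?thesis using I[of q r] 1 by simp
  next
    case 2
    then show ?thesis using I[of x 0] t t' by simp
  next
    case 3
    have "edge_point e \<in> T \<inter> T'" using vedges_props(1,3)[OF T(1) 3(1)] vedges_props(1)[OF T(2)
        3(2)] by blast
    then show ?thesis using I[of "edge_point e" s] 3 by (simp add: edge_vector_def)
  qed
qed

section \<open>Every edge at the vertex lies in two triangles\<close>

lemma triangle_closed:
  assumes "T \<in> triangles M"
  shows "closedin (surf M) T"
proof -
  obtain A B C where h: "homeomorphic_map (subtopology (surf M) T) (top_of_set (convex hull {A, B,
      C})) (chart M T)"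
    by (rule triangle_chart[OF assms])
  have "compact_space (top_of_set (convex hull {A, B, C}))"
    using finite_imp_compact_convex_hull[of "{A, B, C}"] by (simp add: compact_space_subtopology)
  then have "compact_space (subtopology (surf M) T)"
    using homeomorphic_compact_space[OF homeomorphic_map_imp_homeomorphic_space[OF h]] by simp
  moreover have "T \<subseteq> topspace (surf M)" using cover assms by blast
  ultimately have "compactin (surf M) T" by (simp add: compactin_subspace)
  then show ?thesis using topological compactin_imp_closedin unfolding topological_surface_def by
      blast
qed

text \<open>If \<open>p\<close> lay in no other triangle, a neighbourhood of \<open>p\<close> would be contained in \<open>T\<close>; by
  invariance of domain its image under the chart would be open.\<close>

lemma only_triangle_interior:
  assumes T: "T \<in> triangles M" and p: "p \<in> T" and only: "\<And>T'. T' \<in> triangles M \<Longrightarrow> p \<in> T' \<Longrightarrow> T' = T"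
  shows "chart M T p \<in> interior (chart M T ` T)"
proof -
  have px: "p \<in> topspace (surf M)" using cover T p by blast
  obtain U0 where U0: "openin (surf M) U0" "p \<in> U0" "finite {T' \<in> triangles M. T' \<inter> U0 \<noteq> {}}"
    using locally_finite[OF px] by (elim exE conjE)
  \<comment> \<open>By local finiteness only finitely many closed triangles have to be removed from
    a neighbourhood of \<open>p\<close> to leave an open set inside \<open>T\<close>.\<close>
  define Ts where "Ts = {T' \<in> triangles M. T' \<inter> U0 \<noteq> {}} - {T}"
  define U1 where "U1 = U0 - \<Union>Ts"
  have "closedin (surf M) (\<Union>Ts)"
    using U0(3) triangle_closed by (intro closedin_Union) (auto simp: Ts_def)
  then have U1: "openin (surf M) U1" unfolding U1_def using U0(1) by (rule openin_diff[rotated])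
  have pU1: "p \<in> U1" using U0(2) only unfolding U1_def Ts_def by blast
  have U1T: "U1 \<subseteq> T"
  proof
    fix y assume y: "y \<in> U1"
    then have "y \<in> topspace (surf M)" using openin_subset[OF U1] by blast
    then obtain T' where "T' \<in> triangles M" "y \<in> T'" using cover by blast
    then show "y \<in> T" using y unfolding U1_def Ts_def by blast
  qed
  obtain U V where U: "openin (surf M) U" "p \<in> U" and V: "open (V :: (real^2) set)"
    and hom: "subtopology (surf M) U homeomorphic_space top_of_set V"
    using topological px unfolding topological_surface_def by metis
  obtain f g where fg: "homeomorphic_maps (subtopology (surf M) U) (top_of_set V) f g"
    using hom by (auto simp: homeomorphic_space_def)
  have Usub: "U \<subseteq> topspace (surf M)" by (rule openin_subset[OF U(1)])
  have f: "f p \<in> V" "g (f p) = p" and g: "continuous_map (top_of_set V) (subtopology (surf M) U) g"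
    and fgv: "\<And>v. v \<in> V \<Longrightarrow> f (g v) = v"
  proof -
    have cf: "continuous_map (subtopology (surf M) U) (top_of_set V) f" using fg by (simp add:
        homeomorphic_maps_def)
    have pU: "p \<in> topspace (subtopology (surf M) U)" using U(2) Usub by auto
    show "f p \<in> V" using continuous_map_image_subset_topspace[OF cf] pU by auto
    show "g (f p) = p" using fg pU by (simp add: homeomorphic_maps_def)
    show "continuous_map (top_of_set V) (subtopology (surf M) U) g" using fg by (simp add:
        homeomorphic_maps_def)
    show "\<And>v. v \<in> V \<Longrightarrow> f (g v) = v" using fg by (simp add: homeomorphic_maps_def)
  qed
  \<comment> \<open>On this open planar set \<open>chart M T \<circ> g\<close> is continuous,
    injective and plane-valued, as invariance of domain requires.\<close>
  define V1 where "V1 = {v \<in> V. g v \<in> U1}"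
  have gs: "continuous_map (top_of_set V) (surf M) g" using g continuous_map_into_fulltopology by
      blast
  have "openin (top_of_set V) V1"
    using openin_continuous_map_preimage[OF gs U1] by (simp add: V1_def)
  then have V1: "open V1" using V openin_open_eq by blast
  have gT: "g ` V1 \<subseteq> T" using U1T by (auto simp: V1_def)
  obtain A B C where inj: "inj_on (chart M T) T" 
    and h: "homeomorphic_map (subtopology (surf M) T) (top_of_set (convex hull {A, B, C})) (chart
        M T)"
    by (rule triangle_chart[OF T])
  have "continuous_map (subtopology (top_of_set V) V1) (surf M) g" by (rule
      continuous_map_from_subtopology[OF gs])
  then have "continuous_map (top_of_set V1) (surf M) g"
    by (simp add: subtopology_subtopology V1_def Int_def conj_commute)
  then have "continuous_map (top_of_set V1) (subtopology (surf M) T) g"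
    using gT by (simp add: continuous_map_in_subtopology image_subset_iff_funcset)
  then have "continuous_map (top_of_set V1) (top_of_set (convex hull {A, B, C})) (chart M T \<circ> g)"
    by (rule continuous_map_compose) (rule homeomorphic_imp_continuous_map[OF h])
  then have cont: "continuous_on V1 (chart M T \<circ> g)" by (simp add: continuous_map_in_subtopology)
  have injV: "inj_on (chart M T \<circ> g) V1"
  proof (rule inj_onI)
    fix v w assume vw: "v \<in> V1" "w \<in> V1" "(chart M T \<circ> g) v = (chart M T \<circ> g) w"
    then have "g v = g w" using inj gT by (auto simp: inj_on_def)
    then show "v = w" using fgv vw unfolding V1_def by (metis (no_types, lifting) mem_Collect_eq)
  qed
  have "open ((chart M T \<circ> g) ` V1)" by (rule invariance_of_domain[OF cont V1 injV])
  moreover have "chart M T p \<in> (chart M T \<circ> g) ` V1" using f pU1 by (force simp: V1_def)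
  moreover have "(chart M T \<circ> g) ` V1 \<subseteq> chart M T ` T" using gT by auto
  ultimately show ?thesis by (rule interiorI)
qed

text \<open>The midpoint of the edge is a boundary point of the triangle, so by
  \<open>only_triangle_interior\<close> it lies in a second one. It is not a vertex, so the two
  triangles meet in a whole edge, and \<open>e\<close> is the only edge of \<open>T\<close> through
  the midpoint.\<close>

lemma edge_in_two_triangles:
  assumes T: "T \<in> star M x" and e: "e \<in> vedges T"
  shows "\<exists>T'\<in>star M x. T' \<noteq> T \<and> e \<in> vedges T'"
proof -
  note t = star_triangle[OF T]
  \<comment> \<open>The two edges at \<open>x\<close> are interchangeable, so \<open>B\<close> may
    denote the other end of \<open>e\<close>.\<close>
  have "\<exists>B C. \<not> collinear {chart M T x, B, C} \<and> chart M T ` T = convex hull {chart M T x, B, C} \<and>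
      e \<subseteq> T \<and> chart M T ` e = closed_segment (chart M T x) B"
  proof -
    obtain B C e1 e2 \<mu> \<nu> where s: "\<not> collinear {chart M T x, B, C}" "chart M T ` T = convex hull
        {chart M T x, B, C}"
      "vedges T = {e1, e2}" "e1 \<subseteq> T" "e2 \<subseteq> T"
      "chart M T ` e1 = closed_segment (chart M T x) B" "chart M T ` e2 = closed_segment (chart M
          T x) C"
      by (rule star_structure[OF T])
    have "{chart M T x, C, B} = {chart M T x, B, C}" by auto
    then have "\<not> collinear {chart M T x, C, B}" "chart M T ` T = convex hull {chart M T x, C, B}"
        using s by simp_all
    note swapped = this
    have "e = e1 \<or> e = e2" using e s(3) by simp
    then show ?thesis
    proof
      assume "e = e1"
      then show ?thesis using s by (intro exI[of _ B] exI[of _ C]) simp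
    next
      assume "e = e2"
      then show ?thesis using s swapped by (intro exI[of _ C] exI[of _ B]) simp
    qed
  qed
  then obtain B C where nc: "\<not> collinear {chart M T x, B, C}" and im: "chart M T ` T = convex hull
      {chart M T x, B, C}"
    and eT: "e \<subseteq> T" "chart M T ` e = closed_segment (chart M T x) B" by blast
  define A where "A = chart M T x"
  note ind = noncollinear_independent[OF nc, folded A_def]
  define P where "P = (1/2) *\<^sub>R A + (1/2) *\<^sub>R B"
  have "P \<in> chart M T ` e" unfolding eT(2) closed_segment_def P_def A_def
    by (intro CollectI exI[of _ "1/2"]) simp
  then obtain p where p: "p \<in> e" "chart M T p = P" by blast
  have pT: "p \<in> T" using p eT by blast
  have coef: "b \<ge> 0 \<and> d \<ge> 0" if "A + b *\<^sub>R (B - A) + d *\<^sub>R (C - A) \<in> convex hull {A, B, C}" for b d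
  proof -
    have "\<exists>k l m. A + b *\<^sub>R (B - A) + d *\<^sub>R (C - A) = k *\<^sub>R A + l *\<^sub>R B + m *\<^sub>R C \<and> 0 \<le> k \<and> 0 \<le> l
        \<and> 0 \<le> m \<and> k + l + m = 1"
      using that unfolding convex_hull_3 by (rule CollectD)
    then obtain k l m where k: "0 \<le> l" "0 \<le> m" "k + l + m = 1" "A + b *\<^sub>R (B - A) + d *\<^sub>R (C - A)
        = k *\<^sub>R A + l *\<^sub>R B + m *\<^sub>R C"
      by metis
    have kk: "k = 1 - l - m" using k(3) by simp
    have "(b - l) *\<^sub>R (B - A) + (d - m) *\<^sub>R (C - A) = 0"
    proof -
      have "(b - l) *\<^sub>R (B - A) + (d - m) *\<^sub>R (C - A)
        = (A + b *\<^sub>R (B - A) + d *\<^sub>R (C - A)) - (A + l *\<^sub>R (B - A) + m *\<^sub>R (C - A))" by (simp add: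
            algebra_simps)
      also have "A + l *\<^sub>R (B - A) + m *\<^sub>R (C - A) = k *\<^sub>R A + l *\<^sub>R B + m *\<^sub>R C" unfolding kk by
          (simp add: algebra_simps)
      finally show ?thesis using k(4) by simp
    qed
    from ind[OF this] show ?thesis using k(1,2) by simp
  qed
  have P': "P = A + (1/2) *\<^sub>R (B - A)" by (simp add: P_def vec_eq_iff field_simps)
  have notint: "P \<notin> interior (chart M T ` T)"
  proof
    assume "P \<in> interior (chart M T ` T)"
    then obtain \<delta> where d: "\<delta> > 0" "ball P \<delta> \<subseteq> convex hull {A, B, C}" by (auto simp: mem_interior
        im A_def)
    define N where "N = norm (C - A) + 1"
    have N: "N > 0" by (simp add: N_def add_nonneg_pos)
    \<comment> \<open>A step of this size stays in the ball around \<open>P\<close>, but in the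
      direction opposite to \<open>C - A\<close> it leaves the triangle, because the coefficient of
      \<open>C - A\<close> becomes negative.\<close>
    define k where "k = \<delta> / (2 * N)"
    have k: "k > 0" using d(1) N by (simp add: k_def)
    have "k * norm (C - A) < \<delta>"
    proof -
      have "k * norm (C - A) \<le> k * N" using k by (intro mult_left_mono) (auto simp: N_def)
      also have "\<dots> = \<delta> / 2" using N by (simp add: k_def)
      finally show ?thesis using d(1) by simp
    qed
    then have "P + (- k) *\<^sub>R (C - A) \<in> ball P \<delta>" using k by (simp add: dist_norm)
    then have "A + (1/2) *\<^sub>R (B - A) + (- k) *\<^sub>R (C - A) \<in> convex hull {A, B, C}" using d(2)
        unfolding P' by blast
    from coef[OF this] show False using k by simp
  qed
  obtain T' where T': "T' \<in> triangles M" "p \<in> T'" "T' \<noteq> T"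
    using only_triangle_interior[OF t(1) pT] notint p(2) by metis
  have pv: "p \<notin> tri_vertices M T"
  proof
    assume "p \<in> tri_vertices M T"
    then have "P \<in> {A, B, C}" using vertex_iff[OF nc im pT] p(2) by (simp add: A_def)
    moreover have "(1/2) *\<^sub>R (B - A) + 0 *\<^sub>R (C - A) = P - A" "(-1/2) *\<^sub>R (B - A) + 0 *\<^sub>R (C - A)
        = P - B"
      "(1/2) *\<^sub>R (B - A) + (-1) *\<^sub>R (C - A) = P - C"
      unfolding P' by (simp_all add: vec_eq_iff field_simps)
    moreover have "P - A \<noteq> 0" "P - B \<noteq> 0" "P - C \<noteq> 0"
      unfolding calculation(2-4)[symmetric] using ind by fastforce+
    ultimately show False by auto
  qed
  then have e': "T \<inter> T' \<in> tri_edges M T" "T \<inter> T' \<in> tri_edges M T'"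
    using intersection_cases[OF t(1) T'(1) T'(3)[symmetric] pT T'(2)] by auto
  obtain R Q where RQ: "R \<in> {A, B, C}" "Q \<in> {A, B, C}" "R \<noteq> Q" "chart M T ` (T \<inter> T') =
      closed_segment R Q"
    using e'(1) edge_of_iff[OF nc im, of "T \<inter> T'"] by (auto simp: A_def)
  have PRQ: "P \<in> closed_segment R Q" unfolding RQ(4)[symmetric] p(2)[symmetric] using pT T'(2) by
      blast
  have nAC: "P \<notin> closed_segment A C"
  proof
    assume "P \<in> closed_segment A C"
    then obtain s where "P = (1 - s) *\<^sub>R A + s *\<^sub>R C" by (auto simp: closed_segment_def)
    then have "(1/2) *\<^sub>R (B - A) + (- s) *\<^sub>R (C - A) = 0" unfolding P' by (simp add: algebra_simps)
    from ind[OF this] show False by simp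
  qed
  have nBC: "P \<notin> closed_segment B C"
  proof
    assume "P \<in> closed_segment B C"
    then obtain s where s: "P = (1 - s) *\<^sub>R B + s *\<^sub>R C" by (auto simp: closed_segment_def)
    have "(1/2 - (1 - s)) *\<^sub>R (B - A) + (- s) *\<^sub>R (C - A) = P - ((1 - s) *\<^sub>R B + s *\<^sub>R C)"
      unfolding P' by (simp add: vec_eq_iff) (simp add: field_simps)
    then have "(1/2 - (1 - s)) *\<^sub>R (B - A) + (- s) *\<^sub>R (C - A) = 0" using s by simp
    from ind[OF this] show False by auto
  qed
  have "closed_segment R Q = closed_segment A B"
    using RQ(1-3) PRQ nAC nBC closed_segment_commute by (metis insertE singletonD)
  then have "chart M T ` (T \<inter> T') = chart M T ` e" using RQ(4) eT(2) by (simp add: A_def)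
  then have "T \<inter> T' = e" using inj_on_image_eq_iff[OF chart_inj[OF t(1)] _ eT(1)] by blast
  moreover have "x \<in> e" by (rule vedges_props(2)[OF T e])
  ultimately have "T' \<in> star M x" "e \<in> vedges T'" using T'(1) e' by (auto simp: star_def vedges_def)
  then show ?thesis using T'(3) by blast
qed

lemma star_finite: "finite (star M x)"
proof -
  obtain T0 where "T0 \<in> triangles M" "x \<in> T0" using vertex by (auto simp: pf_vertices_def
      tri_vertices_def)
  then have "x \<in> topspace (surf M)" using cover by blast
  then obtain U where "x \<in> U" "finite {T \<in> triangles M. T \<inter> U \<noteq> {}}" using locally_finite by blast
  then show ?thesis by (elim finite_subset[rotated]) (auto simp: star_def)
qed

lemma cone_structure_exists: "\<exists>co. cone_structure M x vedges edge_vector co"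
proof -
  define Q where "Q T K \<longleftrightarrow> (\<forall>e\<in>vedges T. linear (K e)) \<and>
      (\<forall>e\<in>vedges T. \<forall>f\<in>vedges T. K e (edge_vector T f) = (if e = f then 1 else 0)) \<and>
      (\<forall>a. (\<Sum>e\<in>vedges T. K e a *\<^sub>R edge_vector T e) = a) \<and>
      sector M x T = {a. \<forall>e\<in>vedges T. 0 \<le> K e a}" for T and K :: "'a set \<Rightarrow> real^2 \<Rightarrow> real"
  have "\<exists>K. Q T K" if T: "T \<in> star M x" for T
  proof -
    obtain e f where ef: "vedges T = {e, f}" "e \<noteq> f"
      and ind: "\<And>s t. s *\<^sub>R edge_vector T e + t *\<^sub>R edge_vector T f = 0 \<Longrightarrow> s = 0 \<and> t = 0"
      and sec: "\<And>a. a \<in> sector M x T \<longleftrightarrow> (\<exists>s\<ge>0. \<exists>t\<ge>0. a = s *\<^sub>R edge_vector T e + t *\<^sub>R edge_vector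
          T f)"
      by (rule edge_frame[OF T]) (rule that)
    obtain g h :: "real^2 \<Rightarrow> real" where gh: "linear g" "linear h" "g (edge_vector T e) = 1" "g
        (edge_vector T f) = 0"
      "h (edge_vector T e) = 0" "h (edge_vector T f) = 1" "\<forall>a. g a *\<^sub>R edge_vector T e + h a *\<^sub>R
          edge_vector T f = a"
      using plane_coordinates[of "edge_vector T e" "edge_vector T f"] ind by metis
    define K where "K e' = (if e' = e then g else h)" for e'
    have "a \<in> sector M x T \<longleftrightarrow> 0 \<le> g a \<and> 0 \<le> h a" for a
    proof
      assume "a \<in> sector M x T"
      then obtain s t where "0 \<le> s" "0 \<le> t" "a = s *\<^sub>R edge_vector T e + t *\<^sub>R edge_vector T f"
          using sec by blast
      then show "0 \<le> g a \<and> 0 \<le> h a" using gh by (simp add: linear_add linear_scale)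
    next
      assume "0 \<le> g a \<and> 0 \<le> h a"
      then show "a \<in> sector M x T" using sec[of a] gh(7)[rule_format, of a] by metis
    qed
    then have "Q T K" using gh ef unfolding Q_def by (auto simp: K_def)
    then show ?thesis by (rule exI[of "Q T"])
  qed
  then obtain co where co: "\<forall>T\<in>star M x. Q T (co T)" using bchoice[of "star M x" Q] by blast
  have "cone_structure M x vedges edge_vector co"
  proof (rule cone_structure.intro, goal_cases)
    case 1 show ?case by (rule star_finite)
  next
    case (2 T) then show ?case using norm_strict star_triangle by blast
  next
    case (3 T)
    then obtain e f where "vedges T = {e, f}" "e \<noteq> f" using edge_frame by metis
    then show ?case by simp
  next
    case (4 T e) then show ?case using co unfolding Q_def by blast
  next
    case (5 T e f) then show ?case using co unfolding Q_def by blast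
  next
    case (6 T a) then show ?case using co unfolding Q_def by blast
  next
    case (7 T) then show ?case using co unfolding Q_def by blast
  next
    case (8 T a T' b) show ?case by (rule glue_iff)
  next
    case (9 T T' e s) then show ?case by (rule edge_vector_norm)
  next
    case (10 T e) then show ?case by (rule edge_in_two_triangles)
  next
    case (11 T T' e f)
    then show ?case using common_edge(1)[of T T' e] common_edge(1)[of T T' f] by blast
  qed
  then show ?thesis by blast
qed

end

subsection \<open>The classification\<close>

context maximal_cone_geodesic
begin

text \<open>A sector contains no complete line: each coordinate would be affine and nonnegative at
  all times, hence constant, so the velocity would be zero.\<close>

lemma line_meets_edge:
  assumes l: "line c UNIV T \<alpha> v" and D: "D = UNIV"
  shows False
proof -
  have l1: "line c {0..1} T \<alpha> v" by (rule line_subset[OF l]) simp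
  have "(0::real) < 1" "{0..1} \<subseteq> D" using D by simp_all
  note n = line_norm[OF l1 this]
  have "co T e v = co T e 0" if e: "e \<in> Ed T" for e
  proof (rule ccontr)
    assume "co T e v \<noteq> co T e 0"
    then have ne: "co T e v \<noteq> 0" using co_simps(1)[OF n(3) e] by simp
    define t where "t = (- co T e \<alpha> - 1) / co T e v"
    have "co T e (\<alpha> + t *\<^sub>R v) = co T e \<alpha> + t * co T e v" using co_simps[OF n(3) e] by simp
    also have "\<dots> = -1" using ne by (simp add: t_def)
    finally show False using coordD(2)[OF lineD[OF l UNIV_I[of t]]] in_sector[OF n(3)] e by force
  qed
  then have "v = 0" by (rule co_eqI[OF n(3)])
  then show False using n(2) by simp
qed

text \<open>The crossing times are finite in number, and at least one exists because a sector
  contains no complete line. Between consecutive ones the geodesic is inner and therefore a single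
  line in one cone.\<close>

lemma crossing_geodesic:
  assumes na: "\<And>t. t \<in> D \<Longrightarrow> c t \<noteq> apex M x"
  shows "D = UNIV \<and> (\<forall>t. c t \<noteq> apex M x) \<and>
      (\<exists>(m::nat) (C :: nat \<Rightarrow> 'a set) (s :: nat \<Rightarrow> real) (v :: nat \<Rightarrow> real^2).
         1 \<le> m \<and> consecutive_cones M x m C \<and>
         (\<forall>i\<in>{1..m}. c (s i) \<noteq> apex M x \<and>
            c (s i) \<in> mcone M x (C (i - 1)) \<inter> mcone M x (C i)) \<and>
         straight_on M x c {..s 1} (C 0) (v 0) \<and> \<not> in_edge M x (c ` {..s 1}) \<and>
         (\<forall>i\<in>{1..<m}. s i < s (i + 1) \<and>
            straight_on M x c {s i..s (i + 1)} (C i) (v i) \<and>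
            \<not> in_edge M x (c ` {s i..s (i + 1)})) \<and>
         straight_on M x c {s m..} (C m) (v m) \<and> \<not> in_edge M x (c ` {s m..}))"
proof -
  have D: "D = UNIV" by (rule unbounded(1)) (rule na)
  have naU: "c t \<noteq> apex M x" for t using na D by simp
  have nr: "\<alpha> + r *\<^sub>R v \<noteq> 0" if "a < b" "line c {a..b} T \<alpha> v" for a b T \<alpha> v r
    by (rule nonradial[OF na that(1) _ that(2)]) (simp_all add: D)
  define Z where "Z = {t. \<not> inner (c t)}"
  have finZ: "finite Z" unfolding Z_def by (rule unbounded(2)) (rule na)
  have neZ: "Z \<noteq> {}"
  proof
    assume "Z = {}"
    then have inn: "inner (c t)" for t by (auto simp: Z_def)
    have "\<exists>T \<alpha> v. line c UNIV T \<alpha> v"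
      by (rule interval_line[of UNIV 0 1]) (use D inn in auto)
    then show False using line_meets_edge D by blast
  qed
  define xs where "xs = sorted_list_of_set Z"
  define m where "m = length xs"
  \<comment> \<open>Crossings are numbered from 1, list positions from 0; the index 0 is kept for
    the incoming ray.\<close>
  define s where "s i = xs ! (i - 1)" for i
  have setxs: "set xs = Z" using finZ by (simp add: xs_def)
  have m1: "1 \<le> m" using neZ setxs by (cases xs) (auto simp: m_def)
  have smono: "s i < s j" if "1 \<le> i" "i < j" "j \<le> m" for i j
  proof -
    have "sorted_wrt (<) xs" by (simp add: xs_def)
    then show ?thesis unfolding s_def by (rule sorted_wrt_nth_less) (use that in \<open>auto simp: m_def\<close>)
  qed
  have sZ: "\<not> inner (c (s i))" if "i \<in> {1..m}" for i
  proof -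
    have "s i \<in> set xs" unfolding s_def using that by (intro nth_mem) (auto simp: m_def)
    then show ?thesis by (simp add: setxs Z_def)
  qed
  have Zs: "\<exists>j\<in>{1..m}. t = s j" if "\<not> inner (c t)" for t
  proof -
    have "t \<in> set xs" using that by (simp add: setxs Z_def)
    then obtain k where "k < m" "xs ! k = t" by (auto simp: in_set_conv_nth m_def)
    then show ?thesis by (intro bexI[of _ "Suc k"]) (auto simp: s_def)
  qed
  \<comment> \<open>The time interval of the piece with index \<open>i\<close>, unbounded to the
    left for \<open>i = 0\<close> and to the right for \<open>i = m\<close>.\<close>
  define J where "J i = {t. (1 \<le> i \<longrightarrow> s i \<le> t) \<and> (i < m \<longrightarrow> t \<le> s (i + 1))}" for i
  \<comment> \<open>\<open>p i\<close> and \<open>q i\<close> are two times in \<open>J i\<close>: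
    its ends, or times at distance 1 from the crossing where \<open>J i\<close> is
    unbounded.\<close>
  define p where "p i = (if i = 0 then s 1 - 1 else s i)" for i
  define q where "q i = (if i < m then s (i + 1) else s m + 1)" for i
  have pq: "p i < q i" "p i \<in> J i" "q i \<in> J i" if "i \<le> m" for i
  proof -
    have 1: "s i < s (i + 1)" if "1 \<le> i" "i < m" using smono[of i "i + 1"] that by simp
    show "p i < q i" using 1 m1 that by (auto simp: p_def q_def)
    show "p i \<in> J i" using 1 m1 that by (auto simp: p_def J_def)
    show "q i \<in> J i" using 1 m1 that by (auto simp: q_def J_def)
  qed
  have Jint: "is_interval (J i)" for i unfolding J_def is_interval_1 by auto
  have Jinner: "inner (c t)" if i: "i \<le> m" and t: "a \<in> J i" "b \<in> J i" "a < t" "t < b" for i a b t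
  proof (rule ccontr)
    assume "\<not> inner (c t)"
    from Zs[OF this] obtain j where j: "1 \<le> j" "j \<le> m" "t = s j" by auto
    show False
    proof (cases "j \<le> i")
      case True
      then have "s j \<le> s i" using smono[of j i] j i by (cases "j = i") auto
      then show False using t j True by (simp add: J_def)
    next
      case False
      then have "s (i + 1) \<le> s j" using smono[of "i + 1" j] j by (cases "j = i + 1") auto
      then show False using t j False by (simp add: J_def)
    qed
  qed
  have "\<forall>i. \<exists>T \<alpha> v. i \<le> m \<longrightarrow> line c (J i) T \<alpha> v"
  proof
    fix i
    show "\<exists>T \<alpha> v. i \<le> m \<longrightarrow> line c (J i) T \<alpha> v"
    proof (cases "i \<le> m")
      case True
      have "\<exists>T \<alpha> v. line c (J i) T \<alpha> v"
        by (rule interval_line[OF Jint _ pq(2)[OF True] pq(3)[OF True] pq(1)[OF True]])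
           (use D Jinner[OF True] in auto)
      then show ?thesis by blast
    qed simp
  qed
  then obtain C \<alpha> v where l: "\<And>i. i \<le> m \<Longrightarrow> line c (J i) (C i) (\<alpha> i) (v i)" by metis
  have lpq: "line c {p i..q i} (C i) (\<alpha> i) (v i)" if "i \<le> m" for i
    by (rule line_subset[OF l[OF that] is_interval_subset[OF Jint pq(2,3)[OF that]]])
  have n: "v i \<noteq> 0" "C i \<in> star M x" if "i \<le> m" for i
    using line_norm[OF lpq[OF that] pq(1)[OF that]] D by simp_all
  have nri: "\<alpha> i + r *\<^sub>R v i \<noteq> 0" if "i \<le> m" for i r by (rule nr[OF pq(1) lpq]) (use that in
      simp_all)
  have st: "straight_on M x c (J i) (C i) (v i)" if "i \<le> m" for i
    unfolding straight_on_iff using l n that by blast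
  have ie: "\<not> in_edge M x (c ` J i)" if "i \<le> m" for i
  proof (rule inner_not_in_edge)
    have t: "p i < (p i + q i) / 2" "(p i + q i) / 2 < q i" using pq(1)[OF that] by simp_all
    show "inner (c ((p i + q i) / 2))" by (rule Jinner[OF that pq(2,3)[OF that] t])
    have "(p i + q i) / 2 \<in> J i" using is_interval_subset[OF Jint pq(2,3)[OF that]] t by auto
    then show "c ((p i + q i) / 2) \<in> c ` J i" by blast
  qed
  have J0: "J 0 = {..s 1}" and Jm: "J m = {s m..}" and Ji: "\<And>i. i \<in> {1..<m} \<Longrightarrow> J i = {s i..s (i +
      1)}"
    using m1 by (auto simp: J_def)
  have ends: "p i = s i" "q (i - 1) = s i" if "i \<in> {1..m}" for i
    using that by (auto simp: p_def q_def)
  have cL: "coord (c (s i)) (C (i - 1)) (\<alpha> (i - 1) + s i *\<^sub>R v (i - 1))"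
    and cR: "coord (c (s i)) (C i) (\<alpha> i + s i *\<^sub>R v i)" if "i \<in> {1..m}" for i
  proof -
    have i: "i - 1 \<le> m" "i \<le> m" using that by auto
    show "coord (c (s i)) (C (i - 1)) (\<alpha> (i - 1) + s i *\<^sub>R v (i - 1))"
      using lineD[OF l[OF i(1)] pq(3)[OF i(1)]] ends[OF that] by simp
    show "coord (c (s i)) (C i) (\<alpha> i + s i *\<^sub>R v i)"
      using lineD[OF l[OF i(2)] pq(2)[OF i(2)]] ends[OF that] by simp
  qed
  have mc: "c (s i) \<in> mcone M x (C (i - 1)) \<inter> mcone M x (C i)" if "i \<in> {1..m}" for i
    using cL[OF that] cR[OF that] mcone_iff by blast
  have dist: "C (i - 1) \<noteq> C i" if i: "i \<in> {1..m}" for i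
  proof -
    have im: "i - 1 \<le> m" "i \<le> m" using i by auto
    have L: "line c {p (i - 1)..s i} (C (i - 1)) (\<alpha> (i - 1)) (v (i - 1))" "p (i - 1) < s i"
      using lpq[OF im(1)] pq(1)[OF im(1)] ends[OF i] by simp_all
    have R: "line c {s i..q i} (C i) (\<alpha> i) (v i)" "s i < q i"
      using lpq[OF im(2)] pq(1)[OF im(2)] ends[OF i] by simp_all
    show ?thesis
      by (rule crossing_distinct[OF L(1) R(1) L(2) R(2) _ nri[OF im(1)] sZ[OF i] naU]) (simp add: D)
  qed
  have ce: "mcone M x (C (i - 1)) \<inter> mcone M x (C i) \<in> cone_edges M x" if i: "i \<in> {1..m}" for i
  proof -
    have "C (i - 1) \<in> star M x" "C i \<in> star M x" using n(2) i by auto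
    moreover have "mcone M x (C (i - 1)) \<inter> mcone M x (C i) \<noteq> {apex M x}" using mc[OF i] naU by blast
    ultimately show ?thesis unfolding cone_edges_def using dist[OF i] by blast
  qed
  \<comment> \<open>If a cone were entered and left through the same edge, both ends of the segment
    would lie on one ray, and the segment would be radial.\<close>
  have diff: "mcone M x (C (i - 1)) \<inter> mcone M x (C i) \<noteq> mcone M x (C i) \<inter> mcone M x (C (i + 1))"
    if i: "i \<in> {1..<m}" for i
  proof
    assume eq: "mcone M x (C (i - 1)) \<inter> mcone M x (C i) = mcone M x (C i) \<inter> mcone M x (C (i + 1))"
    have i1: "i \<in> {1..m}" "i + 1 \<in> {1..m}" "i \<le> m" using i by auto
    have "c (s (i + 1)) \<in> mcone M x (C (i - 1)) \<inter> mcone M x (C i)" unfolding eq using mc[OF i1(2)]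
        by simp
    then obtain a where a: "coord (c (s (i + 1))) (C (i - 1)) a" using mcone_iff by blast
    have b: "coord (c (s (i + 1))) (C i) (\<alpha> i + s (i + 1) *\<^sub>R v i)" using cL[OF i1(2)] by simp
    have ne: "C i \<noteq> C (i - 1)" using dist[OF i1(1)] by simp
    obtain e r where e: "e \<in> Ed (C i)" "e \<in> Ed (C (i - 1))" "\<alpha> i + s (i + 1) *\<^sub>R v i = r *\<^sub>R u (C
        i) e"
      using coord_cases[OF b a ne] nri[OF i1(3)] by blast
    obtain f r' where f: "f \<in> Ed (C i)" "f \<in> Ed (C (i - 1))" "\<alpha> i + s i *\<^sub>R v i = r' *\<^sub>R u (C i) f"
      using coord_cases[OF cR[OF i1(1)] cL[OF i1(1)] ne] nri[OF i1(3)] by blast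
    have S: "C i \<in> star M x" "C (i - 1) \<in> star M x" using n(2) i by auto
    have "e = f" by (rule edge_unique[OF S ne e(1,2) f(1,2)])
    define h where "h = s (i + 1) - s i"
    have h: "h > 0" unfolding h_def using smono[of i "i + 1"] i by simp
    have "h *\<^sub>R v i = (\<alpha> i + s (i + 1) *\<^sub>R v i) - (\<alpha> i + s i *\<^sub>R v i)" by (simp add: h_def
        algebra_simps)
    also have "\<dots> = (r - r') *\<^sub>R u (C i) f" unfolding e(3) f(3) \<open>e = f\<close> by (simp add: algebra_simps)
    finally have "(1 / h) *\<^sub>R (h *\<^sub>R v i) = (1 / h) *\<^sub>R ((r - r') *\<^sub>R u (C i) f)" by simp
    then have "v i = ((r - r') / h) *\<^sub>R u (C i) f" using h by simp
    from parallel_radial[OF n(1)[OF i1(3)] this f(3)] show False using nri[OF i1(3)] by blast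
  qed
  have cc: "consecutive_cones M x m C"
    unfolding consecutive_cones_def using n(2) dist ce diff by blast
  have mid: "s i < s (i + 1) \<and> straight_on M x c {s i..s (i + 1)} (C i) (v i) \<and> \<not> in_edge M x (c `
      {s i..s (i + 1)})"
    if "i \<in> {1..<m}" for i
    using smono[of i "i + 1"] st[of i] ie[of i] Ji[OF that] that by auto
  have first: "straight_on M x c {..s 1} (C 0) (v 0)" "\<not> in_edge M x (c ` {..s 1})"
    using st[of 0] ie[of 0] J0 by simp_all
  have last: "straight_on M x c {s m..} (C m) (v m)" "\<not> in_edge M x (c ` {s m..})"
    using st[of m] ie[of m] Jm by simp_all
  show ?thesis
    by (intro conjI D allI naU exI[of _ m] exI[of _ C] exI[of _ s] exI[of _ v] m1 cc ballI mc
        first mid last)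
qed

lemma apex_geodesic:
  assumes t0: "t0 \<in> D" "c t0 = apex M x"
  shows "(\<exists>t0 T v. c t0 = apex M x \<and>
          (D = {..t0} \<and> straight_on M x c {..t0} T v \<or>
           D = {t0..} \<and> straight_on M x c {t0..} T v))
     \<or> (D = UNIV \<and> (\<exists>t0 T\<^sub>1 v\<^sub>1 T\<^sub>2 v\<^sub>2. c t0 = apex M x \<and>
          straight_on M x c {..t0} T\<^sub>1 v\<^sub>1 \<and> straight_on M x c {t0..} T\<^sub>2 v\<^sub>2))"
proof (cases "\<exists>t\<in>D. t0 < t")
  case right: True
  then obtain t where "t \<in> D" "t0 < t" by blast
  note r = forward_from_apex[OF t0 this]
  show ?thesis
  proof (cases "\<exists>t\<in>D. t < t0")
    case True
    then obtain t' where "t' \<in> D" "t' < t0" by blast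
    note l = backward_to_apex[OF t0 this]
    have "D = UNIV"
    proof (intro equalityI subsetI UNIV_I)
      fix w :: real
      show "w \<in> D" using l(1) r(1) by (cases "w \<le> t0") auto
    qed
    then show ?thesis using l(2) r(2) t0(2) by blast
  next
    case False
    then have "D \<subseteq> {t0..}" by (auto simp: not_less)
    then have "D = {t0..}" using r(1) by blast
    then show ?thesis using r(2) t0(2) by blast
  qed
next
  case False
  then have le: "D \<subseteq> {..t0}" by (auto simp: not_less)
  obtain a d where "a \<in> D" "d \<in> D" "a < d" by (rule nondegenerate)
  moreover have "d \<le> t0" using le \<open>d \<in> D\<close> by auto
  ultimately have "a \<in> D" "a < t0" by auto
  note l = backward_to_apex[OF t0 this]
  then have "D = {..t0}" using le by blast
  then show ?thesis using l(2) t0(2) by blast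
qed

end

theorem corollary5p3:
  fixes M :: "'a pf_surface" and x :: 'a and D :: "real set" and c :: "real \<Rightarrow> 'a tpoint"
  assumes "pf_finsler_surface M"
    and "x \<in> pf_vertices M"
    and "maximal_geodesic M x D c"
  shows
    "(D = UNIV \<and> (\<forall>t. c t \<noteq> apex M x) \<and>
      (\<exists>(m::nat) (C :: nat \<Rightarrow> 'a set) (s :: nat \<Rightarrow> real) (v :: nat \<Rightarrow> real^2).
         1 \<le> m \<and> consecutive_cones M x m C \<and>
         (\<forall>i\<in>{1..m}. c (s i) \<noteq> apex M x \<and>
            c (s i) \<in> mcone M x (C (i - 1)) \<inter> mcone M x (C i)) \<and>
         straight_on M x c {..s 1} (C 0) (v 0) \<and> \<not> in_edge M x (c ` {..s 1}) \<and>
         (\<forall>i\<in>{1..<m}. s i < s (i + 1) \<and>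
            straight_on M x c {s i..s (i + 1)} (C i) (v i) \<and>
            \<not> in_edge M x (c ` {s i..s (i + 1)})) \<and>
         straight_on M x c {s m..} (C m) (v m) \<and> \<not> in_edge M x (c ` {s m..})))
     \<or> (\<exists>t0 T v. c t0 = apex M x \<and>
          (D = {..t0} \<and> straight_on M x c {..t0} T v \<or>
           D = {t0..} \<and> straight_on M x c {t0..} T v))
     \<or> (D = UNIV \<and> (\<exists>t0 T\<^sub>1 v\<^sub>1 T\<^sub>2 v\<^sub>2. c t0 = apex M x \<and>
          straight_on M x c {..t0} T\<^sub>1 v\<^sub>1 \<and> straight_on M x c {t0..} T\<^sub>2 v\<^sub>2))"
proof -
  interpret S: pf_surface_at_vertex M x using assms(1,2) by (rule pf_surface_at_vertex.intro)
  obtain co where co: "cone_structure M x S.vedges S.edge_vector co" using S.cone_structure_exists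
      by blast
  have geo: "geodesic M x D c" using assms(3) unfolding maximal_geodesic_def by (rule conjunct1)
  obtain \<sigma> where \<sigma>: "\<sigma> > 0" "const_speed M x D c \<sigma>" using geo unfolding geodesic_iff by blast
  interpret G: maximal_cone_geodesic M x S.vedges S.edge_vector co D c \<sigma>
    by (intro maximal_cone_geodesic.intro cone_geodesic.intro co cone_geodesic_axioms.intro
        maximal_cone_geodesic_axioms.intro geo \<sigma> assms(3))
  show ?thesis
  proof (cases "\<exists>t\<in>D. c t = apex M x")
    case True
    then obtain t0 where "t0 \<in> D" "c t0 = apex M x" by blast
    from G.apex_geodesic[OF this] show ?thesis by (rule disjI2)
  next
    case False
    then have "c t \<noteq> apex M x" if "t \<in> D" for t using that by blast
    then show ?thesis by (intro disjI1 G.crossing_geodesic)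
  qed
qed

end
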